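(* Let $1<\beta\le2$. Assume that $\phi\in\mathcal F$ is a real-valued and Lipschitz continuous function on $X_\beta$ with $|e^{S_n\phi}|_\infty/\lambda_\phi^n\to0$ as $n\to\infty$. Then the transfer operator $\mathcal L_\phi:\mathcal F\to\mathcal F$ is quasi-compact; that is, every spectral value $\lambda$ of $\mathcal L_\phi$ with $|\lambda|>r_\phi$ is an isolated eigenvalue with finite multiplicity. In particular, $\lambda_\phi$ is a positive isolated eigenvalue with finite multiplicity.
   Context: For $1<\beta\le2$, $\tau_\beta(x)=\beta x-[\beta x]$ on $[0,1]$ and $g_n(x)=[\beta\tau_\beta^{n-1}(x)]$ are the greedy digits of $x$. $\{0,1\}^{\mathbb N}$ carries the product topology, the lexicographic order $\preceq$ and the left shift $\sigma$. $\underline0=000\cdots$ and $\underline1=(q_n(1))_{n\ge1}:=\lim_{y\nearrow1}(g_n(y))_{n\ge1}$ (quasi-greedy expansion of $1$). The beta-shift is $X_\beta=\{\underline x\in\{0,1\}^{\mathbb N}:\sigma^n(\underline x)\preceq\underline1\ \forall n\ge0\}$ with the map $\sigma$, and Lipschitz continuity is with respect to the metric $d_\beta(\underline x,\underline y)=\beta^{-\min\{k\ge0:x_{k+1}\ne y_{k+1}\}}$ for $\underline x\ne\underline y$. Function spaces: for $f:X_\beta\to\mathbb C$, $\mathrm{var}(f)$ is the supremum of $\sum_{i=1}^n|f(x_i)-f(x_{i-1})|$ over finite chains $\underline0=x_0\prec x_1\prec\dots\prec x_n=\underline1$ in $X_\beta$; $BV=\{f:\mathrm{var}(f)<\infty\}$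 with norm $\|f\|_{BV}=|f|_\infty+\mathrm{var}(f)$, $|f|_\infty=\sup|f|$. $\mathcal N$ is the set of $f\in BV$ vanishing off a countable set, $\mathcal B=BV/\mathcal N$ with the quotient norm, and $\mathcal F\subset\mathcal B$ is the closure in $\mathcal B$ of the linear span of indicator functions of intervals in $X_\beta$. $\mathcal F^*$ is the dual Banach space. For real-valued $\phi\in\mathcal F$: $\mathcal L_\phi f(x)=\sum_{y:\sigma(y)=x}e^{\phi(y)}f(y)$, a bounded operator on $\mathcal F$; $\mathcal L_\phi^*\nu=\nu\circ\mathcal L_\phi$ on $\mathcal F^*$; $S_n\phi=\sum_{i=0}^{n-1}\phi\circ\sigma^i$; $r_\phi=\limsup_{n\to\infty}|e^{S_n\phi}|_\infty^{1/n}$. $\lambda_\phi>0$ and $\nu_\phi\in\mathcal F^*$ denote a pair with $\mathcal L_\phi^*\nu_\phi=\lambda_\phi\nu_\phi$, $\nu_\phi(f)\ge0$ for $f\ge0$ and $\nu_\phi(1)=1$ (such a pair exists). Multiplicity means algebraic multiplicity, i.e. the dimension of the generalized eigenspace in $\mathcal F$. *)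

theory Defs
  imports "HOL-Analysis.Analysis" "HOL-Library.Fun_Lexorder"
begin

section \<open>The beta-shift\<close>

text \<open>
  Sequences are indexed from 0: the digit written $x_{k+1}$ on paper is \<open>x k\<close>.  The type
  \<open>nat \<Rightarrow> int\<close> carries the product topology of the discrete topology on the integers;
  binary sequences are those with range in \<open>{0, 1}\<close>.
\<close>

type_synonym bseq = "nat \<Rightarrow> int"

definition beta_map :: "real \<Rightarrow> real \<Rightarrow> real" where
  "beta_map \<beta> x = \<beta> * x - of_int \<lfloor>\<beta> * x\<rfloor>"

definition greedy_digits :: "real \<Rightarrow> real \<Rightarrow> bseq" where
  "greedy_digits \<beta> x = (\<lambda>n. \<lfloor>\<beta> * (beta_map \<beta> ^^ n) x\<rfloor>)"

definition zero_seq :: bseq where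
  "zero_seq = (\<lambda>_. 0)"

text \<open>The limit is taken in the product topology.\<close>

definition one_seq :: "real \<Rightarrow> bseq" where
  "one_seq \<beta> = (THE q. (greedy_digits \<beta> \<longlongrightarrow> q) (at_left 1))"

definition shift :: "bseq \<Rightarrow> bseq" where
  "shift x = (\<lambda>n. x (Suc n))"

definition lex_le :: "bseq \<Rightarrow> bseq \<Rightarrow> bool" where
  "lex_le x y \<longleftrightarrow> less_fun x y \<or> x = y"

definition beta_shift :: "real \<Rightarrow> bseq set" where
  "beta_shift \<beta> = {x. range x \<subseteq> {0, 1} \<and> (\<forall>n. lex_le ((shift ^^ n) x) (one_seq \<beta>))}"

definition beta_dist :: "real \<Rightarrow> bseq \<Rightarrow> bseq \<Rightarrow> real" where
  "beta_dist \<beta> x y = (if x = y then 0 else 1 / \<beta> ^ (LEAST k. x k \<noteq> y k))"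

definition beta_lipschitz :: "real \<Rightarrow> (bseq \<Rightarrow> real) \<Rightarrow> bool" where
  "beta_lipschitz \<beta> \<phi> \<longleftrightarrow>
     (\<exists>K. \<forall>x\<in>beta_shift \<beta>. \<forall>y\<in>beta_shift \<beta>. \<bar>\<phi> x - \<phi> y\<bar> \<le> K * beta_dist \<beta> x y)"

text \<open>Intervals are the order-convex subsets of the beta-shift.\<close>

definition beta_intervals :: "real \<Rightarrow> bseq set set" where
  "beta_intervals \<beta> = {I. I \<subseteq> beta_shift \<beta> \<and>
     (\<forall>x\<in>I. \<forall>z\<in>I. \<forall>y\<in>beta_shift \<beta>. lex_le x y \<and> lex_le y z \<longrightarrow> y \<in> I)}"


section \<open>Functions of bounded variation modulo null functions\<close>

text \<open>
  A function on the beta-shift is represented by a function on all of \<open>bseq\<close>.  Only its values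
  on \<open>beta_shift \<beta>\<close> ever matter: functions that agree there differ by an element of
  \<open>BV_null \<beta>\<close> and have the same norm, so they are the same element of the quotient.
\<close>

definition sup_norm :: "real \<Rightarrow> (bseq \<Rightarrow> 'a::real_normed_vector) \<Rightarrow> real" where
  "sup_norm \<beta> f = (SUP x\<in>beta_shift \<beta>. norm (f x))"

definition beta_chains :: "real \<Rightarrow> (nat \<times> (nat \<Rightarrow> bseq)) set" where
  "beta_chains \<beta> = {(n, x). x 0 = zero_seq \<and> x n = one_seq \<beta> \<and>
     (\<forall>i\<le>n. x i \<in> beta_shift \<beta>) \<and> (\<forall>i<n. less_fun (x i) (x (Suc i)))}"

definition var :: "real \<Rightarrow> (bseq \<Rightarrow> complex) \<Rightarrow> ennreal" where
  "var \<beta> f = (SUP (n, x)\<in>beta_chains \<beta>. ennreal (\<Sum>i<n. cmod (f (x (Suc i)) - f (x i))))"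

definition BV :: "real \<Rightarrow> (bseq \<Rightarrow> complex) set" where
  "BV \<beta> = {f. var \<beta> f < \<infinity>}"

definition BV_norm :: "real \<Rightarrow> (bseq \<Rightarrow> complex) \<Rightarrow> real" where
  "BV_norm \<beta> f = sup_norm \<beta> f + enn2real (var \<beta> f)"

definition BV_null :: "real \<Rightarrow> (bseq \<Rightarrow> complex) set" where
  "BV_null \<beta> = {f \<in> BV \<beta>. countable {x \<in> beta_shift \<beta>. f x \<noteq> 0}}"

definition BV_rel :: "real \<Rightarrow> ((bseq \<Rightarrow> complex) \<times> (bseq \<Rightarrow> complex)) set" where
  "BV_rel \<beta> = {(f, g). f \<in> BV \<beta> \<and> g \<in> BV \<beta> \<and> (\<lambda>x. f x - g x) \<in> BV_null \<beta>}"

type_synonym bclass = "(bseq \<Rightarrow> complex) set"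

definition quot_space :: "real \<Rightarrow> bclass set" where
  "quot_space \<beta> = BV \<beta> // BV_rel \<beta>"

text \<open>
  If \<open>f\<close> is not in \<open>BV \<beta>\<close>, then \<open>cls \<beta> f\<close> is empty and hence not an element of
  \<open>quot_space \<beta>\<close>.
\<close>

definition cls :: "real \<Rightarrow> (bseq \<Rightarrow> complex) \<Rightarrow> bclass" where
  "cls \<beta> f = BV_rel \<beta> `` {f}"

text \<open>
  Operations on \<open>BV \<beta>\<close> are lifted to classes as in \<open>HOL.Equiv_Relations\<close>: the unions
  over representatives range over copies of one and the same class.
\<close>

definition qzero :: "real \<Rightarrow> bclass" where
  "qzero \<beta> = cls \<beta> (\<lambda>_. 0)"

definition qadd :: "real \<Rightarrow> bclass \<Rightarrow> bclass \<Rightarrow> bclass" where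
  "qadd \<beta> A B = (\<Union>f\<in>A. \<Union>g\<in>B. cls \<beta> (\<lambda>x. f x + g x))"

definition qdiff :: "real \<Rightarrow> bclass \<Rightarrow> bclass \<Rightarrow> bclass" where
  "qdiff \<beta> A B = (\<Union>f\<in>A. \<Union>g\<in>B. cls \<beta> (\<lambda>x. f x - g x))"

definition qscale :: "real \<Rightarrow> complex \<Rightarrow> bclass \<Rightarrow> bclass" where
  "qscale \<beta> c A = (\<Union>f\<in>A. cls \<beta> (\<lambda>x. c * f x))"

definition qnorm :: "real \<Rightarrow> bclass \<Rightarrow> real" where
  "qnorm \<beta> A = (INF f\<in>A. BV_norm \<beta> f)"

definition qspan :: "real \<Rightarrow> bclass set \<Rightarrow> bclass set" where
  "qspan \<beta> S = {cls \<beta> (\<lambda>x. \<Sum>i<m. c i * f i x) | (m::nat) c f. \<forall>i<m. \<exists>A\<in>S. f i \<in> A}"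

definition F_space :: "real \<Rightarrow> bclass set" where
  "F_space \<beta> = {A \<in> quot_space \<beta>. \<forall>\<epsilon>>0.
     \<exists>G\<in>qspan \<beta> ((\<lambda>I. cls \<beta> (indicator I)) ` beta_intervals \<beta>). qnorm \<beta> (qdiff \<beta> A G) < \<epsilon>}"


section \<open>Operators and functionals on the closed span of the interval indicators\<close>

definition F_linear_op :: "real \<Rightarrow> (bclass \<Rightarrow> bclass) \<Rightarrow> bool" where
  "F_linear_op \<beta> T \<longleftrightarrow> (\<forall>A\<in>F_space \<beta>. T A \<in> F_space \<beta>) \<and>
     (\<forall>A\<in>F_space \<beta>. \<forall>B\<in>F_space \<beta>. T (qadd \<beta> A B) = qadd \<beta> (T A) (T B)) \<and>
     (\<forall>c. \<forall>A\<in>F_space \<beta>. T (qscale \<beta> c A) = qscale \<beta> c (T A))"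

definition F_bounded_op :: "real \<Rightarrow> (bclass \<Rightarrow> bclass) \<Rightarrow> bool" where
  "F_bounded_op \<beta> T \<longleftrightarrow> F_linear_op \<beta> T \<and>
     (\<exists>K. \<forall>A\<in>F_space \<beta>. qnorm \<beta> (T A) \<le> K * qnorm \<beta> A)"

definition F_dual :: "real \<Rightarrow> (bclass \<Rightarrow> complex) set" where
  "F_dual \<beta> = {\<nu>.
     (\<forall>A\<in>F_space \<beta>. \<forall>B\<in>F_space \<beta>. \<nu> (qadd \<beta> A B) = \<nu> A + \<nu> B) \<and>
     (\<forall>c. \<forall>A\<in>F_space \<beta>. \<nu> (qscale \<beta> c A) = c * \<nu> A) \<and>
     (\<exists>K. \<forall>A\<in>F_space \<beta>. cmod (\<nu> A) \<le> K * qnorm \<beta> A)}"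

definition resolvent_map :: "real \<Rightarrow> (bclass \<Rightarrow> bclass) \<Rightarrow> complex \<Rightarrow> bclass \<Rightarrow> bclass" where
  "resolvent_map \<beta> T z A = qdiff \<beta> (qscale \<beta> z A) (T A)"

definition F_spectrum :: "real \<Rightarrow> (bclass \<Rightarrow> bclass) \<Rightarrow> complex set" where
  "F_spectrum \<beta> T = {z. \<not> (\<exists>R. F_bounded_op \<beta> R \<and>
     (\<forall>A\<in>F_space \<beta>. R (resolvent_map \<beta> T z A) = A \<and> resolvent_map \<beta> T z (R A) = A))}"

definition F_eigenvalue :: "real \<Rightarrow> (bclass \<Rightarrow> bclass) \<Rightarrow> complex \<Rightarrow> bool" where
  "F_eigenvalue \<beta> T z \<longleftrightarrow> (\<exists>A\<in>F_space \<beta>. A \<noteq> qzero \<beta> \<and> T A = qscale \<beta> z A)"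

definition gen_eigenspace :: "real \<Rightarrow> (bclass \<Rightarrow> bclass) \<Rightarrow> complex \<Rightarrow> bclass set" where
  "gen_eigenspace \<beta> T z = {A \<in> F_space \<beta>. \<exists>k. (resolvent_map \<beta> T z ^^ k) A = qzero \<beta>}"

definition finite_multiplicity :: "real \<Rightarrow> (bclass \<Rightarrow> bclass) \<Rightarrow> complex \<Rightarrow> bool" where
  "finite_multiplicity \<beta> T z \<longleftrightarrow>
     (\<exists>S. finite S \<and> S \<subseteq> gen_eigenspace \<beta> T z \<and> gen_eigenspace \<beta> T z \<subseteq> qspan \<beta> S)"

definition isolated_eigenvalue_fin_mult :: "real \<Rightarrow> (bclass \<Rightarrow> bclass) \<Rightarrow> complex \<Rightarrow> bool" where
  "isolated_eigenvalue_fin_mult \<beta> T z \<longleftrightarrow>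
     F_eigenvalue \<beta> T z \<and> z isolated_in F_spectrum \<beta> T \<and> finite_multiplicity \<beta> T z"


section \<open>The transfer operator\<close>

definition transfer_fun :: "real \<Rightarrow> (bseq \<Rightarrow> real) \<Rightarrow> (bseq \<Rightarrow> complex) \<Rightarrow> bseq \<Rightarrow> complex" where
  "transfer_fun \<beta> \<phi> f x = (\<Sum>y | y \<in> beta_shift \<beta> \<and> shift y = x. of_real (exp (\<phi> y)) * f y)"

definition transfer_op :: "real \<Rightarrow> (bseq \<Rightarrow> real) \<Rightarrow> bclass \<Rightarrow> bclass" where
  "transfer_op \<beta> \<phi> A = (\<Union>f\<in>A. cls \<beta> (transfer_fun \<beta> \<phi> f))"

definition birkhoff_sum :: "nat \<Rightarrow> (bseq \<Rightarrow> real) \<Rightarrow> bseq \<Rightarrow> real" where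
  "birkhoff_sum n \<phi> x = (\<Sum>i<n. \<phi> ((shift ^^ i) x))"

definition r_phi :: "real \<Rightarrow> (bseq \<Rightarrow> real) \<Rightarrow> ereal" where
  "r_phi \<beta> \<phi> =
     limsup (\<lambda>n. ereal (root n (sup_norm \<beta> (\<lambda>x. exp (birkhoff_sum n \<phi> x)))))"

text \<open>
  For a functional with complex values, \<open>\<nu> f \<ge> 0\<close> means that \<open>\<nu> f\<close> is real and
  nonnegative.  A class is nonnegative if it has a nonnegative representative.
\<close>

definition conformal_pair ::
    "real \<Rightarrow> (bseq \<Rightarrow> real) \<Rightarrow> real \<Rightarrow> (bclass \<Rightarrow> complex) \<Rightarrow> bool" where
  "conformal_pair \<beta> \<phi> l \<nu> \<longleftrightarrow> l > 0 \<and> \<nu> \<in> F_dual \<beta> \<and>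
     (\<forall>A\<in>F_space \<beta>. \<nu> (transfer_op \<beta> \<phi> A) = of_real l * \<nu> A) \<and>
     (\<forall>f. cls \<beta> f \<in> F_space \<beta> \<and> (\<forall>x\<in>beta_shift \<beta>. f x \<in> \<real>\<^sub>\<ge>\<^sub>0) \<longrightarrow> \<nu> (cls \<beta> f) \<in> \<real>\<^sub>\<ge>\<^sub>0) \<and>
     \<nu> (cls \<beta> (\<lambda>_. 1)) = 1"

definition quasi_compact :: "real \<Rightarrow> (bseq \<Rightarrow> real) \<Rightarrow> bool" where
  "quasi_compact \<beta> \<phi> \<longleftrightarrow>
     (\<forall>z\<in>F_spectrum \<beta> (transfer_op \<beta> \<phi>). ereal (cmod z) > r_phi \<beta> \<phi> \<longrightarrow>
        isolated_eigenvalue_fin_mult \<beta> (transfer_op \<beta> \<phi>) z)"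

end

theory Submission
  imports Defs "HOL-Library.Diagonal_Subsequence" "HOL-Library.Function_Algebras"
begin

text \<open>
  Let $L$ be the transfer operator.  For a word $w$ of length $n$ the inverse branch
  $x \mapsto wx$ is defined on an initial segment of the beta-shift, and $L^n f$ is the sum over $w$
  of the products of $e^{S_n\phi}$ and $f$ along these branches.  If $f$ is at most $2^{-n}$ at one
  point of every cylinder, then it is at most $2^{-n}$ plus its variation on the cylinder
  throughout, and since the variations on the cylinders add up to at most $\mathrm{var}(f)$, the
  $BV$-norm of $L^n f$ is $O(n\,|e^{S_n\phi}|_\infty)$ times $1 + \|f\|_{BV}$.  As there are only
  finitely many cylinders, every sequence in the unit ball has a subsequence whose images under
  $L^n$ are pairwise at distance $O(n\,|e^{S_n\phi}|_\infty)$.  This formulation by subsequences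
  passes to the quotient and to $\mathcal F$.

  Such a noncompactness bound for the powers of an operator gives quasi-compactness by Riesz's
  argument.  A flag of finite-dimensional invariant subspaces with eigenvalues of modulus at least
  $\rho > r_\phi$ cannot be infinite, so there are only finitely many such eigenvalues and their
  generalized eigenspaces are finite-dimensional.  A boundary point of the spectrum of modulus
  above $\rho$ has approximate eigenvectors, and these have a convergent subsequence, so it is an
  eigenvalue.  The complement of the disc of radius $\rho$ minus the finitely many eigenvalues is
  connected and contains no boundary point of the spectrum, so it lies in the resolvent set.
\<close>


section \<open>Riesz theory on a complete seminormed space\<close>

text \<open>Classes are sets of functions without a vector space type. The Riesz theory is therefore
  set up for a seminorm whose null vectors play the role of 0, and it is applied to functions on the
  shift with the quotient norm pulled back to them. Boundedness below together with surjectivity up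
  to null vectors replaces the resolvent, and Banach's fixed point theorem replaces the Neumann
  series.

  The factor n comes from the weights: on a cylinder of length n the variation of S_n \<phi> is at
  most n times the norm of \<phi>, and n-th roots do not see this. The tolerance 2^-n compensates
  for the number of cylinders, since each of them contributes the size of f at its sample point.

  For \<lambda> as the conformal eigenvalue two further facts enter. The suprema of e^(S_n \<phi>)
  are submultiplicative, so the convergence of their quotients by \<lambda>^n to 0 already forces
  r_\<phi> < \<lambda>. And the conformal functional vanishes on the range of \<lambda> - L but not
  on the constant 1, so \<lambda> is a spectral value.\<close>

locale seminormed_operator = vector_space scale
  for scale :: "complex \<Rightarrow> 'a::ab_group_add \<Rightarrow> 'a" (infixr \<open>\<odot>\<close> 75) +
  fixes V :: "'a set" and p :: "'a \<Rightarrow> real" and T :: "'a \<Rightarrow> 'a" and B :: real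
  assumes V: "subspace V"
    and p_add: "\<And>x y. x \<in> V \<Longrightarrow> y \<in> V \<Longrightarrow> p (x + y) \<le> p x + p y"
    and p_scale: "\<And>c x. x \<in> V \<Longrightarrow> p (c \<odot> x) = cmod c * p x"
    and T_in: "\<And>x. x \<in> V \<Longrightarrow> T x \<in> V"
    and T_add: "\<And>x y. x \<in> V \<Longrightarrow> y \<in> V \<Longrightarrow> T (x + y) = T x + T y"
    and T_scale: "\<And>c x. x \<in> V \<Longrightarrow> T (c \<odot> x) = c \<odot> T x"
    and B_nonneg: "0 \<le> B"
    and T_bound: "\<And>x. x \<in> V \<Longrightarrow> p (T x) \<le> B * p x"
    and complete: "\<And>X. range X \<subseteq> V \<Longrightarrow> \<forall>e>0. \<exists>N. \<forall>m\<ge>N. \<forall>n\<ge>N. p (X m - X n) < e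
      \<Longrightarrow> \<exists>l\<in>V. (\<lambda>n. p (X n - l)) \<longlonglongrightarrow> 0"
begin

section \<open>Elementary rules for the seminorm and for \<open>z - T\<close>\<close>

lemma V_add [simp, intro]: "x \<in> V \<Longrightarrow> y \<in> V \<Longrightarrow> x + y \<in> V"
  and V_diff [simp, intro]: "x \<in> V \<Longrightarrow> y \<in> V \<Longrightarrow> x - y \<in> V"
  and V_scale [simp, intro]: "x \<in> V \<Longrightarrow> c \<odot> x \<in> V"
  and V_zero [simp, intro]: "0 \<in> V"
  using V by (auto simp: subspace_add subspace_diff subspace_scale subspace_0)

lemma V_minus [simp, intro]: "x \<in> V \<Longrightarrow> - x \<in> V"
  using V_diff[of 0 x] by simp

lemmas T_V [simp, intro] = T_in

lemma p_zero [simp]: "p 0 = 0"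
  using p_scale[of 0 0] by simp

lemma p_minus: "x \<in> V \<Longrightarrow> p (- x) = p x"
  using p_scale[of x "-1"] by simp

lemma p_commute: "x \<in> V \<Longrightarrow> y \<in> V \<Longrightarrow> p (x - y) = p (y - x)"
  using p_minus[of "x - y"] by simp

lemma p_nonneg: assumes "x \<in> V" shows "0 \<le> p x"
  using p_add[of x "- x"] p_minus[OF assms] assms by simp

lemma p_diff: "x \<in> V \<Longrightarrow> y \<in> V \<Longrightarrow> p (x - y) \<le> p x + p y"
  using p_add[of x "- y"] p_minus[of y] by simp

lemma p_diff_trans:
  assumes "x \<in> V" "y \<in> V" "z \<in> V" shows "p (x - z) \<le> p (x - y) + p (y - z)"
  using p_add[of "x - y" "y - z"] assms by simp

lemma p_reverse: "x \<in> V \<Longrightarrow> y \<in> V \<Longrightarrow> p x \<le> p y + p (x - y)"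
  using p_add[of y "x - y"] by simp

lemma p_diff_add:
  assumes "x \<in> V" "y \<in> V" "z \<in> V" shows "p (x - y + z) \<le> p x + p y + p z"
  using p_add[of "x - y" z] p_diff[of x y] assms by simp

lemma T_diff: assumes "x \<in> V" "y \<in> V" shows "T (x - y) = T x - T y"
  using T_add[of "x - y" y] assms by (simp add: algebra_simps)

lemma T_pow_V [simp, intro]: "x \<in> V \<Longrightarrow> (T ^^ m) x \<in> V"
  by (induction m) auto

definition A :: "complex \<Rightarrow> 'a \<Rightarrow> 'a" where
  "A z x = z \<odot> x - T x"

lemma A_V [simp, intro]: "x \<in> V \<Longrightarrow> A z x \<in> V"
  by (simp add: A_def)

lemma A_add: "x \<in> V \<Longrightarrow> y \<in> V \<Longrightarrow> A z (x + y) = A z x + A z y"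
  by (simp add: A_def T_add scale_right_distrib)

lemma A_diff: "x \<in> V \<Longrightarrow> y \<in> V \<Longrightarrow> A z (x - y) = A z x - A z y"
  by (simp add: A_def T_diff scale_right_diff_distrib)

lemma A_scale: "x \<in> V \<Longrightarrow> A z (c \<odot> x) = c \<odot> A z x"
  by (simp add: A_def T_scale scale_right_diff_distrib scale_left_commute)

lemma A_shift: "A w x = A z x + (w - z) \<odot> x"
  by (simp add: A_def scale_left_diff_distrib)

lemma A_commute: assumes "x \<in> V" shows "A z (A w x) = A w (A z x)"
  using assms by (simp add: A_def T_diff T_scale scale_right_diff_distrib scale_left_commute)

lemma A_bound: assumes "x \<in> V" shows "p (A z x) \<le> (cmod z + B) * p x"
  using p_diff[of "z \<odot> x" "T x"] T_bound[OF assms] assms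
  by (simp add: A_def p_scale algebra_simps)

lemma A_pow_V [simp, intro]: "x \<in> V \<Longrightarrow> (A z ^^ k) x \<in> V"
  by (induction k) auto

section \<open>The resolvent set modulo vectors of seminorm 0\<close>

text \<open>As \<open>p\<close> is only a seminorm, being in the resolvent set is expressed without an inverse
  operator: \<open>A z\<close> is bounded below and surjective up to vectors of seminorm 0.\<close>

definition good :: "complex \<Rightarrow> bool" where
  "good z \<longleftrightarrow> (\<exists>K. \<forall>x\<in>V. p x \<le> K * p (A z x)) \<and> (\<forall>y\<in>V. \<exists>x\<in>V. p (A z x - y) = 0)"

text \<open>This concerns the map that \<open>T\<close> induces on \<open>V\<close> modulo the
  vectors of seminorm 0.\<close>

definition eigenvalue :: "complex \<Rightarrow> bool" where
  "eigenvalue z \<longleftrightarrow> (\<exists>x\<in>V. p x \<noteq> 0 \<and> p (A z x) = 0)"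

text \<open>Banach's argument: the iterates of 0 form a Cauchy sequence. As limits are determined
  only up to seminorm 0, so is the fixed point.\<close>

lemma contraction_fixed_point:
  assumes G: "\<And>x. x \<in> V \<Longrightarrow> G x \<in> V" and c: "0 \<le> c" "c < 1"
    and lip: "\<And>x y. x \<in> V \<Longrightarrow> y \<in> V \<Longrightarrow> p (G x - G y) \<le> c * p (x - y)"
  shows "\<exists>x\<in>V. p (G x - x) = 0"
proof -
  define X where "X n = (G ^^ n) 0" for n
  define D where "D = p (G 0)"
  have XV [simp]: "X n \<in> V" for n
    by (induction n) (auto simp: X_def G)
  have D: "0 \<le> D" by (simp add: D_def G p_nonneg)
  \<comment> \<open>\<open>D / (1 - c)\<close> is the fixed point of
    \<open>t \<mapsto> c * t + D\<close>, so the bound reproduces itself in the induction and no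
    geometric series has to be summed.\<close>
  have base: "p (X k - X 0) \<le> D / (1 - c)" for k
  proof (induction k)
    case 0
    show ?case using c D by simp
  next
    case (Suc k)
    have "p (X (Suc k) - X 0) \<le> p (X (Suc k) - X 1) + p (X 1 - X 0)"
      by (rule p_diff_trans) auto
    also have "p (X (Suc k) - X 1) \<le> c * p (X k - X 0)"
      using lip[OF XV[of k] XV[of 0]] by (simp add: X_def)
    also have "\<dots> \<le> c * (D / (1 - c))" using Suc c by (intro mult_left_mono)
    also have "p (X 1 - X 0) = D" by (simp add: X_def D_def)
    finally show ?case using c by (simp add: field_simps)
  qed
  have 1: "p (X (n + k) - X n) \<le> c ^ n * (D / (1 - c))" for n k
  proof (induction n)
    case 0
    show ?case using base[of k] by simp
  next
    case (Suc n)
    have "p (X (Suc n + k) - X (Suc n)) \<le> c * p (X (n + k) - X n)"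
      using lip[OF XV[of "n + k"] XV[of n]] by (simp add: X_def)
    also have "\<dots> \<le> c * (c ^ n * (D / (1 - c)))" using Suc c by (intro mult_left_mono)
    finally show ?case by simp
  qed
  have lim: "(\<lambda>n. c ^ n * (D / (1 - c))) \<longlonglongrightarrow> 0"
    using c by (intro tendsto_mult_left_zero LIMSEQ_power_zero) auto
  have "\<exists>l\<in>V. (\<lambda>n. p (X n - l)) \<longlonglongrightarrow> 0"
  proof (rule complete)
    show "\<forall>e>0. \<exists>N. \<forall>m\<ge>N. \<forall>n\<ge>N. p (X m - X n) < e"
    proof (intro allI impI)
      fix e :: real assume "e > 0"
      then have "\<forall>\<^sub>F n in sequentially. c ^ n * (D / (1 - c)) < e"
        using lim by (simp add: order_tendsto_iff)
      then obtain N where N: "\<And>n. n \<ge> N \<Longrightarrow> c ^ n * (D / (1 - c)) < e"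
        by (auto simp: eventually_sequentially)
      have "p (X m - X n) < e" if "m \<ge> N" "n \<ge> N" for m n
      proof (cases "n \<le> m")
        case True
        then show ?thesis using 1[of n "m - n"] N[OF \<open>n \<ge> N\<close>] by simp
      next
        case False
        then show ?thesis using 1[of m "n - m"] N[OF \<open>m \<ge> N\<close>] p_commute[of "X n" "X m"] by simp
      qed
      then show "\<exists>N. \<forall>m\<ge>N. \<forall>n\<ge>N. p (X m - X n) < e" by blast
    qed
  qed auto
  then obtain l where l: "l \<in> V" "(\<lambda>n. p (X n - l)) \<longlonglongrightarrow> 0" by blast
  have "p (G l - l) \<le> c * p (X n - l) + p (X (Suc n) - l)" for n
  proof -
    have "p (G l - l) \<le> p (G l - X (Suc n)) + p (X (Suc n) - l)"
      using l by (intro p_diff_trans) (auto simp: G)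
    also have "p (G l - X (Suc n)) \<le> c * p (l - X n)"
      using lip[OF l(1) XV[of n]] by (simp add: X_def)
    finally show ?thesis using l p_commute by simp
  qed
  moreover have "(\<lambda>n. c * p (X n - l) + p (X (Suc n) - l)) \<longlonglongrightarrow> c * 0 + 0"
    by (rule tendsto_add[OF tendsto_mult[OF tendsto_const l(2)] LIMSEQ_Suc[OF l(2)]])
  ultimately have "p (G l - l) \<le> c * 0 + 0"
    by (intro LIMSEQ_le_const) auto
  then show ?thesis using l p_nonneg[of "G l - l"] G by (intro bexI[of _ l]) auto
qed

text \<open>The perturbation \<open>(w - z) \<odot> x\<close> is too small to destroy the lower
  bound for \<open>A z\<close>. Solving \<open>A w x = y\<close> amounts to a fixed point of the map
  that sends \<open>x\<close> to a preimage of \<open>y - (w - z) \<odot> x\<close> under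
  \<open>A z\<close>, a contraction with factor \<open>cmod (w - z) * K\<close>.\<close>

lemma good_near:
  assumes K: "\<And>x. x \<in> V \<Longrightarrow> p x \<le> K * p (A z x)" and surj: "\<And>y. y \<in> V \<Longrightarrow> \<exists>x\<in>V. p (A z x - y) = 0"
    and K0: "0 \<le> K" and w: "cmod (w - z) * K < 1"
  shows "good w"
  unfolding good_def
proof (intro conjI ballI exI)
  fix x assume x: "x \<in> V"
  have "p x \<le> K * p (A z x)" by (rule K) fact
  also have "p (A z x) \<le> p (A w x) + p ((w - z) \<odot> x)"
    using p_diff[of "A w x" "(w - z) \<odot> x"] x A_shift[of w x z] by simp
  finally have "p x \<le> K * p (A w x) + K * (cmod (w - z) * p x)"
    using K0 x by (simp add: p_scale mult_left_mono distrib_left flip: distrib_left)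
  then have "(1 - cmod (w - z) * K) * p x \<le> K * p (A w x)"
    by (simp add: algebra_simps)
  then show "p x \<le> K / (1 - cmod (w - z) * K) * p (A w x)"
    using w by (simp add: field_simps)
next
  fix y assume y: "y \<in> V"
  \<comment> \<open>The chosen right inverse \<open>S\<close> need not be linear; the Lipschitz
    bound for \<open>G\<close> comes from applying \<open>K\<close> to
    \<open>G x - G x'\<close>.\<close>
  obtain S where S: "\<And>v. v \<in> V \<Longrightarrow> S v \<in> V" "\<And>v. v \<in> V \<Longrightarrow> p (A z (S v) - v) = 0"
    using surj by metis
  define G where "G x = S (y - (w - z) \<odot> x)" for x
  have GV [simp]: "G x \<in> V" if "x \<in> V" for x using that y by (simp add: G_def S)
  have Geq: "p (A z (G x) - (y - (w - z) \<odot> x)) = 0" if "x \<in> V" for x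
    using that y by (simp add: G_def S)
  have "\<exists>x\<in>V. p (G x - x) = 0"
  proof (rule contraction_fixed_point[where c = "cmod (w - z) * K"])
    fix x x' assume x: "x \<in> V" "x' \<in> V"
    have "p (G x - G x') \<le> K * p (A z (G x - G x'))" using x by (intro K) auto
    also have "A z (G x - G x') = (A z (G x) - (y - (w - z) \<odot> x)) - (A z (G x') - (y - (w - z) \<odot> x'))
        + (w - z) \<odot> (x' - x)"
      using x by (simp add: A_diff scale_right_diff_distrib)
    also have "p \<dots> \<le> (0 + 0) + cmod (w - z) * p (x' - x)"
      using x y Geq
        p_diff_add[of "A z (G x) - (y - (w - z) \<odot> x)" "A z (G x') - (y - (w - z) \<odot> x')" "(w - z) \<odot> (x' - x)"]
      by (simp add: p_scale)
    finally show "p (G x - G x') \<le> cmod (w - z) * K * p (x - x')"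
      using K0 x p_commute[of x x'] mult_left_mono[of _ _ K] by (fastforce simp: mult_ac)
  qed (use K0 w in auto)
  then obtain x where x: "x \<in> V" "p (G x - x) = 0" by blast
  have "A w x - y = (A z (G x) - (y - (w - z) \<odot> x)) - A z (G x - x)"
    using x by (simp add: A_diff A_shift[of w x z])
  also have "p \<dots> \<le> p (A z (G x) - (y - (w - z) \<odot> x)) + p (A z (G x - x))"
    using x y by (intro p_diff) auto
  also have "\<dots> \<le> 0 + (cmod z + B) * 0"
    using x Geq A_bound[of "G x - x" z] by (intro add_mono) auto
  finally show "\<exists>x\<in>V. p (A w x - y) = 0"
    using x y p_nonneg[of "A w x - y"] by (intro bexI[of _ x]) auto
qed

text \<open>The equation \<open>z x - T x = y\<close> is the fixed point equation of
  \<open>x \<mapsto> (y + T x) / z\<close>, with contraction factor \<open>B / |z|\<close>; the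
  lower bound is the triangle inequality.\<close>

lemma good_large:
  assumes z: "B < cmod z" shows "good z"
  unfolding good_def
proof (intro conjI ballI exI)
  fix x assume x: "x \<in> V"
  have "cmod z * p x \<le> p (A z x) + p (T x)"
    using p_add[of "A z x" "T x"] x by (simp add: A_def flip: p_scale)
  then have "(cmod z - B) * p x \<le> p (A z x)"
    using T_bound[OF x] by (simp add: algebra_simps)
  then show "p x \<le> 1 / (cmod z - B) * p (A z x)"
    using z by (simp add: field_simps)
next
  fix y assume y: "y \<in> V"
  have z0: "z \<noteq> 0" using z B_nonneg by auto
  define G where "G x = (1 / z) \<odot> (y + T x)" for x
  have "\<exists>x\<in>V. p (G x - x) = 0"
  proof (rule contraction_fixed_point[where c = "B / cmod z"])
    fix x x' assume x: "x \<in> V" "x' \<in> V"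
    have "G x - G x' = (1 / z) \<odot> T (x - x')"
      using x y by (simp add: G_def T_diff flip: scale_right_diff_distrib)
    then show "p (G x - G x') \<le> B / cmod z * p (x - x')"
      using x T_bound[of "x - x'"] by (simp add: p_scale norm_divide divide_right_mono)
  qed (use z B_nonneg y z0 in \<open>auto simp: G_def field_simps\<close>)
  then obtain x where x: "x \<in> V" "p (G x - x) = 0" by blast
  have "A z x - y = - (z \<odot> (G x - x))"
    using z0 by (simp add: A_def G_def scale_right_diff_distrib)
  then have "p (A z x - y) = 0"
    using x y by (simp add: p_minus p_scale G_def)
  then show "\<exists>x\<in>V. p (A z x - y) = 0" using x by blast
qed

text \<open>If \<open>A z\<close> were bounded below by \<open>e\<close>, then for a good
  \<open>w\<close> at distance less than \<open>e / 4\<close> the map \<open>A w\<close> would be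
  bounded below by \<open>3 e / 4\<close>, hence by \<open>e / 2\<close>. The neighbourhood of
  \<open>w\<close> given by \<open>good_near\<close> has radius \<open>e / 2\<close> and would
  contain \<open>z\<close>.\<close>

lemma approximate_eigenvector:
  assumes cl: "z \<in> closure {w. good w}" and bad: "\<not> good z" and e: "0 < e"
  shows "\<exists>x\<in>V. p x = 1 \<and> p (A z x) < e"
proof (rule ccontr)
  assume "\<not> ?thesis"
  then have *: "e \<le> p (A z x)" if "x \<in> V" "p x = 1" for x using that by force
  have below: "e * p x \<le> p (A z x)" if x: "x \<in> V" for x
  proof (cases "p x = 0")
    case True
    then show ?thesis using p_nonneg[of "A z x"] x by simp
  next
    case False
    then have px: "p x > 0" using p_nonneg[OF x] by simp
    then show ?thesis
      using *[of "complex_of_real (1 / p x) \<odot> x"] x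
      by (simp add: p_scale A_scale norm_divide field_simps del: of_real_divide)
  qed
  obtain w where w: "good w" "dist w z < e / 4"
    using cl e unfolding closure_approachable by (metis mem_Collect_eq zero_less_divide_iff zero_less_numeral)
  have wz: "cmod (w - z) < e / 4" using w by (simp add: dist_norm)
  have K: "p x \<le> (2 / e) * p (A w x)" if x: "x \<in> V" for x
  proof -
    have "e * p x \<le> p (A z x)" by (rule below) fact
    also have "\<dots> \<le> p (A w x) + cmod (w - z) * p x"
      using p_diff[of "A w x" "(w - z) \<odot> x"] x A_shift[of w x z] by (simp add: p_scale)
    also have "cmod (w - z) * p x \<le> e / 4 * p x"
      using wz p_nonneg[OF x] by (intro mult_right_mono) auto
    finally have "e * p x * 3 / 4 \<le> p (A w x)" by (simp add: algebra_simps)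
    moreover have "0 \<le> e * p x" using e p_nonneg[OF x] by simp
    ultimately have "e * p x \<le> 2 * p (A w x)" by simp
    then show ?thesis using e by (simp add: field_simps)
  qed
  have "good z"
  proof (rule good_near[OF K])
    show "\<And>y. y \<in> V \<Longrightarrow> \<exists>x\<in>V. p (A w x - y) = 0" using w by (auto simp: good_def)
    show "cmod (z - w) * (2 / e) < 1" using wz e by (simp add: norm_minus_commute field_simps)
  qed (use e in auto)
  then show False using bad by contradiction
qed

section \<open>The essential bound and boundary points of the spectrum\<close>

text \<open>A form of \<open>\<rho>\<close> being at least the essential spectral radius that is inherited by invariant
  subspaces and quotients.\<close>

definition ess_bound :: "real \<Rightarrow> bool" where
  "ess_bound \<rho> \<longleftrightarrow> (\<forall>e>0. \<exists>m. \<forall>X::nat \<Rightarrow> 'a. (\<forall>i. X i \<in> V \<and> p (X i) \<le> 1) \<longrightarrow>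
     (\<exists>s::nat \<Rightarrow> nat. strict_mono s \<and> (\<forall>i j. p ((T ^^ m) (X (s i)) - (T ^^ m) (X (s j))) \<le> e * \<rho> ^ m)))"

lemma T_pow_Suc_diff:
  assumes "x \<in> V"
  shows "(T ^^ Suc m) x - z ^ Suc m \<odot> x = T ((T ^^ m) x - z ^ m \<odot> x) - z ^ m \<odot> A z x"
  using assms by (simp add: T_diff T_scale A_def scale_right_diff_distrib mult.commute)

text \<open>\<open>T^m - z^m\<close> is a polynomial in \<open>T\<close> times \<open>A z\<close>,
  so an approximate eigenvector of \<open>T\<close> is one of \<open>T^m\<close> as well. The
  constant depends on \<open>m\<close>, which is harmless because \<open>m\<close> is fixed before
  the tail of the approximating sequence is selected.\<close>

lemma T_pow_approx:
  "\<exists>C\<ge>0. \<forall>x\<in>V. p ((T ^^ m) x - z ^ m \<odot> x) \<le> C * p (A z x)"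
proof (induction m)
  case 0
  show ?case by (auto intro!: exI[of _ 0])
next
  case (Suc m)
  then obtain C where C: "C \<ge> 0" "\<forall>x\<in>V. p ((T ^^ m) x - z ^ m \<odot> x) \<le> C * p (A z x)" by blast
  show ?case
  proof (intro exI[of _ "B * C + cmod z ^ m"] conjI ballI)
    show "0 \<le> B * C + cmod z ^ m" using C B_nonneg by simp
    fix x assume x: "x \<in> V"
    have "p ((T ^^ Suc m) x - z ^ Suc m \<odot> x) \<le> p (T ((T ^^ m) x - z ^ m \<odot> x)) + p (z ^ m \<odot> A z x)"
      unfolding T_pow_Suc_diff[OF x] using x by (intro p_diff) auto
    also have "\<dots> \<le> B * (C * p (A z x)) + cmod z ^ m * p (A z x)"
      using x C B_nonneg
      by (intro add_mono order_trans[OF T_bound] mult_left_mono) (auto simp: p_scale norm_power)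
    finally show "p ((T ^^ Suc m) x - z ^ Suc m \<odot> x) \<le> (B * C + cmod z ^ m) * p (A z x)"
      by (simp add: algebra_simps)
  qed
qed

text \<open>Along approximate eigenvectors \<open>T^m\<close> is nearly multiplication by
  \<open>z^m\<close>. A subsequence whose images under \<open>T^m\<close> are within
  \<open>e \<rho>^m\<close> of each other is therefore itself within a multiple of \<open>e\<close>,
  since \<open>\<rho> \<le> |z|\<close>. Diagonalizing over \<open>e\<close> gives a Cauchy sequence
  of unit vectors, and its limit is an eigenvector.\<close>

lemma boundary_eigenvalue:
  assumes ess: "ess_bound \<rho>" and \<rho>: "0 < \<rho>" "\<rho> \<le> cmod z"
    and cl: "z \<in> closure {w. good w}" and bad: "\<not> good z"
  shows "eigenvalue z"
proof -
  have "\<forall>k::nat. \<exists>x\<in>V. p x = 1 \<and> p (A z x) < 1 / (Suc k)"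
    using approximate_eigenvector[OF cl bad] by simp
  then obtain X where X: "\<And>k. X k \<in> V" "\<And>k. p (X k) = 1" "\<And>k::nat. p (A z (X k)) < 1 / (Suc k)"
    by metis
  have z0: "cmod z > 0" using \<rho> by linarith
  interpret subseqs "\<lambda>n s. \<forall>i j. p (X (s i) - X (s j)) \<le> 1 / (Suc n)"
  proof
    fix n :: nat and s :: "nat \<Rightarrow> nat" assume s: "strict_mono s"
    \<comment> \<open>Three errors of size \<open>e * |z|^m\<close> will occur: the distance between
      the images under \<open>T^m\<close> and the two defects of \<open>T^m\<close> from
      \<open>z^m\<close>.\<close>
    define e where "e = 1 / (3 * Suc n)"
    have e: "e > 0" by (simp add: e_def)
    obtain m where m: "\<And>X::nat \<Rightarrow> 'a. (\<forall>i. X i \<in> V \<and> p (X i) \<le> 1) \<Longrightarrow>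
     (\<exists>s::nat \<Rightarrow> nat. strict_mono s \<and> (\<forall>i j. p ((T ^^ m) (X (s i)) - (T ^^ m) (X (s j))) \<le> e * \<rho> ^ m))"
      using ess e unfolding ess_bound_def by blast
    obtain r :: "nat \<Rightarrow> nat" where r: "strict_mono r"
        "\<And>i j. p ((T ^^ m) (X (s (r i))) - (T ^^ m) (X (s (r j)))) \<le> e * \<rho> ^ m"
      using m[of "X \<circ> s"] X(1,2) by auto
    obtain C where C: "C \<ge> 0" "\<And>x. x \<in> V \<Longrightarrow> p ((T ^^ m) x - z ^ m \<odot> x) \<le> C * p (A z x)"
      using T_pow_approx[of m z] by blast
    have "(\<lambda>n. C * (1 / Suc n)) \<longlonglongrightarrow> C * 0"
      by (rule tendsto_mult[OF tendsto_const LIMSEQ_Suc[OF lim_1_over_n]])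
    then have "\<forall>\<^sub>F n in sequentially. C * (1 / Suc n) < e * cmod z ^ m"
      by (rule order_tendstoD) (use e z0 in simp)
    then obtain N where N: "\<And>n. n \<ge> N \<Longrightarrow> C * (1 / Suc n) < e * cmod z ^ m"
      by (auto simp: eventually_sequentially)
    \<comment> \<open>Dropping the first \<open>N\<close> indices makes the defects small for all
      remaining vectors and not only eventually.\<close>
    define r' where "r' i = r (i + N)" for i
    have r': "strict_mono r'" using r(1) by (auto simp: r'_def strict_mono_def)
    have big: "s (r' i) \<ge> N" for i
      using seq_suble[OF s, of "r (i + N)"] seq_suble[OF r(1), of "i + N"] by (simp add: r'_def)
    have err: "p ((T ^^ m) (X k) - z ^ m \<odot> X k) \<le> e * cmod z ^ m" if "k \<ge> N" for k
    proof -
      have "p ((T ^^ m) (X k) - z ^ m \<odot> X k) \<le> C * p (A z (X k))" by (intro C X)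
      also have "\<dots> \<le> C * (1 / Suc k)" using C(1) X(3)[of k] by (intro mult_left_mono) auto
      finally show ?thesis using N[OF that] by linarith
    qed
    show "\<exists>r'::nat \<Rightarrow> nat. strict_mono r' \<and> (\<forall>i j. p (X ((s \<circ> r') i) - X ((s \<circ> r') j)) \<le> 1 / real (Suc n))"
    proof (intro exI[of _ r'] conjI r' allI)
      fix i j
      let ?x = "X (s (r' i))" and ?y = "X (s (r' j))"
      have "z ^ m \<odot> (?x - ?y) = ((T ^^ m) ?x - (T ^^ m) ?y) - ((T ^^ m) ?x - z ^ m \<odot> ?x)
          + ((T ^^ m) ?y - z ^ m \<odot> ?y)"
        by (simp add: scale_right_diff_distrib)
      also have "p \<dots> \<le> (e * \<rho> ^ m + e * cmod z ^ m) + e * cmod z ^ m"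
        using r(2)[of "i + N" "j + N"] err[OF big] X(1)
        by (intro order_trans[OF p_diff_add] add_mono) (auto simp: r'_def)
      also have "\<dots> \<le> cmod z ^ m * (3 * e)"
        using mult_left_mono[OF power_mono[of \<rho> "cmod z" m], of e] \<rho> e by simp
      also have "p (z ^ m \<odot> (?x - ?y)) = cmod z ^ m * p (?x - ?y)"
        using X(1) by (subst p_scale) (auto simp: norm_power)
      finally have "cmod z ^ m * p (?x - ?y) \<le> cmod z ^ m * (3 * e)" .
      then show "p (X ((s \<circ> r') i) - X ((s \<circ> r') j)) \<le> 1 / real (Suc n)"
        using z0 by (simp only: mult_le_cancel_left_pos zero_less_power) (simp add: e_def field_simps)
    qed
  qed
  \<comment> \<open>From index \<open>Suc k\<close> on, the diagonal sequence is a subsequence of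
    stage \<open>k\<close>.\<close>
  have diag: "\<forall>i j. p (X ((diagseq \<circ> (+) (Suc k)) i) - X ((diagseq \<circ> (+) (Suc k)) j)) \<le> 1 / Suc k" for k
    by (rule diagseq_holds) auto
  define Y where "Y n = X (diagseq n)" for n
  have YV [simp]: "Y n \<in> V" for n by (simp add: Y_def X)
  have Yd: "p (Y m - Y n) \<le> 1 / Suc k" if "m > k" "n > k" for m n k
    using diag[of k, rule_format, of "m - Suc k" "n - Suc k"] that by (simp add: Y_def)
  have "\<exists>l\<in>V. (\<lambda>n. p (Y n - l)) \<longlonglongrightarrow> 0"
  proof (rule complete)
    show "\<forall>e>0. \<exists>N. \<forall>m\<ge>N. \<forall>n\<ge>N. p (Y m - Y n) < e"
    proof (intro allI impI)
      fix e :: real assume "e > 0"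
      then obtain k where k: "1 / Suc k < e" using nat_approx_posE by blast
      then show "\<exists>N. \<forall>m\<ge>N. \<forall>n\<ge>N. p (Y m - Y n) < e"
        using Yd[of k] by (intro exI[of _ "Suc k"]) (force simp: Suc_le_eq)
    qed
  qed auto
  then obtain l where l: "l \<in> V" "(\<lambda>n. p (Y n - l)) \<longlonglongrightarrow> 0" by blast
  \<comment> \<open>\<open>l\<close> is a limit of unit vectors, hence not a null vector.\<close>
  have "1 \<le> p l"
  proof (rule LIMSEQ_le_const)
    show "(\<lambda>n. p l + p (Y n - l)) \<longlonglongrightarrow> p l" using tendsto_add[OF tendsto_const l(2), of "p l"] by simp
    show "\<exists>N. \<forall>n\<ge>N. 1 \<le> p l + p (Y n - l)"
      using p_reverse[OF YV l(1)] X(2) by (simp add: Y_def)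
  qed
  moreover have "p (A z l) \<le> 0"
  proof (rule LIMSEQ_le_const)
    have "(\<lambda>n. (cmod z + B) * p (Y n - l) + 1 / Suc n) \<longlonglongrightarrow> (cmod z + B) * 0 + 0"
      by (rule tendsto_add[OF tendsto_mult[OF tendsto_const l(2)] LIMSEQ_Suc[OF lim_1_over_n]])
    then show "(\<lambda>n. (cmod z + B) * p (Y n - l) + 1 / Suc n) \<longlonglongrightarrow> 0" by simp
    show "\<exists>N. \<forall>n\<ge>N. p (A z l) \<le> (cmod z + B) * p (Y n - l) + 1 / Suc n"
    proof (intro exI allI impI)
      fix n :: nat
      have "p (A z l) \<le> p (A z (Y n)) + p (A z (Y n - l))"
        using p_diff[of "A z (Y n)" "A z (Y n - l)"] l by (simp add: A_diff)
      also have "p (A z (Y n)) \<le> 1 / Suc (diagseq n)" using X(3) by (simp add: Y_def less_imp_le)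
      also have "\<dots> \<le> 1 / Suc n" using seq_suble[OF subseq_diagseq, of n] by (simp add: field_simps)
      also have "p (A z (Y n - l)) \<le> (cmod z + B) * p (Y n - l)" using l by (intro A_bound) auto
      finally show "p (A z l) \<le> (cmod z + B) * p (Y n - l) + 1 / Suc n" by simp
    qed
  qed
  ultimately show ?thesis
    unfolding eigenvalue_def using l p_nonneg[of "A z l"] by (intro bexI[of _ l]) auto
qed

section \<open>Flags of finite-dimensional invariant subspaces\<close>

text \<open>\<open>W u k\<close> is the span of \<open>u 0, \<dots>, u (k - 1)\<close> and the vectors of seminorm 0.\<close>

primrec W :: "(nat \<Rightarrow> 'a) \<Rightarrow> nat \<Rightarrow> 'a set" where
  "W u 0 = {x \<in> V. p x = 0}"
| "W u (Suc k) = {x \<in> V. \<exists>c. x - c \<odot> u k \<in> W u k}"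

lemma W_subset: "W u k \<subseteq> V"
  by (cases k) auto

lemma W_V [dest]: "x \<in> W u k \<Longrightarrow> x \<in> V"
  using W_subset by blast

lemma W_cong: "(\<And>i. i < k \<Longrightarrow> u i = v i) \<Longrightarrow> W u k = W v k"
  by (induction k) auto

lemma W_subspace: "(\<And>i. i < k \<Longrightarrow> u i \<in> V) \<Longrightarrow> subspace (W u k)"
proof (induction k)
  case 0
  have "p (x + y) = 0" if "x \<in> V" "y \<in> V" "p x = 0" "p y = 0" for x y
    using p_add[of x y] p_nonneg[of "x + y"] that by auto
  then show ?case by (auto simp: subspace_def p_scale)
next
  case (Suc k)
  then have sub: "subspace (W u k)" by auto
  have uk: "u k \<in> V" using Suc.prems by auto
  show ?case
  proof (rule subspaceI)
    show "0 \<in> W u (Suc k)" using subspace_0[OF sub] by (auto intro!: exI[of _ 0])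
    fix x y assume "x \<in> W u (Suc k)" "y \<in> W u (Suc k)"
    then obtain c d where *: "x \<in> V" "y \<in> V" "x - c \<odot> u k \<in> W u k" "y - d \<odot> u k \<in> W u k" by auto
    then have "x + y - (c + d) \<odot> u k \<in> W u k"
      using subspace_add[OF sub *(3,4)] by (simp add: scale_left_distrib algebra_simps)
    then show "x + y \<in> W u (Suc k)" using * by auto
  next
    fix x a assume "x \<in> W u (Suc k)"
    then obtain c where *: "x \<in> V" "x - c \<odot> u k \<in> W u k" by auto
    then have "a \<odot> x - (a * c) \<odot> u k \<in> W u k"
      using subspace_scale[OF sub *(2), of a] by (simp add: scale_right_diff_distrib)
    then show "a \<odot> x \<in> W u (Suc k)" using * by auto
  qed
qed

lemma W_Suc_mono: "W u k \<subseteq> W u (Suc k)"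
  by (auto intro!: exI[of _ 0])

lemma W_mono: "i \<le> k \<Longrightarrow> W u i \<subseteq> W u k"
  by (rule lift_Suc_mono_le[where f = "W u", OF W_Suc_mono])

lemma W_new: assumes "\<And>i. i \<le> k \<Longrightarrow> u i \<in> V" shows "u k \<in> W u (Suc k)"
  using assms subspace_0[OF W_subspace[of k u]] by (auto intro!: exI[of _ 1])

lemma W_closed:
  assumes "\<And>i. i < k \<Longrightarrow> u i \<in> V" "x \<in> V" "\<And>e. e > 0 \<Longrightarrow> \<exists>w\<in>W u k. p (x - w) < e"
  shows "x \<in> W u k"
  using assms
proof (induction k arbitrary: x)
  case 0
  have "p x \<le> 0"
  proof (rule field_le_epsilon)
    fix e :: real assume "e > 0"
    then obtain w where w: "w \<in> W u 0" "p (x - w) < e" using 0 by blast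
    then show "p x \<le> 0 + e" using p_reverse[of x w] 0 by auto
  qed
  then show ?case using p_nonneg[of x] 0 by auto
next
  case (Suc k)
  have sub: "subspace (W u k)" using Suc.prems by (intro W_subspace) auto
  have uk: "u k \<in> V" using Suc.prems by auto
  show ?case
  proof (cases "u k \<in> W u k")
    case True
    have "x \<in> W u k"
    proof (rule Suc.IH)
      fix e :: real assume "e > 0"
      then obtain w where w: "w \<in> W u (Suc k)" "p (x - w) < e" using Suc by blast
      then obtain c where "w - c \<odot> u k \<in> W u k" by auto
      from subspace_add[OF sub this subspace_scale[OF sub True, of c]]
      show "\<exists>w\<in>W u k. p (x - w) < e" using w by auto
    qed (use Suc.prems in auto)
    then show ?thesis using W_Suc_mono by blast
  next
    case False
    obtain d where d: "d > 0" "\<And>w. w \<in> W u k \<Longrightarrow> d \<le> p (u k - w)"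
    proof -
      have "\<exists>d>0. \<forall>w\<in>W u k. d \<le> p (u k - w)"
      proof (rule ccontr)
        assume "\<not> ?thesis"
        then have "\<And>e. e > 0 \<Longrightarrow> \<exists>w\<in>W u k. p (u k - w) < e" by force
        with Suc.IH[of "u k"] uk Suc.prems(1) False show False by auto
      qed
      then show thesis using that by blast
    qed
    \<comment> \<open>The coefficient at \<open>u k\<close> is a bounded functional on
      \<open>W u (Suc k)\<close>, of norm at most \<open>1 / d\<close>.\<close>
    have dc: "cmod c * d \<le> p (c \<odot> u k + w)" if w: "w \<in> W u k" for c w
    proof (cases "c = 0")
      case True
      then show ?thesis using w p_nonneg[of w] by auto
    next
      case False
      have "d \<le> p (u k - (- 1 / c) \<odot> w)" using subspace_scale[OF sub w] by (intro d)
      then have "cmod c * d \<le> p (c \<odot> (u k - (- 1 / c) \<odot> w))"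
        using uk w by (subst p_scale) (auto intro!: mult_left_mono)
      also have "c \<odot> (u k - (- 1 / c) \<odot> w) = c \<odot> u k + w"
        using False by (simp add: scale_right_diff_distrib scale_right_distrib)
      finally show ?thesis .
    qed
    have "\<forall>n::nat. \<exists>w\<in>W u (Suc k). p (x - w) < 1 / Suc n"
      using Suc.prems(3) by (metis of_nat_0_less_iff zero_less_Suc zero_less_divide_1_iff)
    then obtain w where w: "\<And>n. w n \<in> W u (Suc k)" "\<And>n::nat. p (x - w n) < 1 / Suc n" by metis
    then have "\<forall>n. \<exists>c. w n - c \<odot> u k \<in> W u k" by auto
    then obtain c where c: "\<And>n. w n - c n \<odot> u k \<in> W u k" by metis
    have wV [simp]: "w n \<in> V" for n using w by blast
    have cd: "cmod (c m - c n) * d \<le> 1 / Suc m + 1 / Suc n" for m n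
    proof -
      have "cmod (c m - c n) * d \<le> p ((c m - c n) \<odot> u k + ((w m - c m \<odot> u k) - (w n - c n \<odot> u k)))"
        by (intro dc subspace_diff[OF sub] c)
      also have "(c m - c n) \<odot> u k + ((w m - c m \<odot> u k) - (w n - c n \<odot> u k)) = (x - w n) - (x - w m)"
        by (simp add: scale_left_diff_distrib)
      also have "p \<dots> \<le> p (x - w n) + p (x - w m)" using Suc.prems by (intro p_diff) auto
      also have "\<dots> \<le> 1 / Suc m + 1 / Suc n" using w(2)[of n] w(2)[of m] by linarith
      finally show ?thesis .
    qed
    have "Cauchy c"
    proof (rule CauchyI)
      fix e :: real assume e: "e > 0"
      then obtain N where N: "1 / Suc N < e * d / 2" using nat_approx_posE[of "e * d / 2"] d by auto
      show "\<exists>M. \<forall>m\<ge>M. \<forall>n\<ge>M. cmod (c m - c n) < e"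
      proof (intro exI[of _ N] allI impI)
        fix m n assume "m \<ge> N" "n \<ge> N"
        then have "1 / Suc m \<le> 1 / Suc N" "1 / Suc n \<le> 1 / Suc N" by (auto simp: field_simps)
        with cd[of m n] N have "cmod (c m - c n) * d < e * d" by linarith
        then show "cmod (c m - c n) < e" using d by simp
      qed
    qed
    then obtain c0 where c0: "c \<longlonglongrightarrow> c0" using Cauchy_convergent convergent_def by blast
    have "x - c0 \<odot> u k \<in> W u k"
    proof (rule Suc.IH)
      fix e :: real assume e: "e > 0"
      have "(\<lambda>n. 1 / Suc n + cmod (c n - c0) * p (u k)) \<longlonglongrightarrow> 0 + cmod (c0 - c0) * p (u k)"
        by (intro tendsto_add[OF LIMSEQ_Suc[OF lim_1_over_n]] tendsto_intros c0)
      then have "\<forall>\<^sub>F n in sequentially. 1 / Suc n + cmod (c n - c0) * p (u k) < e"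
        by (rule order_tendstoD) (use e in simp)
      then obtain n :: nat where n: "1 / Suc n + cmod (c n - c0) * p (u k) < e"
        by (auto simp: eventually_sequentially)
      have "(x - c0 \<odot> u k) - (w n - c n \<odot> u k) = (x - w n) + (c n - c0) \<odot> u k"
        by (simp add: scale_left_diff_distrib)
      also have "p \<dots> \<le> p (x - w n) + cmod (c n - c0) * p (u k)"
        using Suc.prems uk by (intro order_trans[OF p_add]) (auto simp: p_scale)
      also have "\<dots> < e" using w(2)[of n] n by linarith
      finally show "\<exists>w\<in>W u k. p (x - c0 \<odot> u k - w) < e" using c by blast
    qed (use Suc.prems uk in auto)
    then show ?thesis using Suc.prems by auto
  qed
qed

text \<open>The condition on \<open>A (z i) (u i)\<close> says that \<open>T\<close> is upper
  triangular along \<open>u\<close> with diagonal entries \<open>z i\<close>. For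
  \<open>k = 0\<close> the boundedness of \<open>T\<close> keeps null vectors null.\<close>

lemma T_W:
  assumes "\<And>i. i < k \<Longrightarrow> u i \<in> V" "\<And>i. i < k \<Longrightarrow> A (z i) (u i) \<in> W u i" "x \<in> W u k"
  shows "T x \<in> W u k"
  using assms
proof (induction k arbitrary: x)
  case 0
  then show ?case using T_bound[of x] p_nonneg[of "T x"] by auto
next
  case (Suc k)
  have sub: "subspace (W u (Suc k))" using Suc.prems by (intro W_subspace) auto
  obtain c where c: "x - c \<odot> u k \<in> W u k" and x: "x \<in> V" using Suc.prems by auto
  have uk: "u k \<in> V" using Suc.prems by auto
  have 1: "T (x - c \<odot> u k) \<in> W u (Suc k)"
    using Suc.IH[OF _ _ c] Suc.prems W_Suc_mono by (meson less_SucI subsetD)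
  have 2: "A (z k) (u k) \<in> W u (Suc k)" using Suc.prems(2)[of k] W_Suc_mono by blast
  have "T x = T (x - c \<odot> u k) + c \<odot> (z k \<odot> u k - A (z k) (u k))"
    using x uk by (simp add: T_diff T_scale A_def)
  also have "\<dots> \<in> W u (Suc k)"
    using W_new[of k u] Suc.prems(1)
    by (intro subspace_add[OF sub] 1 subspace_scale[OF sub] subspace_diff[OF sub] 2) auto
  finally show ?case .
qed

text \<open>On the quotient of \<open>W u (Suc k)\<close> by \<open>W u k\<close> the operator
  \<open>T\<close> acts as multiplication by the diagonal entry \<open>z k\<close>.\<close>

lemma A_W_Suc:
  assumes "\<And>i. i \<le> k \<Longrightarrow> u i \<in> V" "\<And>i. i \<le> k \<Longrightarrow> A (z i) (u i) \<in> W u i" "x \<in> W u (Suc k)"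
  shows "A (z k) x \<in> W u k"
proof -
  have sub: "subspace (W u k)" using assms by (intro W_subspace) auto
  obtain c where c: "x - c \<odot> u k \<in> W u k" and x: "x \<in> V" using assms by auto
  have "T (x - c \<odot> u k) \<in> W u k" using assms by (intro T_W[OF _ _ c, of z]) auto
  then have "A (z k) (x - c \<odot> u k) \<in> W u k"
    unfolding A_def using subspace_diff[OF sub subspace_scale[OF sub c]] by blast
  moreover have "c \<odot> A (z k) (u k) \<in> W u k" using assms by (intro subspace_scale[OF sub]) auto
  ultimately have "A (z k) (x - c \<odot> u k) + c \<odot> A (z k) (u k) \<in> W u k"
    by (rule subspace_add[OF sub])
  then show ?thesis using x assms(1)[of k] by (simp add: A_diff A_scale)
qed

text \<open>As \<open>W u k\<close> is closed, \<open>u k\<close> has positive distance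
  \<open>d\<close> from it. Normalizing \<open>u k - w\<close> for a \<open>w\<close> that realizes
  \<open>d\<close> up to a factor 2 gives the constant 1/2.\<close>

lemma Riesz_vector:
  assumes u: "\<And>i. i \<le> k \<Longrightarrow> u i \<in> V" and new: "u k \<notin> W u k"
  shows "\<exists>x\<in>W u (Suc k). p x = 1 \<and> (\<forall>w\<in>W u k. 1 / 2 \<le> p (x - w))"
proof -
  have sub: "subspace (W u k)" using u by (intro W_subspace) auto
  have sub': "subspace (W u (Suc k))" using u by (intro W_subspace) auto
  have uk: "u k \<in> V" using u by auto
  define d where "d = (INF w\<in>W u k. p (u k - w))"
  have ne: "W u k \<noteq> {}" using subspace_0[OF sub] by blast
  have bdd: "bdd_below ((\<lambda>w. p (u k - w)) ` W u k)"
    using uk by (intro bdd_belowI[of _ 0]) (auto intro!: p_nonneg)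
  have dle: "d \<le> p (u k - w)" if "w \<in> W u k" for w
    unfolding d_def using bdd that by (rule cINF_lower)
  obtain e where e: "e > 0" "\<And>w. w \<in> W u k \<Longrightarrow> e \<le> p (u k - w)"
    using W_closed[of k u "u k"] u new by (metis less_imp_le_nat linorder_not_less order_refl)
  have "e \<le> d" unfolding d_def by (rule cINF_greatest[OF ne e(2)])
  then have d: "d > 0" using e by linarith
  then have "d < 2 * d" by simp
  then obtain w where w: "w \<in> W u k" "p (u k - w) < 2 * d"
    unfolding d_def using cINF_less_iff[OF ne bdd] by blast
  define q where "q = p (u k - w)"
  have q: "q > 0" using dle[OF w(1)] d by (simp add: q_def)
  show ?thesis
  proof (intro bexI[of _ "of_real (1 / q) \<odot> (u k - w)"] conjI ballI)
    have xV: "u k - w \<in> V" using uk w by auto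
    show "p (of_real (1 / q) \<odot> (u k - w)) = 1"
      using q xV by (subst p_scale) (auto simp: q_def norm_divide)
    show "of_real (1 / q) \<odot> (u k - w) \<in> W u (Suc k)"
      using W_new[of k u] u w W_Suc_mono
      by (intro subspace_scale[OF sub'] subspace_diff[OF sub']) blast+
    fix v assume v: "v \<in> W u k"
    have "of_real (1 / q) \<odot> (u k - w) - v = of_real (1 / q) \<odot> (u k - (w + of_real q \<odot> v))"
      using q by (simp add: scale_right_diff_distrib scale_right_distrib)
    moreover have "d \<le> p (u k - (w + of_real q \<odot> v))"
      using v w by (intro dle subspace_add[OF sub] subspace_scale[OF sub])
    moreover have "u k - (w + of_real q \<odot> v) \<in> V" using uk w v by auto
    ultimately have "1 / q * d \<le> p (of_real (1 / q) \<odot> (u k - w) - v)"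
      using q by (simp add: p_scale norm_divide divide_right_mono del: of_real_divide)
    moreover have "1 / 2 \<le> 1 / q * d" using w q by (simp add: q_def field_simps)
    ultimately show "1 / 2 \<le> p (of_real (1 / q) \<odot> (u k - w) - v)" by linarith
  qed
qed

text \<open>For \<open>j < k\<close> the images of two Riesz vectors under \<open>T^m\<close> differ
  by \<open>z k ^ m\<close> times the difference of \<open>x k\<close> and a vector of
  \<open>W u k\<close>, hence by at least \<open>\<rho>^m / 2\<close>. This contradicts
  \<open>ess_bound\<close> with \<open>e = 1/4\<close>.\<close>

lemma no_infinite_flag:
  assumes ess: "ess_bound \<rho>" and \<rho>: "0 < \<rho>"
    and u: "\<And>k. u k \<in> V" "\<And>k. u k \<notin> W u k" "\<And>k. A (z k) (u k) \<in> W u k"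
    and z: "\<And>k. \<rho> \<le> cmod (z k)"
  shows False
proof -
  have sub: "subspace (W u k)" for k using u by (intro W_subspace) auto
  have "\<forall>k. \<exists>x\<in>W u (Suc k). p x = 1 \<and> (\<forall>w\<in>W u k. 1 / 2 \<le> p (x - w))"
    by (intro allI Riesz_vector u)
  then obtain x where x: "\<And>k. x k \<in> W u (Suc k)" "\<And>k. p (x k) = 1"
      "\<And>k w. w \<in> W u k \<Longrightarrow> 1 / 2 \<le> p (x k - w)" by metis
  have xV: "x k \<in> V" for k using x(1) by blast
  have inv: "(T ^^ m) y \<in> W u k" if "y \<in> W u k" for m k y
    by (induction m) (simp_all add: that T_W[where z=z, OF u(1) u(3)] del: W.simps)
  have Tx: "(T ^^ m) (x k) - z k ^ m \<odot> x k \<in> W u k" for m k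
  proof (induction m)
    case 0
    show ?case using subspace_0[OF sub] by simp
  next
    case (Suc m)
    show ?case
      unfolding T_pow_Suc_diff[OF xV]
      by (rule subspace_diff[OF sub T_W[OF u(1) u(3) Suc]
            subspace_scale[OF sub A_W_Suc[OF u(1) u(3) x(1)]]])
  qed
  obtain m where m: "\<And>X::nat \<Rightarrow> 'a. (\<forall>i. X i \<in> V \<and> p (X i) \<le> 1) \<Longrightarrow>
     (\<exists>s::nat \<Rightarrow> nat. strict_mono s \<and> (\<forall>i j. p ((T ^^ m) (X (s i)) - (T ^^ m) (X (s j))) \<le> (1/4) * \<rho> ^ m))"
    using ess[unfolded ess_bound_def, rule_format, of "1/4"] by auto
  obtain s :: "nat \<Rightarrow> nat" where s: "strict_mono s" "\<And>i j. p ((T ^^ m) (x (s i)) - (T ^^ m) (x (s j))) \<le> (1/4) * \<rho> ^ m"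
    using m[of x] xV x(2) by force
  define j k where "j = s 0" and "k = s 1"
  have jk: "j < k" using s(1) by (simp add: j_def k_def strict_mono_def)
  define w where "w = (T ^^ m) (x j) - ((T ^^ m) (x k) - z k ^ m \<odot> x k)"
  have "(T ^^ m) (x j) \<in> W u k" using inv[OF x(1)[of j]] W_mono[of "Suc j" k] jk by auto
  then have w: "w \<in> W u k" unfolding w_def using Tx by (rule subspace_diff[OF sub])
  have z0: "z k \<noteq> 0" using z[of k] \<rho> by auto
  have "(T ^^ m) (x k) - (T ^^ m) (x j) = z k ^ m \<odot> (x k - (1 / z k ^ m) \<odot> w)"
    using z0 by (simp add: w_def scale_right_diff_distrib)
  then have "p ((T ^^ m) (x k) - (T ^^ m) (x j)) = cmod (z k) ^ m * p (x k - (1 / z k ^ m) \<odot> w)"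
    using xV w by (subst \<open>_ = z k ^ m \<odot> _\<close>, subst p_scale) (auto simp: norm_power)
  moreover have "\<dots> \<ge> \<rho> ^ m * (1 / 2)"
    using z[of k] \<rho> x(3)[OF subspace_scale[OF sub w]] by (intro mult_mono power_mono) auto
  moreover have "p ((T ^^ m) (x k) - (T ^^ m) (x j)) \<le> (1/4) * \<rho> ^ m"
    using s(2) by (simp add: j_def k_def)
  moreover have "\<rho> ^ m > 0" using \<rho> by simp
  ultimately show False by linarith
qed

text \<open>Applying \<open>A (z k)\<close> to \<open>x\<close> takes it into \<open>W u k\<close>
  and keeps it a null vector of \<open>A w\<close>, because the two maps commute. By induction
  \<open>A (z k) x\<close> is null, and so is its difference from \<open>A w x\<close>, which is
  \<open>x\<close> times the nonzero number \<open>w - z k\<close> up to sign.\<close>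

lemma eigenvector_notin_W:
  assumes "\<And>i. i < k \<Longrightarrow> u i \<in> V" "\<And>i. i < k \<Longrightarrow> p (A (z i) (u i)) = 0" "\<And>i. i < k \<Longrightarrow> z i \<noteq> w"
    and "x \<in> W u k" "p (A w x) = 0"
  shows "p x = 0"
  using assms
proof (induction k arbitrary: x)
  case 0
  then show ?case by auto
next
  case (Suc k)
  have x: "x \<in> V" using Suc.prems by auto
  have "A (z k) x \<in> W u k"
  proof (rule A_W_Suc)
    fix i assume i: "i \<le> k"
    then have "A (z i) (u i) \<in> W u 0" using Suc.prems by auto
    then show "A (z i) (u i) \<in> W u i" using W_mono[of 0 i u] by blast
  qed (use Suc.prems in auto)
  then have 1: "A (z k) x \<in> W u k" .
  have Aw: "p (A w (A (z k) x)) = 0"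
  proof -
    have "p (A (z k) (A w x)) \<le> 0"
      using A_bound[OF A_V[OF x], of "z k" w] unfolding Suc.prems(5) by simp
    moreover have "0 \<le> p (A (z k) (A w x))" using x by (intro p_nonneg A_V)
    ultimately show ?thesis unfolding A_commute[OF x, of w "z k"] by linarith
  qed
  have 0: "p (A (z k) x) = 0"
    by (rule Suc.IH[OF _ _ _ 1 Aw]) (simp_all add: Suc.prems(1-3))
  have "(w - z k) \<odot> x = A w x - A (z k) x" using A_shift[of w x "z k"] by simp
  then have "p ((w - z k) \<odot> x) \<le> p (A w x) + p (A (z k) x)"
    using p_diff[OF A_V A_V, OF x x] by simp
  then have "cmod (w - z k) * p x \<le> 0"
    unfolding 0 Suc.prems(5) p_scale[OF x] by simp
  then show ?case
    using Suc.prems(3)[of k] p_nonneg[OF x] by (auto simp: mult_le_0_iff)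
qed

section \<open>Eigenvalues outside the disc: finiteness, isolation, multiplicity\<close>

lemma finite_eigenvalues:
  assumes ess: "ess_bound \<rho>" and \<rho>: "0 < \<rho>"
  shows "finite {z. \<rho> \<le> cmod z \<and> eigenvalue z}"
proof (rule ccontr)
  assume "infinite {z. \<rho> \<le> cmod z \<and> eigenvalue z}"
  then obtain z :: "nat \<Rightarrow> complex" where z: "inj z" "range z \<subseteq> {z. \<rho> \<le> cmod z \<and> eigenvalue z}"
    using infinite_countable_subset by blast
  then have "\<forall>k. \<exists>x\<in>V. p x \<noteq> 0 \<and> p (A (z k) x) = 0" by (auto simp: eigenvalue_def)
  then obtain u where u: "\<And>k. u k \<in> V" "\<And>k. p (u k) \<noteq> 0" "\<And>k. p (A (z k) (u k)) = 0" by metis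
  \<comment> \<open>Eigenvectors for distinct eigenvalues are independent modulo null vectors, so
    they span a flag.\<close>
  have new: "u k \<notin> W u k" for k
  proof
    assume *: "u k \<in> W u k"
    have "z i \<noteq> z k" if "i < k" for i using injD[OF z(1), of i k] that by auto
    then have "p (u k) = 0"
      by (rule eigenvector_notin_W[where u = u and z = z, OF u(1) u(3) _ * u(3)])
    then show False using u(2) by simp
  qed
  have inv: "A (z k) (u k) \<in> W u k" for k
  proof -
    have "A (z k) (u k) \<in> W u 0" using u by auto
    then show ?thesis using W_mono[of 0 k u] by blast
  qed
  have "\<rho> \<le> cmod (z k)" for k using z(2) by auto
  then show False by (rule no_infinite_flag[where u = u and z = z, OF ess \<rho> u(1) new inv])
qed

lemma bad_isolated_eigenvalue:
  assumes ess: "ess_bound \<rho>" and \<rho>: "0 < \<rho>" "\<rho> < cmod z" and bad: "\<not> good z"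
  shows "eigenvalue z" "\<exists>d>0. \<forall>w. dist w z < d \<and> w \<noteq> z \<longrightarrow> good w"
proof -
  define E where "E = {z. \<rho> \<le> cmod z \<and> eigenvalue z}"
  have fin: "finite E" unfolding E_def by (rule finite_eigenvalues[OF ess \<rho>(1)])
  define U where "U = - cball 0 \<rho> - E"
  have op: "open U" unfolding U_def using fin by (intro open_Diff finite_imp_closed) auto
  have conn: "connected U"
    unfolding U_def using fin by (intro connected_open_delete_finite connected_complement_bounded_convex) auto
  define P where "P = U \<inter> {w. good w}"
  define Q where "Q = U - {w. good w}"
  have opP: "open P"
  proof (rule openI)
    fix w assume w: "w \<in> P"
    then obtain K where K: "\<And>x. x \<in> V \<Longrightarrow> p x \<le> K * p (A w x)" and
        surj: "\<And>y. y \<in> V \<Longrightarrow> \<exists>x\<in>V. p (A w x - y) = 0"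
      by (auto simp: P_def good_def)
    obtain r where r: "r > 0" "ball w r \<subseteq> U" using openE[OF op, of w] w by (auto simp: P_def)
    define K' where "K' = max K 1"
    have K': "p x \<le> K' * p (A w x)" if "x \<in> V" for x
      using K[OF that] mult_right_mono[of K K' "p (A w x)"] p_nonneg[of "A w x"] that
      by (auto simp: K'_def)
    have K'0: "K' > 0" by (simp add: K'_def)
    have "good v" if "dist w v < 1 / K'" for v
      using that K'0 by (intro good_near[OF K' surj]) (auto simp: dist_norm norm_minus_commute field_simps)
    then have "ball w (min r (1 / K')) \<subseteq> P" using r by (auto simp: P_def)
    then show "\<exists>T>0. ball w T \<subseteq> P" using r K'0 by (intro exI[of _ "min r (1 / K')"]) auto
  qed
  \<comment> \<open>A bad point of \<open>U\<close> is no eigenvalue, hence by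
    \<open>boundary_eigenvalue\<close> no limit of good points.\<close>
  have opQ: "open Q"
  proof (rule openI)
    fix w assume w: "w \<in> Q"
    obtain r where r: "r > 0" "ball w r \<subseteq> U" using openE[OF op, of w] w by (auto simp: Q_def)
    have "\<not> eigenvalue w" using w by (auto simp: Q_def U_def E_def)
    then have "w \<notin> closure {w. good w}"
      using boundary_eigenvalue[OF ess \<rho>(1), of w] w by (auto simp: Q_def U_def)
    then obtain e where e: "e > 0" "\<And>v. good v \<Longrightarrow> \<not> dist v w < e"
      unfolding closure_approachable by auto
    then have "ball w (min r e) \<subseteq> Q" using r by (auto simp: Q_def dist_commute)
    then show "\<exists>T>0. ball w T \<subseteq> Q" using r e by (intro exI[of _ "min r e"]) auto
  qed
  obtain b where b: "b > 0" "\<And>w. w \<in> E \<Longrightarrow> cmod w < b"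
    using finite_imp_bounded[OF fin] bounded_pos_less by blast
  \<comment> \<open>This point lies beyond \<open>B\<close>, hence is good, and beyond the disc and
    all points of \<open>E\<close>; it shows that \<open>P\<close> is not empty.\<close>
  define w0 where "w0 = complex_of_real (1 + B + b + \<rho>)"
  have cw0: "cmod w0 = 1 + B + b + \<rho>" using b B_nonneg \<rho> by (simp add: w0_def del: of_real_add)
  have "w0 \<in> P"
    using cw0 b(1) b(2)[of w0] \<rho> B_nonneg by (auto simp: P_def U_def intro!: good_large)
  moreover have "U \<subseteq> P \<union> Q" "P \<inter> Q \<inter> U = {}" by (auto simp: P_def Q_def)
  ultimately have "Q = {}"
    using connectedD[OF conn opP opQ] by (auto simp: P_def Q_def)
  then have good: "good w" if "\<rho> < cmod w" "w \<notin> E" for w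
    using that \<open>Q = {}\<close> unfolding Q_def U_def by (auto simp: subset_eq)
  show "eigenvalue z" using good[OF \<rho>(2)] bad by (auto simp: E_def)
  have "open (- cball 0 \<rho> - (E - {z}))" using fin by (intro open_Diff finite_imp_closed) auto
  moreover have "z \<in> - cball 0 \<rho> - (E - {z})" using \<rho> by auto
  ultimately obtain d where d: "d > 0" "ball z d \<subseteq> - cball 0 \<rho> - (E - {z})" by (rule openE)
  have "good w" if "dist w z < d" "w \<noteq> z" for w
  proof -
    have "w \<in> - cball 0 \<rho> - (E - {z})" using d(2) that by (auto simp: subset_eq dist_commute)
    then show ?thesis using that by (intro good) auto
  qed
  then show "\<exists>d>0. \<forall>w. dist w z < d \<and> w \<noteq> z \<longrightarrow> good w" using d by blast
qed

text \<open>If the generalized eigenspace is not exhausted by \<open>W f k\<close>, the last iterate under \<open>A z\<close> of one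
  of its vectors that lies outside \<open>W f k\<close> extends the flag.\<close>

lemma finite_generalized_eigenspace:
  assumes ess: "ess_bound \<rho>" and \<rho>: "0 < \<rho>" "\<rho> \<le> cmod z"
  defines "E \<equiv> {x \<in> V. \<exists>k. p ((A z ^^ k) x) = 0}"
  shows "\<exists>n u. (\<forall>i<n. u i \<in> E) \<and> E \<subseteq> W u n"
proof (rule ccontr)
  assume contra: "\<not> ?thesis"
  define P where "P f k v \<longleftrightarrow> v \<in> E \<and> v \<notin> W f k \<and> A z v \<in> W f k" for f :: "nat \<Rightarrow> 'a" and k v
  have "\<exists>f. \<forall>k. P f k (f k)"
  proof (rule dependent_wellorder_choice)
    \<comment> \<open>\<open>P f k\<close> depends on \<open>f\<close> only below \<open>k\<close>,
      through \<open>W f k\<close>, as the choice principle requires.\<close>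
    fix r and f g :: "nat \<Rightarrow> 'a" and k :: nat assume "\<And>y. y < k \<Longrightarrow> f y = g y"
    then show "P f k r = P g k r" using W_cong[of k f g] by (simp add: P_def)
  next
    fix k and f :: "nat \<Rightarrow> 'a" assume f: "\<And>y. y < k \<Longrightarrow> P f y (f y)"
    then have "\<not> E \<subseteq> W f k" using contra unfolding P_def by blast
    then obtain v j where v: "v \<in> E" "v \<notin> W f k" "v \<in> V" "p ((A z ^^ j) v) = 0" by (auto simp: E_def)
    have "(A z ^^ j) v \<in> W f 0" using v by auto
    then have ex: "(A z ^^ j) v \<in> W f k" using W_mono[of 0 k f] by blast
    define l where "l = (LEAST j. (A z ^^ j) v \<in> W f k)"
    have l: "(A z ^^ l) v \<in> W f k" unfolding l_def by (rule LeastI[of _ j]) (rule ex)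
    \<comment> \<open>\<open>l\<close> is positive because \<open>v\<close> itself lies outside
      \<open>W f k\<close>.\<close>
    then obtain l' where l': "l = Suc l'" using v by (cases l) auto
    have "(A z ^^ l') v \<notin> W f k" using not_less_Least[of l' "\<lambda>j. (A z ^^ j) v \<in> W f k"] l' by (simp add: l_def)
    moreover have "(A z ^^ l') v \<in> E"
    proof -
      have z0: "p ((A z ^^ i) x) = 0" if "x \<in> V" "p x = 0" for i x
        using that
      proof (induction i)
        case (Suc i)
        then show ?case using A_bound[of "(A z ^^ i) x" z] p_nonneg[of "A z ((A z ^^ i) x)"] by simp
      qed simp
      have "p ((A z ^^ j) ((A z ^^ l') v)) = p ((A z ^^ l') ((A z ^^ j) v))"
        by (metis add.commute comp_apply funpow_add)
      also have "\<dots> = 0" using v by (intro z0[of "(A z ^^ j) v"]) auto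
      finally show ?thesis using v by (auto simp: E_def)
    qed
    ultimately have "P f k ((A z ^^ l') v)" using l l' by (simp add: P_def)
    then show "\<exists>r. P f k r" ..
  qed
  then obtain u where u: "\<And>k. P u k (u k)" by blast
  have "u k \<in> V" "u k \<notin> W u k" "A z (u k) \<in> W u k" for k
    using u[of k] by (auto simp: P_def E_def)
  with no_infinite_flag[OF ess \<rho>(1), of u "\<lambda>_. z"] \<rho>(2) show False by blast
qed

end

section \<open>Lexicographic order and inverse branches on the beta-shift\<close>

lemma less_fun_total: "x \<noteq> y \<Longrightarrow> less_fun x y \<or> less_fun y x" for x y :: bseq
proof -
  assume "x \<noteq> y"
  then have ex: "\<exists>k. x k \<noteq> y k" by auto
  define k where "k = (LEAST k. x k \<noteq> y k)"
  have "x k \<noteq> y k" unfolding k_def using ex by (rule LeastI_ex)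
  moreover have "x j = y j" if "j < k" for j using not_less_Least[of j] that by (auto simp: k_def)
  ultimately show ?thesis unfolding less_fun_def by (metis linorder_neqE)
qed

lemma transp_less_fun: "transp (less_fun :: bseq \<Rightarrow> bseq \<Rightarrow> bool)"
  by (auto intro!: transpI elim: less_fun_trans)

section \<open>The quasi-greedy expansion of 1\<close>

text \<open>With the ceiling in place of the floor, the orbit of 1 is the limit of the greedy orbits of
  \<open>y < 1\<close> as \<open>y\<close> tends to 1.\<close>

definition qg_map :: "real \<Rightarrow> real \<Rightarrow> real" where
  "qg_map \<beta> c = \<beta> * c - of_int (\<lceil>\<beta> * c\<rceil> - 1)"

definition qg_digits :: "real \<Rightarrow> real \<Rightarrow> bseq" where
  "qg_digits \<beta> c = (\<lambda>n. \<lceil>\<beta> * (qg_map \<beta> ^^ n) c\<rceil> - 1)"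

lemma qg_map_range: "0 < qg_map \<beta> c \<and> qg_map \<beta> c \<le> 1"
  using ceiling_correct[of "\<beta> * c"] by (auto simp: qg_map_def)

lemma qg_iter_range: "0 < c \<Longrightarrow> c \<le> 1 \<Longrightarrow> 0 < (qg_map \<beta> ^^ n) c \<and> (qg_map \<beta> ^^ n) c \<le> 1"
  by (cases n) (auto simp: qg_map_range)

text \<open>Just below \<open>\<beta> * c\<close> the floor has the value
  \<open>\<lceil>\<beta> * c\<rceil> - 1\<close>, also when \<open>\<beta> * c\<close> is an
  integer. So for \<open>y\<close> close to 1 both orbits subtract the same digits for
  \<open>n\<close> steps, and their distance is multiplied by \<open>\<beta>\<close> each
  time.\<close>

lemma greedy_orbit_near_1:
  assumes \<beta>: "1 < \<beta>"
  shows "\<forall>\<^sub>F y in at_left 1. (beta_map \<beta> ^^ n) y = (qg_map \<beta> ^^ n) 1 - \<beta> ^ n * (1 - y)"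
proof (induction n)
  case 0
  show ?case by simp
next
  case (Suc n)
  define c where "c = (qg_map \<beta> ^^ n) 1"
  have "((\<lambda>y. \<beta> ^ Suc n * (1 - y)) \<longlongrightarrow> \<beta> ^ Suc n * (1 - 1)) (at_left (1::real))"
    by (intro tendsto_intros)
  \<comment> \<open>There is room for the perturbation because \<open>qg_map\<close> never takes the
    value 0.\<close>
  then have "\<forall>\<^sub>F y in at_left 1. \<beta> ^ Suc n * (1 - y) < qg_map \<beta> c"
    using qg_map_range[of \<beta> c] by (auto elim!: order_tendstoD(2))
  moreover have "\<forall>\<^sub>F y in at_left (1::real). y < 1"
    by (simp add: eventually_at_filter)
  ultimately show ?case using Suc
  proof eventually_elim
    case (elim y)
    have "0 < \<beta> ^ Suc n * (1 - y)" using \<beta> elim by simp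
    then have "\<lfloor>\<beta> * c - \<beta> ^ Suc n * (1 - y)\<rfloor> = \<lceil>\<beta> * c\<rceil> - 1"
      using elim(1) ceiling_correct[of "\<beta> * c"] unfolding qg_map_def[of \<beta> c]
      by (intro floor_unique) linarith+
    moreover have "\<beta> * (c - \<beta> ^ n * (1 - y)) = \<beta> * c - \<beta> ^ Suc n * (1 - y)"
      by (simp add: algebra_simps)
    ultimately show ?case
      using elim(3) by (simp add: beta_map_def[of _ "c - _"] qg_map_def[of _ c] flip: c_def)
  qed
qed

text \<open>A digit is \<open>\<beta>\<close> times an orbit point minus the next orbit point, and
  both orbit points are known near 1.\<close>

lemma greedy_digit_near_1:
  assumes \<beta>: "1 < \<beta>"
  shows "\<forall>\<^sub>F y in at_left 1. greedy_digits \<beta> y n = qg_digits \<beta> 1 n"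
  using greedy_orbit_near_1[OF \<beta>, of n] greedy_orbit_near_1[OF \<beta>, of "Suc n"]
proof eventually_elim
  case (elim y)
  define a c where "a = (beta_map \<beta> ^^ n) y" and "c = (qg_map \<beta> ^^ n) 1"
  have "\<beta> * a = \<beta> * c - \<beta> ^ Suc n * (1 - y)"
    unfolding a_def elim(1) by (simp add: algebra_simps c_def)
  then have "real_of_int \<lfloor>\<beta> * a\<rfloor> = of_int (\<lceil>\<beta> * c\<rceil> - 1)"
    using elim(2) by (simp add: beta_map_def[of _ a] qg_map_def[of _ c] flip: a_def c_def)
  then have "real_of_int \<lfloor>\<beta> * (beta_map \<beta> ^^ n) y\<rfloor> = of_int (\<lceil>\<beta> * (qg_map \<beta> ^^ n) 1\<rceil> - 1)"
    unfolding a_def c_def .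
  then show ?case
    unfolding greedy_digits_def qg_digits_def by (simp only: of_int_eq_iff)
qed

text \<open>In a product of discrete spaces convergence means that each digit is eventually
  constant. This gives the limit and also its uniqueness, which \<open>THE\<close> requires.\<close>

lemma one_seq_eq:
  assumes \<beta>: "1 < \<beta>"
  shows "one_seq \<beta> = qg_digits \<beta> 1"
  unfolding one_seq_def
proof (rule the_equality)
  have "limitin (product_topology (\<lambda>i::nat. euclidean :: int topology) UNIV)
      (greedy_digits \<beta>) (qg_digits \<beta> 1) (at_left 1)"
    unfolding limitin_componentwise using greedy_digit_near_1[OF \<beta>] by (auto simp: tendsto_discrete)
  then show lim: "(greedy_digits \<beta> \<longlongrightarrow> qg_digits \<beta> 1) (at_left 1)"
    by (simp add: euclidean_product_topology)
  show "q = qg_digits \<beta> 1" if q: "(greedy_digits \<beta> \<longlongrightarrow> q) (at_left 1)" for q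
  proof
    fix n
    have "limitin (product_topology (\<lambda>i::nat. euclidean :: int topology) UNIV)
        (greedy_digits \<beta>) q (at_left 1)"
      using q by (simp add: euclidean_product_topology)
    then have "\<forall>\<^sub>F y in at_left 1. greedy_digits \<beta> y n = q n"
      unfolding limitin_componentwise by (simp add: tendsto_discrete)
    then have "\<forall>\<^sub>F y in at_left (1::real). q n = qg_digits \<beta> 1 n"
      using greedy_digit_near_1[OF \<beta>, of n] by eventually_elim simp
    then show "q n = qg_digits \<beta> 1 n" by simp
  qed
qed

lemma shift_pow: "(shift ^^ n) x = (\<lambda>k. x (n + k))"
  by (induction n arbitrary: x) (auto simp: shift_def)

lemma shift_qg_digits: "(shift ^^ n) (qg_digits \<beta> c) = qg_digits \<beta> ((qg_map \<beta> ^^ n) c)"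
  by (simp add: shift_pow qg_digits_def fun_eq_iff funpow_add add.commute[of n])

text \<open>Up to the first position where the digits differ, both orbits subtract the same integers
  and keep their order; at that position the larger orbit point has the larger digit.\<close>

lemma qg_digits_mono:
  assumes \<beta>: "1 < \<beta>" and "c \<le> d"
  shows "lex_le (qg_digits \<beta> c) (qg_digits \<beta> d)"
proof (cases "qg_digits \<beta> c = qg_digits \<beta> d")
  case False
  then have ex: "\<exists>k. qg_digits \<beta> c k \<noteq> qg_digits \<beta> d k" by auto
  define k where "k = (LEAST k. qg_digits \<beta> c k \<noteq> qg_digits \<beta> d k)"
  have ne: "qg_digits \<beta> c k \<noteq> qg_digits \<beta> d k" unfolding k_def using ex by (rule LeastI_ex)
  have eq: "qg_digits \<beta> c j = qg_digits \<beta> d j" if "j < k" for j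
    using not_less_Least[of j] that by (auto simp: k_def)
  have orbit: "(qg_map \<beta> ^^ j) c \<le> (qg_map \<beta> ^^ j) d" if "j \<le> k" for j
    using that
  proof (induction j)
    case 0
    show ?case using assms by simp
  next
    case (Suc j)
    then have "\<beta> * (qg_map \<beta> ^^ j) c \<le> \<beta> * (qg_map \<beta> ^^ j) d" using \<beta> by simp
    moreover have "\<lceil>\<beta> * (qg_map \<beta> ^^ j) c\<rceil> = \<lceil>\<beta> * (qg_map \<beta> ^^ j) d\<rceil>"
      using eq[of j] Suc by (simp add: qg_digits_def)
    ultimately show ?case
      by (simp add: qg_map_def[of _ "(qg_map \<beta> ^^ j) c"] qg_map_def[of _ "(qg_map \<beta> ^^ j) d"])
  qed
  have "\<beta> * (qg_map \<beta> ^^ k) c \<le> \<beta> * (qg_map \<beta> ^^ k) d"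
    using orbit[of k] \<beta> by simp
  then have "qg_digits \<beta> c k \<le> qg_digits \<beta> d k"
    unfolding qg_digits_def by (intro diff_right_mono ceiling_mono)
  then show ?thesis unfolding lex_le_def less_fun_def using ne eq by (metis order_neq_le_trans)
qed (simp add: lex_le_def)

section \<open>Words and inverse branches\<close>

definition pre :: "int \<Rightarrow> bseq \<Rightarrow> bseq" where
  "pre b x = case_nat b x"

definition cat :: "int list \<Rightarrow> bseq \<Rightarrow> bseq" where
  "cat w x = foldr pre w x"

lemma cat_simps [simp]: "cat [] x = x" "cat (b # w) x = pre b (cat w x)"
  by (simp_all add: cat_def)

lemma cat_append: "cat (v @ w) x = cat v (cat w x)"
  by (simp add: cat_def)

lemma shift_pre [simp]: "shift (pre b x) = x"
  by (simp add: shift_def pre_def)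

lemma pre_shift: "pre (x 0) (shift x) = x"
  by (auto simp: shift_def pre_def fun_eq_iff split: nat.split)

lemma range_pre: "range (pre b x) = insert b (range x)"
  by (force simp: pre_def image_iff split: nat.splits intro: exI[of _ "Suc _"])

lemma less_fun_pre: "less_fun (pre b x) (pre b y) \<longleftrightarrow> less_fun x y"
proof
  assume "less_fun x y"
  then obtain k where "x k < y k" "\<forall>j<k. x j = y j" unfolding less_fun_def by blast
  then show "less_fun (pre b x) (pre b y)"
    unfolding less_fun_def by (intro exI[of _ "Suc k"]) (auto simp: pre_def split: nat.split)
next
  assume "less_fun (pre b x) (pre b y)"
  then obtain k where k: "pre b x k < pre b y k" "\<forall>j<k. pre b x j = pre b y j"
    unfolding less_fun_def by blast
  then obtain l where l: "k = Suc l" by (cases k) (auto simp: pre_def)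
  have "x j = y j" if "j < l" for j using k(2)[rule_format, of "Suc j"] that l by (simp add: pre_def)
  then show "less_fun x y" using k l unfolding less_fun_def by (intro exI[of _ l]) (auto simp: pre_def)
qed

lemma less_fun_pre_0_1: "less_fun (pre 0 x) (pre 1 y)"
  unfolding less_fun_def by (intro exI[of _ 0]) (simp add: pre_def)

lemma less_fun_cat: "less_fun (cat w x) (cat w y) \<longleftrightarrow> less_fun x y"
  by (induction w) (auto simp: less_fun_pre)

lemma shift_cat: "k \<le> length w \<Longrightarrow> (shift ^^ k) (cat w x) = cat (drop k w) x"
proof (induction k arbitrary: w)
  case (Suc k)
  then obtain b v where "w = b # v" by (cases w) auto
  then show ?case using Suc by (simp add: funpow_swap1)
qed simp

primrec words :: "nat \<Rightarrow> int list set" where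
  "words 0 = {[]}"
| "words (Suc n) = Cons 0 ` words n \<union> Cons 1 ` words n"

lemma words_props: "finite (words n) \<and> card (words n) = 2 ^ n \<and> (\<forall>w\<in>words n. length w = n)"
proof (induction n)
  case (Suc n)
  then have "card (words (Suc n)) = card (Cons 0 ` words n) + card (Cons 1 ` words n)"
    unfolding words.simps by (intro card_Un_disjoint) auto
  then show ?case using Suc by (auto simp: card_image)
qed simp

lemma finite_words [simp]: "finite (words n)" and card_words: "card (words n) = 2 ^ n"
  and length_words: "w \<in> words n \<Longrightarrow> length w = n"
  using words_props by auto

lemma sum_words_Suc: "(\<Sum>w\<in>words (Suc n). g w) = (\<Sum>w\<in>words n. g (0 # w) + g (1 # w))"
  unfolding words.simps by (subst sum.union_disjoint) (auto simp: sum.reindex sum.distrib)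

section \<open>Admissible sequences and the domains of the branches\<close>

locale beta_shift_space =
  fixes \<beta> :: real
  assumes \<beta>: "1 < \<beta>" "\<beta> \<le> 2"
begin

abbreviation X where "X \<equiv> beta_shift \<beta>"

abbreviation \<Omega> where "\<Omega> \<equiv> one_seq \<beta>"

lemma one_seq_range: "range \<Omega> \<subseteq> {0, 1}"
proof -
  have "qg_digits \<beta> 1 n \<in> {0, 1}" for n
  proof -
    define c where "c = (qg_map \<beta> ^^ n) 1"
    have c: "0 < c" "c \<le> 1" using qg_iter_range[where c = 1 and \<beta> = \<beta> and n = n] by (auto simp: c_def)
    have "\<beta> * c \<le> 2 * 1" using c \<beta> by (intro mult_mono) auto
    then have "\<lceil>\<beta> * c\<rceil> \<le> 2" by (simp add: ceiling_le_iff)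
    moreover have "0 < \<lceil>\<beta> * c\<rceil>" using c \<beta> by simp
    ultimately have "\<lceil>\<beta> * c\<rceil> = 1 \<or> \<lceil>\<beta> * c\<rceil> = 2" by linarith
    then show ?thesis by (auto simp: qg_digits_def simp flip: c_def)
  qed
  then show ?thesis using \<beta> by (auto simp: one_seq_eq)
qed

text \<open>A shift of the expansion of 1 is the expansion of an orbit point, which is at most 1, so
  \<open>qg_digits_mono\<close> compares it with the expansion of 1.\<close>

lemma one_seq_in: "\<Omega> \<in> X"
  unfolding beta_shift_def using one_seq_range \<beta> qg_iter_range[where c = 1 and \<beta> = \<beta>]
  by (auto simp: one_seq_eq shift_qg_digits intro!: qg_digits_mono)

lemma X_range: "x \<in> X \<Longrightarrow> x k \<in> {0, 1}"
  by (auto simp: beta_shift_def)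

lemma X_le_one: "x \<in> X \<Longrightarrow> lex_le x \<Omega>"
  unfolding beta_shift_def by (auto dest: spec[of _ 0])

lemma zero_le:
  assumes "\<And>k. x k \<in> {0, 1}" shows "lex_le zero_seq x"
proof (cases "x = zero_seq")
  case False
  then have "less_fun zero_seq x \<or> less_fun x zero_seq" using less_fun_total by metis
  moreover have "\<not> less_fun x zero_seq"
  proof
    assume "less_fun x zero_seq"
    then obtain k where "x k < 0" by (auto simp: less_fun_def zero_seq_def)
    then show False using assms[of k] by auto
  qed
  ultimately show ?thesis by (simp add: lex_le_def)
qed (simp add: lex_le_def)

lemma zero_seq_in: "zero_seq \<in> X"
proof -
  have "(shift ^^ n) zero_seq = zero_seq" for n by (simp add: shift_pow zero_seq_def)
  moreover have "lex_le zero_seq \<Omega>" using one_seq_range by (intro zero_le) auto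
  ultimately show ?thesis by (auto simp: beta_shift_def zero_seq_def)
qed

lemma shift_in: "x \<in> X \<Longrightarrow> shift x \<in> X"
proof -
  assume x: "x \<in> X"
  have "lex_le ((shift ^^ n) (shift x)) \<Omega>" for n
    using x unfolding beta_shift_def by (auto simp: funpow_swap1 dest!: spec[of _ "Suc n"])
  then show ?thesis using x by (auto simp: beta_shift_def shift_def)
qed

lemma shift_pow_in: "x \<in> X \<Longrightarrow> (shift ^^ n) x \<in> X"
  by (induction n) (auto simp: shift_in)

text \<open>Every proper shift of \<open>pre b x\<close> is a shift of \<open>x\<close>, so
  prepending a letter adds only the condition on the unshifted sequence.\<close>

lemma pre_in_X: "pre b x \<in> X \<longleftrightarrow> x \<in> X \<and> b \<in> {0, 1} \<and> lex_le (pre b x) \<Omega>"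
proof (intro iffI conjI)
  assume *: "pre b x \<in> X"
  show "x \<in> X" using shift_in[OF *] by simp
  show "b \<in> {0, 1}" using X_range[OF *, of 0] by (simp add: pre_def)
  show "lex_le (pre b x) \<Omega>" using * by (rule X_le_one)
next
  assume *: "x \<in> X \<and> b \<in> {0, 1} \<and> lex_le (pre b x) \<Omega>"
  have "lex_le ((shift ^^ n) (pre b x)) \<Omega>" for n
    using * by (cases n) (auto simp: funpow_swap1 beta_shift_def)
  then show "pre b x \<in> X" using * by (auto simp: beta_shift_def range_pre)
qed

text \<open>Each admissibility condition is an upper bound and \<open>cat w\<close> is monotone, so
  the conditions pass from \<open>y\<close> to smaller points. Thus the domain of an inverse branch
  is an initial segment.\<close>

lemma cat_down:
  assumes "x \<in> X" "less_fun x y" "cat w y \<in> X" shows "cat w x \<in> X"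
  using assms(3)
proof (induction w)
  case Nil
  show ?case using assms by simp
next
  case (Cons b w)
  have "less_fun (cat (b # w) x) (cat (b # w) y)" using assms(2) by (simp only: less_fun_cat)
  then show ?case
    using Cons by (auto simp: pre_in_X lex_le_def intro: less_fun_trans)
qed

lemma cat_drop_in: "cat w x \<in> X \<Longrightarrow> cat (drop k w) x \<in> X"
  using shift_pow_in[of "cat w x" k] shift_cat[of k w x] shift_pow_in[of "cat w x" "length w"]
    shift_cat[of "length w" w x]
  by (cases "k \<le> length w") auto

lemma shift_preimages: "{y. y \<in> X \<and> shift y = x} = {y. y \<in> (\<lambda>b. pre b x) ` {0, 1} \<and> y \<in> X}"
proof (intro set_eqI iffI)
  fix y assume "y \<in> {y. y \<in> X \<and> shift y = x}"
  then show "y \<in> {y. y \<in> (\<lambda>b. pre b x) ` {0, 1} \<and> y \<in> X}"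
    using X_range[of y 0] pre_shift[of y] by auto
qed auto

lemma pre_neq: "pre 0 x \<noteq> pre 1 x"
  using less_fun_pre_0_1[of x x] less_fun_irrefl by metis

lemma transfer_fun_eq:
  "transfer_fun \<beta> \<phi> f x = (if pre 0 x \<in> X then of_real (exp (\<phi> (pre 0 x))) * f (pre 0 x) else 0)
     + (if pre 1 x \<in> X then of_real (exp (\<phi> (pre 1 x))) * f (pre 1 x) else 0)"
proof -
  have "transfer_fun \<beta> \<phi> f x =
      (\<Sum>y\<in>{y. y \<in> (\<lambda>b. pre b x) ` {0, 1} \<and> y \<in> X}. complex_of_real (exp (\<phi> y)) * f y)"
    unfolding transfer_fun_def shift_preimages ..
  also have "\<dots> = (\<Sum>y\<in>(\<lambda>b. pre b x) ` {0, 1}. if y \<in> X then complex_of_real (exp (\<phi> y)) * f y else 0)"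
    by (rule sum.inter_filter) simp
  finally show ?thesis using pre_neq by (simp del: of_real_exp)
qed

lemma transfer_fun_pow:
  assumes "x \<in> X"
  shows "(transfer_fun \<beta> \<phi> ^^ n) f x = (\<Sum>w\<in>words n.
     if cat w x \<in> X then of_real (exp (birkhoff_sum n \<phi> (cat w x))) * f (cat w x) else 0)"
proof (induction n arbitrary: f)
  case 0
  show ?case using assms by (simp add: birkhoff_sum_def)
next
  case (Suc n)
  have Suc_birk: "birkhoff_sum (Suc n) \<phi> (pre b y) = \<phi> (pre b y) + birkhoff_sum n \<phi> y" for b y
    unfolding birkhoff_sum_def by (subst sum.lessThan_Suc_shift) (simp add: funpow_swap1)
  \<comment> \<open>Splitting off the innermost factor prepends the new letter to the whole word,
    which matches \<open>Suc_birk\<close>: the new point comes first in the Birkhoff sum.\<close>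
  have "(transfer_fun \<beta> \<phi> ^^ Suc n) f x = (transfer_fun \<beta> \<phi> ^^ n) (transfer_fun \<beta> \<phi> f) x"
    by (simp add: funpow_swap1)
  also have "\<dots> = (\<Sum>w\<in>words n. if cat w x \<in> X
     then of_real (exp (birkhoff_sum n \<phi> (cat w x))) * transfer_fun \<beta> \<phi> f (cat w x) else 0)"
    by (rule Suc)
  also have "\<dots> = (\<Sum>w\<in>words (Suc n).
     if cat w x \<in> X then of_real (exp (birkhoff_sum (Suc n) \<phi> (cat w x))) * f (cat w x) else 0)"
    unfolding sum_words_Suc
    by (intro sum.cong refl) (auto simp: transfer_fun_eq Suc_birk exp_add algebra_simps pre_in_X)
  finally show ?case .
qed

end

section \<open>Bounded variation along finite chains\<close>

fun vsum :: "(bseq \<Rightarrow> complex) \<Rightarrow> bseq list \<Rightarrow> real" where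
  "vsum f (x # y # xs) = cmod (f y - f x) + vsum f (y # xs)"
| "vsum f _ = 0"

lemma vsum_nonneg: "0 \<le> vsum f xs"
  by (induction f xs rule: vsum.induct) auto

lemma vsum_map: "vsum f (map h xs) = vsum (\<lambda>x. f (h x)) xs"
  by (induction "\<lambda>x. f (h x)" xs rule: vsum.induct) auto

lemma vsum_le:
  "(\<And>x y. x \<in> set xs \<Longrightarrow> y \<in> set xs \<Longrightarrow> cmod (f x - f y) \<le> A * cmod (g x - g y))
    \<Longrightarrow> vsum f xs \<le> A * vsum g xs"
  by (induction f xs rule: vsum.induct) (auto simp: distrib_left intro!: add_mono)

lemma vsum_cong: "(\<And>x. x \<in> set xs \<Longrightarrow> f x = g x) \<Longrightarrow> vsum f xs = vsum g xs"
  by (induction f xs rule: vsum.induct) auto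

lemma vsum_add: "vsum (\<lambda>x. f x + g x) xs \<le> vsum f xs + vsum g xs"
proof (induction f xs rule: vsum.induct)
  case (1 f x y xs)
  have "cmod (f y + g y - (f x + g x)) \<le> cmod (f y - f x) + cmod (g y - g x)"
    by (metis add_diff_add norm_triangle_ineq)
  then show ?case using 1 by simp
qed auto

lemma vsum_sum: "vsum (\<lambda>x. \<Sum>w\<in>S. h w x) xs \<le> (\<Sum>w\<in>S. vsum (h w) xs)"
proof (cases "finite S")
  case True
  then show ?thesis
  proof induction
    case empty
    have "vsum (\<lambda>x. 0) xs = 0" by (induction "\<lambda>x::bseq. 0::complex" xs rule: vsum.induct) auto
    then show ?case by simp
  next
    case (insert w S)
    then show ?case using vsum_add[of "h w" "\<lambda>x. \<Sum>w\<in>S. h w x" xs] by simp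
  qed
next
  case False
  have "vsum (\<lambda>x. 0) xs = 0" by (induction "\<lambda>x::bseq. 0::complex" xs rule: vsum.induct) auto
  then show ?thesis using False by simp
qed

lemma vsum_append: "vsum f xs + vsum f ys \<le> vsum f (xs @ ys)"
proof (induction f xs rule: vsum.induct)
  case ("2_2" f x)
  then show ?case by (cases ys) auto
qed auto

lemma vsum_mult:
  assumes "\<And>x. x \<in> set xs \<Longrightarrow> cmod (f x) \<le> F" "\<And>x. x \<in> set xs \<Longrightarrow> cmod (g x) \<le> G"
  shows "vsum (\<lambda>x. f x * g x) xs \<le> F * vsum g xs + G * vsum f xs"
  using assms
proof (induction f xs rule: vsum.induct)
  case (1 f x y xs)
  have "f y * g y - f x * g x = f y * (g y - g x) + (f y - f x) * g x" by (simp add: algebra_simps)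
  then have "cmod (f y * g y - f x * g x) \<le> cmod (f y) * cmod (g y - g x) + cmod (f y - f x) * cmod (g x)"
    by (metis norm_mult norm_triangle_ineq)
  also have "\<dots> \<le> F * cmod (g y - g x) + cmod (f y - f x) * G"
    using 1(2,3) by (intro add_mono mult_right_mono mult_left_mono) auto
  finally show ?case using 1 by (simp add: algebra_simps)
qed auto

lemma vsum_tendsto:
  "(\<And>x. x \<in> set xs \<Longrightarrow> (\<lambda>n. F n x) \<longlonglongrightarrow> f x) \<Longrightarrow> (\<lambda>n. vsum (F n) xs) \<longlonglongrightarrow> vsum f xs"
  by (induction f xs rule: vsum.induct) (auto intro!: tendsto_intros)

lemma vsum_nth: "vsum f xs = (\<Sum>i<length xs - 1. cmod (f (xs ! Suc i) - f (xs ! i)))"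
proof (induction f xs rule: vsum.induct)
  case (1 f x y xs)
  then show ?case by (simp add: sum.lessThan_Suc_shift del: sum.lessThan_Suc)
qed auto

text \<open>Cutting a function off outside an initial segment costs one jump.\<close>

lemma vsum_cutoff:
  assumes "sorted_wrt less_fun xs"
    and down: "\<And>x y. x \<in> set xs \<Longrightarrow> y \<in> D \<Longrightarrow> less_fun x y \<Longrightarrow> x \<in> D"
    and "\<And>x. x \<in> set xs \<Longrightarrow> x \<in> D \<Longrightarrow> cmod (h x) \<le> S" and "0 \<le> S"
  shows "vsum (\<lambda>x. if x \<in> D then h x else 0) xs \<le> vsum h (filter (\<lambda>x. x \<in> D) xs) + S"
  using assms
proof (induction h xs rule: vsum.induct)
  case (1 h x y xs)
  show ?case
  proof (cases "y \<in> D")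
    case True
    then have "x \<in> D" using 1(3)[of x y] 1(2) by auto
    then show ?thesis using 1 True by auto
  next
    case False
    have rest: "z \<notin> D" if "z \<in> set (y # xs)" for z
      using that False 1(3)[of y z] 1(2) by auto
    have "vsum (\<lambda>x. if x \<in> D then h x else 0) (y # xs) = vsum (\<lambda>x. 0) (y # xs)"
      by (rule vsum_cong) (use rest in auto)
    also have "\<dots> = 0" using vsum_le[of "y # xs" "\<lambda>x. 0" 0 "\<lambda>x. 0"] vsum_nonneg[of "\<lambda>x. 0" "y # xs"] by simp
    finally show ?thesis
      using False 1(4)[of x] 1(5) vsum_nonneg[of h "filter (\<lambda>x. x \<in> D) (x # xs)"] by auto
  qed
qed auto

section \<open>Chains and total variation on subsets of the beta-shift\<close>

context beta_shift_space
begin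

text \<open>The endpoints are not prescribed, so chains can be restricted to cylinders, mapped by
  branches and concatenated. Adding endpoints never decreases a sum, so \<open>tv X\<close> is still
  the variation.\<close>

definition chains :: "bseq set \<Rightarrow> bseq list set" where
  "chains I = {xs. sorted_wrt less_fun xs \<and> set xs \<subseteq> I}"

definition tv :: "bseq set \<Rightarrow> (bseq \<Rightarrow> complex) \<Rightarrow> real" where
  "tv I f = (SUP xs\<in>chains I. vsum f xs)"

lemma Nil_chain [simp, intro]: "[] \<in> chains I"
  by (simp add: chains_def)

lemma chains_mono: "I \<subseteq> J \<Longrightarrow> chains I \<subseteq> chains J"
  by (auto simp: chains_def)

lemma beta_chain_vsum:
  assumes "(n, x) \<in> beta_chains \<beta>"
  shows "\<exists>xs\<in>chains X. (\<Sum>i<n. cmod (f (x (Suc i)) - f (x i))) = vsum f xs"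
proof (intro bexI)
  have x: "\<And>i. i \<le> n \<Longrightarrow> x i \<in> X" "\<And>i. i < n \<Longrightarrow> less_fun (x i) (x (Suc i))"
    using assms by (auto simp: beta_chains_def)
  have nth: "map x [0..<Suc n] ! i = x i" if "i \<le> n" for i
    using that by (simp add: nth_append del: upt_Suc)
  show "map x [0..<Suc n] \<in> chains X"
    using x unfolding chains_def
    by (auto simp: sorted_wrt_iff_nth_Suc_transp[OF transp_less_fun] nth simp del: upt_Suc)
  show "(\<Sum>i<n. cmod (f (x (Suc i)) - f (x i))) = vsum f (map x [0..<Suc n])"
    unfolding vsum_nth by (rule sum.cong) (auto simp: nth simp del: upt_Suc)
qed

text \<open>\<open>zero_seq\<close> is the least and \<open>\<Omega>\<close> the greatest point of
  the beta-shift, so each of them that is missing can be attached to the chain.\<close>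

lemma vsum_le_beta_chain:
  assumes "xs \<in> chains X"
  shows "\<exists>(n, x)\<in>beta_chains \<beta>. vsum f xs \<le> (\<Sum>i<n. cmod (f (x (Suc i)) - f (x i)))"
proof -
  have "\<exists>ys. ys \<in> chains X \<and> ys \<noteq> [] \<and> hd ys = zero_seq \<and> vsum f xs \<le> vsum f ys"
  proof (cases "xs = [] \<or> hd xs \<noteq> zero_seq")
    case True
    have "less_fun zero_seq y" if "y \<in> set xs" for y
    proof -
      have "y \<in> X" using assms that by (auto simp: chains_def)
      then have le: "lex_le zero_seq z" if "z \<in> X" for z
        using X_range that by (auto intro!: zero_le)
      have "zero_seq \<noteq> y"
      proof
        assume "zero_seq = y"
        with that True have "less_fun (hd xs) zero_seq" "hd xs \<in> X"
          using assms by (cases xs; auto simp: chains_def)+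
        then show False using le[of "hd xs"] less_fun_asym by (auto simp: lex_le_def less_fun_irrefl)
      qed
      then show ?thesis using le[OF \<open>y \<in> X\<close>] by (auto simp: lex_le_def)
    qed
    then have "zero_seq # xs \<in> chains X" using assms zero_seq_in by (auto simp: chains_def)
    moreover have "vsum f xs \<le> vsum f (zero_seq # xs)" using vsum_append[of f "[zero_seq]" xs] by simp
    ultimately show ?thesis by (intro exI[of _ "zero_seq # xs"]) auto
  qed (use assms in auto)
  then obtain ys where ys: "ys \<in> chains X" "ys \<noteq> []" "hd ys = zero_seq" "vsum f xs \<le> vsum f ys" by blast
  have "\<exists>zs. zs \<in> chains X \<and> zs \<noteq> [] \<and> hd zs = zero_seq \<and> last zs = \<Omega> \<and> vsum f xs \<le> vsum f zs"
  proof (cases "last ys = \<Omega>")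
    case False
    have "less_fun y \<Omega>" if y: "y \<in> set ys" for y
    proof -
      have yX: "y \<in> X" using ys y by (auto simp: chains_def)
      have lX: "last ys \<in> X" using ys by (auto simp: chains_def)
      have "less_fun y (last ys) \<or> y = last ys"
        using ys(1,2) y by (cases ys rule: rev_cases) (auto simp: chains_def sorted_wrt_append)
      moreover have "less_fun (last ys) \<Omega>" using X_le_one[OF lX] False by (simp add: lex_le_def)
      ultimately show ?thesis by (auto intro: less_fun_trans)
    qed
    then have "ys @ [\<Omega>] \<in> chains X" using ys one_seq_in by (auto simp: chains_def sorted_wrt_append)
    moreover have "vsum f ys \<le> vsum f (ys @ [\<Omega>])" using vsum_append[of f ys "[\<Omega>]"] by simp
    ultimately show ?thesis using ys by (intro exI[of _ "ys @ [\<Omega>]"]) auto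
  qed (use ys in auto)
  then obtain zs where zs: "zs \<in> chains X" "zs \<noteq> []" "hd zs = zero_seq" "last zs = \<Omega>" "vsum f xs \<le> vsum f zs"
    by blast
  have "(length zs - 1, \<lambda>i. zs ! i) \<in> beta_chains \<beta>"
    using zs unfolding beta_chains_def chains_def
    by (auto simp: sorted_wrt_iff_nth_Suc_transp[OF transp_less_fun] hd_conv_nth last_conv_nth
        subset_eq all_set_conv_all_nth length_greater_0_conv[symmetric] simp del: length_greater_0_conv)
  then show ?thesis using zs(5) by (intro bexI) (auto simp: vsum_nth)
qed

text \<open>This replaces the extended real supremum over chains with fixed endpoints by a real
  supremum over all chains.\<close>

lemma BV_iff: "f \<in> BV \<beta> \<longleftrightarrow> bdd_above (vsum f ` chains X)"
  and var_eq: "f \<in> BV \<beta> \<Longrightarrow> enn2real (var \<beta> f) = tv X f"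
proof -
  have ub: "ennreal (vsum f xs) \<le> var \<beta> f" if xs: "xs \<in> chains X" for xs
  proof -
    obtain n x where nx: "(n, x) \<in> beta_chains \<beta>"
        "vsum f xs \<le> (\<Sum>i<n. cmod (f (x (Suc i)) - f (x i)))"
      using vsum_le_beta_chain[OF xs, of f] by blast
    have "ennreal (vsum f xs) \<le> ennreal (\<Sum>i<n. cmod (f (x (Suc i)) - f (x i)))"
      using nx by (intro ennreal_leI)
    also have "\<dots> \<le> var \<beta> f" unfolding var_def by (rule SUP_upper2[OF nx(1)]) simp
    finally show ?thesis .
  qed
  have le: "var \<beta> f \<le> ennreal (tv X f)" if bdd: "bdd_above (vsum f ` chains X)"
    unfolding var_def
  proof (rule SUP_least)
    fix c assume c: "c \<in> beta_chains \<beta>"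
    obtain n x where nx: "c = (n, x)" by (cases c)
    obtain xs where "xs \<in> chains X" "(\<Sum>i<n. cmod (f (x (Suc i)) - f (x i))) = vsum f xs"
      using beta_chain_vsum c nx by blast
    then show "(case c of (n, x) \<Rightarrow> ennreal (\<Sum>i<n. cmod (f (x (Suc i)) - f (x i)))) \<le> ennreal (tv X f)"
      unfolding nx tv_def using bdd by (auto intro!: ennreal_leI cSUP_upper)
  qed
  have real_ub: "vsum f xs \<le> enn2real (var \<beta> f)" if "f \<in> BV \<beta>" "xs \<in> chains X" for xs
    using enn2real_mono[OF ub[OF that(2)]] that(1) vsum_nonneg[of f xs] by (simp add: BV_def)
  show iff: "f \<in> BV \<beta> \<longleftrightarrow> bdd_above (vsum f ` chains X)"
  proof
    assume "f \<in> BV \<beta>"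
    then show "bdd_above (vsum f ` chains X)" using real_ub by (intro bdd_aboveI[of _ "enn2real (var \<beta> f)"]) auto
  next
    assume "bdd_above (vsum f ` chains X)"
    then have "var \<beta> f \<le> ennreal (tv X f)" by (rule le)
    then show "f \<in> BV \<beta>" unfolding BV_def by (auto intro: le_less_trans)
  qed
  show "enn2real (var \<beta> f) = tv X f" if f: "f \<in> BV \<beta>"
  proof (rule antisym)
    have bdd: "bdd_above (vsum f ` chains X)" using f iff by simp
    have "0 \<le> tv X f" unfolding tv_def
      using cSUP_upper[OF Nil_chain bdd] by simp
    then show "enn2real (var \<beta> f) \<le> tv X f"
      using enn2real_mono[OF le[OF bdd]] by simp
    show "tv X f \<le> enn2real (var \<beta> f)"
      unfolding tv_def using real_ub[OF f] Nil_chain by (intro cSUP_least) auto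
  qed
qed

abbreviation nrm :: "(bseq \<Rightarrow> complex) \<Rightarrow> real" where "nrm \<equiv> BV_norm \<beta>"

lemma vsum_le_tv: "f \<in> BV \<beta> \<Longrightarrow> I \<subseteq> X \<Longrightarrow> xs \<in> chains I \<Longrightarrow> vsum f xs \<le> tv I f"
  unfolding tv_def BV_iff using chains_mono[of I X]
  by (intro cSUP_upper) (auto elim!: bdd_above_mono)

lemma tv_leI: "(\<And>xs. xs \<in> chains I \<Longrightarrow> vsum f xs \<le> c) \<Longrightarrow> tv I f \<le> c"
  unfolding tv_def using Nil_chain by (intro cSUP_least) auto

lemma tv_nonneg: "f \<in> BV \<beta> \<Longrightarrow> I \<subseteq> X \<Longrightarrow> 0 \<le> tv I f"
  using vsum_le_tv[of f I "[]"] by simp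

text \<open>A chain in \<open>I\<close> followed by a chain in \<open>J\<close> is a chain in
  \<open>K\<close>; the jump between them is discarded.\<close>

lemma tv_superadditive:
  assumes "f \<in> BV \<beta>" "K \<subseteq> X" "I \<subseteq> K" "J \<subseteq> K" and lt: "\<And>x y. x \<in> I \<Longrightarrow> y \<in> J \<Longrightarrow> less_fun x y"
  shows "tv I f + tv J f \<le> tv K f"
proof -
  have "tv I f \<le> tv K f - tv J f"
  proof (rule tv_leI)
    fix xs assume xs: "xs \<in> chains I"
    have "tv J f \<le> tv K f - vsum f xs"
    proof (rule tv_leI)
      fix ys assume ys: "ys \<in> chains J"
      have "xs @ ys \<in> chains K" using xs ys assms(3,4) by (auto simp: chains_def sorted_wrt_append intro!: lt)
      then have "vsum f (xs @ ys) \<le> tv K f" using assms by (intro vsum_le_tv) auto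
      then show "vsum f ys \<le> tv K f - vsum f xs" using vsum_append[of f xs ys] by simp
    qed
    then show "vsum f xs \<le> tv K f - tv J f" by simp
  qed
  then show ?thesis by simp
qed

lemma diff_le_tv:
  assumes "f \<in> BV \<beta>" "I \<subseteq> X" "x \<in> I" "y \<in> I" shows "cmod (f x - f y) \<le> tv I f"
proof -
  consider "x = y" | "less_fun x y" | "less_fun y x" using less_fun_total by blast
  then show ?thesis
  proof cases
    case 1
    then show ?thesis using tv_nonneg assms by simp
  next
    case 2
    then have "[x, y] \<in> chains I" using assms by (simp add: chains_def)
    from vsum_le_tv[OF assms(1,2) this] show ?thesis by (simp add: norm_minus_commute)
  next
    case 3
    then have "[y, x] \<in> chains I" using assms by (simp add: chains_def)
    from vsum_le_tv[OF assms(1,2) this] show ?thesis by simp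
  qed
qed

lemma cmod_le_sup_norm:
  assumes "f \<in> BV \<beta>" "x \<in> X" shows "cmod (f x) \<le> sup_norm \<beta> f"
  unfolding sup_norm_def
proof (rule cSUP_upper[OF assms(2)])
  have "cmod (f y) \<le> cmod (f zero_seq) + tv X f" if "y \<in> X" for y
    using diff_le_tv[OF assms(1) order_refl that zero_seq_in] norm_triangle_sub[of "f y" "f zero_seq"] by linarith
  then show "bdd_above ((\<lambda>x. cmod (f x)) ` X)" by (auto intro!: bdd_aboveI)
qed

lemma nrm_eq: "f \<in> BV \<beta> \<Longrightarrow> nrm f = sup_norm \<beta> f + tv X f"
  by (simp add: BV_norm_def var_eq)

lemma nrm_ub:
  "f \<in> BV \<beta> \<Longrightarrow> x \<in> X \<Longrightarrow> xs \<in> chains X \<Longrightarrow> cmod (f x) + vsum f xs \<le> nrm f"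
  unfolding nrm_eq using cmod_le_sup_norm vsum_le_tv by (intro add_mono) auto

text \<open>The point \<open>x\<close> and the chain \<open>xs\<close> vary independently, so the
  supremum of the left side is \<open>nrm f\<close> itself. One estimate thus yields both membership
  and the norm bound.\<close>

lemma BV_leI:
  assumes "\<And>x xs. x \<in> X \<Longrightarrow> xs \<in> chains X \<Longrightarrow> cmod (f x) + vsum f xs \<le> C"
  shows "f \<in> BV \<beta>" "nrm f \<le> C"
proof -
  show f: "f \<in> BV \<beta>"
    unfolding BV_iff
  proof (rule bdd_aboveI2)
    fix xs assume "xs \<in> chains X"
    from assms[OF zero_seq_in this] show "vsum f xs \<le> C" using norm_ge_zero[of "f zero_seq"] by linarith
  qed
  have "sup_norm \<beta> f \<le> C - tv X f"
    unfolding sup_norm_def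
  proof (rule cSUP_least)
    fix x assume x: "x \<in> X"
    have "tv X f \<le> C - cmod (f x)" by (rule tv_leI) (use assms[OF x] in \<open>simp add: algebra_simps\<close>)
    then show "cmod (f x) \<le> C - tv X f" by simp
  qed (use zero_seq_in in blast)
  then show "nrm f \<le> C" by (simp add: nrm_eq[OF f])
qed

lemma nrm_nonneg: "f \<in> BV \<beta> \<Longrightarrow> 0 \<le> nrm f"
  using nrm_ub[OF _ zero_seq_in, of f "[]"] order_trans[OF norm_ge_zero[of "f zero_seq"]] by auto

lemma cmod_le_nrm: "f \<in> BV \<beta> \<Longrightarrow> x \<in> X \<Longrightarrow> cmod (f x) \<le> nrm f"
  using nrm_ub[of f x "[]"] by auto

lemma tv_le_nrm: "f \<in> BV \<beta> \<Longrightarrow> tv X f \<le> nrm f"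
  using cmod_le_sup_norm[OF _ zero_seq_in, of f] order_trans[OF norm_ge_zero[of "f zero_seq"]]
  by (simp add: nrm_eq)

section \<open>Products and limits of functions of bounded variation\<close>

lemma BV_add: assumes "f \<in> BV \<beta>" "g \<in> BV \<beta>"
  shows "f + g \<in> BV \<beta>" "nrm (f + g) \<le> nrm f + nrm g"
proof -
  have *: "cmod ((f + g) x) + vsum (f + g) xs \<le> nrm f + nrm g" if "x \<in> X" "xs \<in> chains X" for x xs
    using nrm_ub[OF assms(1) that] nrm_ub[OF assms(2) that] vsum_add[of f g xs]
      norm_triangle_ineq[of "f x" "g x"] by (simp add: plus_fun_def)
  show "f + g \<in> BV \<beta>" "nrm (f + g) \<le> nrm f + nrm g" by (rule BV_leI[of "f + g", OF *]; assumption)+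
qed

text \<open>With sup norms \<open>F\<close>, \<open>G\<close> and variations \<open>a\<close>,
  \<open>b\<close> the product rule for \<open>vsum\<close> leads to \<open>F G + F b + G a\<close>,
  which is \<open>(F + a) (G + b)\<close> without the term \<open>a b\<close>.\<close>

lemma BV_mult: assumes "f \<in> BV \<beta>" "g \<in> BV \<beta>"
  shows "f * g \<in> BV \<beta>" "nrm (f * g) \<le> nrm f * nrm g"
proof -
  have *: "cmod ((f * g) x) + vsum (f * g) xs \<le> nrm f * nrm g" if x: "x \<in> X" and xs: "xs \<in> chains X" for x xs
  proof -
    define F G where "F = sup_norm \<beta> f" and "G = sup_norm \<beta> g"
    define a b where "a = tv X f" and "b = tv X g"
    have FG: "\<And>y. y \<in> X \<Longrightarrow> cmod (f y) \<le> F" "\<And>y. y \<in> X \<Longrightarrow> cmod (g y) \<le> G"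
      unfolding F_def G_def using assms by (auto intro: cmod_le_sup_norm)
    have pos: "0 \<le> F" "0 \<le> G" using FG[OF x] norm_ge_zero order_trans by blast+
    have ab: "0 \<le> a" "0 \<le> b" "vsum f xs \<le> a" "vsum g xs \<le> b"
      unfolding a_def b_def using assms xs by (auto intro: tv_nonneg vsum_le_tv)
    have "vsum (\<lambda>x. f x * g x) xs \<le> F * vsum g xs + G * vsum f xs"
      using xs FG by (intro vsum_mult) (auto simp: chains_def)
    also have "\<dots> \<le> F * b + G * a" using pos ab by (intro add_mono mult_left_mono) auto
    moreover have "cmod (f x * g x) \<le> F * G"
      unfolding norm_mult using FG[OF x] pos by (intro mult_mono) auto
    moreover have "0 \<le> a * b" using ab by simp
    moreover have "nrm f * nrm g = (F + a) * (G + b)"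
      by (simp add: nrm_eq assms F_def G_def a_def b_def)
    ultimately show ?thesis by (simp add: times_fun_def algebra_simps)
  qed
  show "f * g \<in> BV \<beta>" "nrm (f * g) \<le> nrm f * nrm g" by (rule BV_leI[of "f * g", OF *]; assumption)+
qed

lemma BV_const: "(\<lambda>_. c) \<in> BV \<beta>" "nrm (\<lambda>_. c) \<le> cmod c"
proof -
  have "vsum (\<lambda>_. c) xs = 0" for xs by (induction "\<lambda>_::bseq. c" xs rule: vsum.induct) auto
  then have "cmod c + vsum (\<lambda>_. c) xs \<le> cmod c" for xs by simp
  from BV_leI[of "\<lambda>_. c", OF this] show "(\<lambda>_. c) \<in> BV \<beta>" "nrm (\<lambda>_. c) \<le> cmod c" by auto
qed

text \<open>For a fixed point and a fixed chain the quantity in \<open>BV_leI\<close> involves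
  finitely many values of the function and is continuous in them, so a norm bound survives pointwise
  limits.\<close>

lemma BV_limit:
  assumes "\<And>n. F n \<in> BV \<beta>" "\<And>x. x \<in> X \<Longrightarrow> (\<lambda>n. F n x) \<longlonglongrightarrow> f x" "\<forall>\<^sub>F n in sequentially. nrm (F n) \<le> C"
  shows "f \<in> BV \<beta>" "nrm f \<le> C"
proof -
  have *: "cmod (f x) + vsum f xs \<le> C" if x: "x \<in> X" and xs: "xs \<in> chains X" for x xs
  proof (rule tendsto_upperbound)
    show "(\<lambda>n. cmod (F n x) + vsum (F n) xs) \<longlonglongrightarrow> cmod (f x) + vsum f xs"
      using xs by (intro tendsto_intros vsum_tendsto assms x) (auto simp: chains_def)
    show "\<forall>\<^sub>F n in sequentially. cmod (F n x) + vsum (F n) xs \<le> C"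
      using assms(3) by eventually_elim (use nrm_ub[OF assms(1) x xs] in \<open>auto intro: order_trans\<close>)
  qed auto
  show "f \<in> BV \<beta>" "nrm f \<le> C" using BV_leI[OF *] by auto
qed

lemma BV_scale: assumes "f \<in> BV \<beta>"
  shows "(\<lambda>x. c * f x) \<in> BV \<beta>" "nrm (\<lambda>x. c * f x) \<le> cmod c * nrm f"
proof -
  have eq: "(\<lambda>x. c * f x) = (\<lambda>_. c) * f" by auto
  show "(\<lambda>x. c * f x) \<in> BV \<beta>" unfolding eq by (intro BV_mult BV_const assms)
  have "nrm ((\<lambda>_. c) * f) \<le> nrm (\<lambda>_. c) * nrm f" by (intro BV_mult BV_const assms)
  also have "\<dots> \<le> cmod c * nrm f" by (intro mult_right_mono BV_const nrm_nonneg assms)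
  finally show "nrm (\<lambda>x. c * f x) \<le> cmod c * nrm f" unfolding eq .
qed

lemma BV_minus: assumes "f \<in> BV \<beta>" shows "- f \<in> BV \<beta>" "nrm (- f) \<le> nrm f"
proof -
  have eq: "- f = (\<lambda>x. (- 1) * f x)" by auto
  show "- f \<in> BV \<beta>" "nrm (- f) \<le> nrm f"
    unfolding eq using BV_scale[OF assms, of "- 1"] by simp_all
qed

lemma BV_diff: assumes "f \<in> BV \<beta>" "g \<in> BV \<beta>"
  shows "f - g \<in> BV \<beta>" "nrm (f - g) \<le> nrm f + nrm g"
  using BV_add[OF assms(1) BV_minus(1)[OF assms(2)]] BV_minus(2)[OF assms(2)] by simp_all

lemma BV_zero: "0 \<in> BV \<beta>" "nrm 0 = 0"
  using BV_const[of 0] nrm_nonneg[of 0] by (simp_all add: zero_fun_def)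

lemma BV_sum: "(\<And>i. i \<in> S \<Longrightarrow> h i \<in> BV \<beta>) \<Longrightarrow> sum h S \<in> BV \<beta> \<and> nrm (sum h S) \<le> (\<Sum>i\<in>S. nrm (h i))"
proof (induction S rule: infinite_finite_induct)
  case (insert i S)
  then have "h i \<in> BV \<beta>" "sum h S \<in> BV \<beta>" "nrm (sum h S) \<le> (\<Sum>i\<in>S. nrm (h i))" by auto
  then show ?case
    using BV_add[of "h i" "sum h S"] unfolding sum.insert[OF insert(1,2)] by linarith
qed (use BV_zero in simp_all)

text \<open>Point values are bounded by the norm, which gives a pointwise limit;
  \<open>BV_limit\<close> applied to \<open>F n - F m\<close> for growing \<open>m\<close> turns it
  into a limit in norm.\<close>

lemma BV_complete:
  assumes F: "\<And>n. F n \<in> BV \<beta>" and Cauchy: "\<And>e. e > 0 \<Longrightarrow> \<exists>N. \<forall>m\<ge>N. \<forall>n\<ge>N. nrm (F m - F n) < e"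
  shows "\<exists>f\<in>BV \<beta>. (\<forall>x\<in>X. (\<lambda>n. F n x) \<longlonglongrightarrow> f x) \<and> (\<lambda>n. nrm (F n - f)) \<longlonglongrightarrow> 0"
proof -
  have "\<exists>l. (\<lambda>n. F n x) \<longlonglongrightarrow> l" if x: "x \<in> X" for x
  proof -
    have "Cauchy (\<lambda>n. F n x)"
    proof (rule CauchyI)
      fix e :: real assume "e > 0"
      then obtain N where N: "\<forall>m\<ge>N. \<forall>n\<ge>N. nrm (F m - F n) < e" using Cauchy by blast
      have "norm (F m x - F n x) < e" if "m \<ge> N" "n \<ge> N" for m n
      proof -
        have "norm (F m x - F n x) \<le> nrm (F m - F n)"
          using cmod_le_nrm[OF BV_diff(1)[OF F F] x, of m n] by simp
        then show ?thesis using N that by (meson order_le_less_trans)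
      qed
      then show "\<exists>M. \<forall>m\<ge>M. \<forall>n\<ge>M. norm (F m x - F n x) < e" by blast
    qed
    then show ?thesis using Cauchy_convergent convergent_def by blast
  qed
  then obtain f where f: "\<And>x. x \<in> X \<Longrightarrow> (\<lambda>n. F n x) \<longlonglongrightarrow> f x" by metis
  have tail: "\<exists>N. \<forall>n\<ge>N. F n - f \<in> BV \<beta> \<and> nrm (F n - f) \<le> e" if "e > 0" for e
  proof -
    obtain N where N: "\<forall>m\<ge>N. \<forall>n\<ge>N. nrm (F m - F n) < e" using Cauchy \<open>e > 0\<close> by blast
    have "F n - f \<in> BV \<beta> \<and> nrm (F n - f) \<le> e" if "n \<ge> N" for n
    proof -
      have "\<forall>\<^sub>F m in sequentially. nrm (F n - F m) \<le> e"
        using N that by (auto simp: eventually_sequentially intro!: exI[of _ N] less_imp_le)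
      moreover have "(\<lambda>m. (F n - F m) x) \<longlonglongrightarrow> (F n - f) x" if "x \<in> X" for x
        using f[OF that] by (auto intro!: tendsto_diff)
      ultimately show ?thesis
        using BV_limit[where F = "\<lambda>m. F n - F m" and f = "F n - f", OF BV_diff(1)[OF F F]] by blast
    qed
    then show ?thesis by blast
  qed
  obtain n where "F n - f \<in> BV \<beta>" using tail[of 1] by auto
  then have "F n - (F n - f) \<in> BV \<beta>" by (rule BV_diff(1)[OF F])
  moreover have "F n - (F n - f) = f" by (simp add: fun_eq_iff)
  ultimately have fBV: "f \<in> BV \<beta>" by (simp only:)
  have "(\<lambda>n. nrm (F n - f)) \<longlonglongrightarrow> 0"
  proof (rule LIMSEQ_I)
    fix e :: real assume "e > 0"
    then obtain N where N: "\<forall>n\<ge>N. F n - f \<in> BV \<beta> \<and> nrm (F n - f) \<le> e / 2"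
      using tail[of "e / 2"] by auto
    have "norm (nrm (F n - f) - 0) < e" if "n \<ge> N" for n
      using N that \<open>e > 0\<close> nrm_nonneg[of "F n - f"] by fastforce
    then show "\<exists>N. \<forall>n\<ge>N. norm (nrm (F n - f) - 0) < e" by blast
  qed
  then show ?thesis using f fBV by blast
qed

section \<open>The ideal of null functions and the quotient classes\<close>

lemma BV_null_iff: "f \<in> BV_null \<beta> \<longleftrightarrow> f \<in> BV \<beta> \<and> countable {x \<in> X. f x \<noteq> 0}"
  by (simp add: BV_null_def)

lemma null_BV: "f \<in> BV_null \<beta> \<Longrightarrow> f \<in> BV \<beta>"
  by (simp add: BV_null_iff)

lemma null_add: assumes "f \<in> BV_null \<beta>" "g \<in> BV_null \<beta>" shows "f + g \<in> BV_null \<beta>"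
proof -
  have "{x \<in> X. (f + g) x \<noteq> 0} \<subseteq> {x \<in> X. f x \<noteq> 0} \<union> {x \<in> X. g x \<noteq> 0}" by auto
  then have "countable {x \<in> X. (f + g) x \<noteq> 0}"
    by (rule countable_subset) (use assms in \<open>simp add: BV_null_iff\<close>)
  then show ?thesis using assms BV_add(1)[of f g] by (simp add: BV_null_iff)
qed

lemma null_mult: assumes "f \<in> BV_null \<beta>" "g \<in> BV \<beta>" shows "f * g \<in> BV_null \<beta>"
proof -
  have "{x \<in> X. (f * g) x \<noteq> 0} \<subseteq> {x \<in> X. f x \<noteq> 0}" by auto
  then have "countable {x \<in> X. (f * g) x \<noteq> 0}"
    by (rule countable_subset) (use assms in \<open>simp add: BV_null_iff\<close>)
  then show ?thesis using assms BV_mult(1)[of f g] by (simp add: BV_null_iff)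
qed

lemma null_zero: "0 \<in> BV_null \<beta>"
  by (simp add: BV_null_iff BV_zero)

lemma null_minus: "f \<in> BV_null \<beta> \<Longrightarrow> - f \<in> BV_null \<beta>"
  by (simp add: BV_null_iff BV_minus)

lemma null_diff: "f \<in> BV_null \<beta> \<Longrightarrow> g \<in> BV_null \<beta> \<Longrightarrow> f - g \<in> BV_null \<beta>"
  using null_add[of f "- g"] null_minus[of g] by simp

lemma null_scale: assumes "f \<in> BV_null \<beta>" shows "(\<lambda>x. c * f x) \<in> BV_null \<beta>"
  using null_mult[OF assms BV_const(1)[of c]] by (simp add: times_fun_def mult.commute)

lemma null_sum: "(\<And>i. i \<in> S \<Longrightarrow> h i \<in> BV_null \<beta>) \<Longrightarrow> sum h S \<in> BV_null \<beta>"
proof (induction S rule: infinite_finite_induct)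
  case (insert i S)
  then show ?case using null_add[of "h i" "sum h S"] unfolding sum.insert[OF insert(1,2)] by blast
qed (use null_zero in simp_all)

lemma BV_cong:
  assumes "f \<in> BV \<beta>" and eq: "\<And>x. x \<in> X \<Longrightarrow> f x = g x"
  shows "g \<in> BV \<beta>" "f - g \<in> BV_null \<beta>"
proof -
  have "vsum f xs = vsum g xs" if "xs \<in> chains X" for xs
    using that eq by (intro vsum_cong) (auto simp: chains_def)
  then have "vsum f ` chains X = vsum g ` chains X" by (rule image_cong[OF refl])
  then show g: "g \<in> BV \<beta>" using assms(1) by (simp add: BV_iff)
  have "{x \<in> X. (f - g) x \<noteq> 0} = {}" using eq by auto
  then show "f - g \<in> BV_null \<beta>" using BV_diff(1)[OF assms(1) g] by (simp only: BV_null_iff) simp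
qed

lemma BV_rel_iff: "(f, g) \<in> BV_rel \<beta> \<longleftrightarrow> f \<in> BV \<beta> \<and> g \<in> BV \<beta> \<and> f - g \<in> BV_null \<beta>"
proof -
  have "(\<lambda>x. f x - g x) = f - g" by auto
  then show ?thesis by (simp add: BV_rel_def)
qed

lemma in_cls: "h \<in> cls \<beta> f \<longleftrightarrow> f \<in> BV \<beta> \<and> h \<in> BV \<beta> \<and> f - h \<in> BV_null \<beta>"
  by (simp add: cls_def BV_rel_iff)

lemma equiv_BV_rel: "equiv (BV \<beta>) (BV_rel \<beta>)"
proof (rule equivI)
  show "BV_rel \<beta> \<subseteq> BV \<beta> \<times> BV \<beta>" by (auto simp: BV_rel_def)
  show "refl_on (BV \<beta>) (BV_rel \<beta>)" by (auto intro!: refl_onI simp: BV_rel_iff null_zero)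
  show "sym (BV_rel \<beta>)"
    using null_minus by (fastforce intro!: symI simp: BV_rel_iff)
  show "trans (BV_rel \<beta>)"
  proof (rule transI)
    fix f g h assume "(f, g) \<in> BV_rel \<beta>" "(g, h) \<in> BV_rel \<beta>"
    then show "(f, h) \<in> BV_rel \<beta>"
      using null_add[of "f - g" "g - h"] by (auto simp: BV_rel_iff)
  qed
qed

lemma cls_eq_iff: "f \<in> BV \<beta> \<Longrightarrow> g \<in> BV \<beta> \<Longrightarrow> cls \<beta> f = cls \<beta> g \<longleftrightarrow> f - g \<in> BV_null \<beta>"
  unfolding cls_def using eq_equiv_class_iff[OF equiv_BV_rel, of f g] by (simp add: BV_rel_iff)

lemma cls_self: "f \<in> BV \<beta> \<Longrightarrow> f \<in> cls \<beta> f"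
  by (simp add: in_cls null_zero)

lemma cls_in_quot: "cls \<beta> f \<in> quot_space \<beta> \<longleftrightarrow> f \<in> BV \<beta>"
proof
  assume "cls \<beta> f \<in> quot_space \<beta>"
  then have "cls \<beta> f \<noteq> {}" unfolding quot_space_def using in_quotient_imp_non_empty[OF equiv_BV_rel] by blast
  then show "f \<in> BV \<beta>" by (auto simp: in_cls)
next
  assume "f \<in> BV \<beta>"
  then show "cls \<beta> f \<in> quot_space \<beta>" by (auto simp: quot_space_def cls_def intro: quotientI)
qed

lemma quot_cases: assumes "A \<in> quot_space \<beta>" obtains f where "f \<in> BV \<beta>" "A = cls \<beta> f"
  using assms by (auto simp: quot_space_def cls_def elim: quotientE)

lemma qscale_cls: assumes "f \<in> BV \<beta>" shows "qscale \<beta> c (cls \<beta> f) = cls \<beta> (\<lambda>x. c * f x)"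
proof -
  have "cls \<beta> (\<lambda>x. c * g x) = cls \<beta> (\<lambda>x. c * f x)" if "g \<in> cls \<beta> f" for g
  proof (subst cls_eq_iff)
    have "(\<lambda>x. c * g x) - (\<lambda>x. c * f x) = (\<lambda>x. (- c) * (f - g) x)" by (auto simp: algebra_simps)
    then show "(\<lambda>x. c * g x) - (\<lambda>x. c * f x) \<in> BV_null \<beta>"
      using that null_scale[of "f - g" "- c"] by (simp add: in_cls)
  qed (use that in \<open>auto simp: in_cls intro: BV_scale\<close>)
  then show ?thesis unfolding qscale_def by (intro UN_constant_eq[OF cls_self[OF assms]] ballI)
qed

lemma qadd_cls: assumes "f \<in> BV \<beta>" "g \<in> BV \<beta>" shows "qadd \<beta> (cls \<beta> f) (cls \<beta> g) = cls \<beta> (f + g)"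
proof -
  have "cls \<beta> (\<lambda>x. f' x + g' x) = cls \<beta> (f + g)" if "f' \<in> cls \<beta> f" "g' \<in> cls \<beta> g" for f' g'
  proof -
    have eq: "(\<lambda>x. f' x + g' x) = f' + g'" by (simp add: fun_eq_iff)
    have BV: "f' \<in> BV \<beta>" "g' \<in> BV \<beta>" using that by (simp_all add: in_cls)
    have "f' + g' - (f + g) = - ((f - f') + (g - g'))" by simp
    also have "\<dots> \<in> BV_null \<beta>" using that by (intro null_minus null_add) (simp_all add: in_cls)
    finally show ?thesis
      unfolding eq cls_eq_iff[OF BV_add(1)[OF BV] BV_add(1)[OF assms]] .
  qed
  then show ?thesis
    unfolding qadd_def by (intro UN_constant_eq[OF cls_self[OF assms(1)]] UN_constant_eq[OF cls_self[OF assms(2)]] ballI)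
qed

lemma qdiff_cls: assumes "f \<in> BV \<beta>" "g \<in> BV \<beta>" shows "qdiff \<beta> (cls \<beta> f) (cls \<beta> g) = cls \<beta> (f - g)"
proof -
  have "cls \<beta> (\<lambda>x. f' x - g' x) = cls \<beta> (f - g)" if "f' \<in> cls \<beta> f" "g' \<in> cls \<beta> g" for f' g'
  proof -
    have eq: "(\<lambda>x. f' x - g' x) = f' - g'" by (simp add: fun_eq_iff)
    have BV: "f' \<in> BV \<beta>" "g' \<in> BV \<beta>" using that by (simp_all add: in_cls)
    have "f' - g' - (f - g) = (g - g') - (f - f')" by simp
    also have "\<dots> \<in> BV_null \<beta>" using that by (intro null_diff[of "g - g'" "f - f'"]) (simp_all add: in_cls)
    finally show ?thesis
      unfolding eq cls_eq_iff[OF BV_diff(1)[OF BV] BV_diff(1)[OF assms]] .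
  qed
  then show ?thesis
    unfolding qdiff_def by (intro UN_constant_eq[OF cls_self[OF assms(1)]] UN_constant_eq[OF cls_self[OF assms(2)]] ballI)
qed

section \<open>The quotient norm as a seminorm on functions\<close>

definition p :: "(bseq \<Rightarrow> complex) \<Rightarrow> real" where
  "p f = qnorm \<beta> (cls \<beta> f)"

lemma p_bdd: "bdd_below (nrm ` cls \<beta> f)"
  by (rule bdd_belowI[of _ 0]) (auto simp: in_cls nrm_nonneg)

lemma p_le: "f \<in> BV \<beta> \<Longrightarrow> h \<in> BV \<beta> \<Longrightarrow> f - h \<in> BV_null \<beta> \<Longrightarrow> p f \<le> nrm h"
  unfolding p_def qnorm_def by (rule cINF_lower[OF p_bdd]) (simp add: in_cls)

lemma p_le_nrm: "f \<in> BV \<beta> \<Longrightarrow> p f \<le> nrm f"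
  by (rule p_le) (auto simp: null_zero)

lemma p_less:
  assumes "f \<in> BV \<beta>" "p f < c"
  shows "\<exists>h\<in>BV \<beta>. f - h \<in> BV_null \<beta> \<and> nrm h < c"
proof -
  have "cls \<beta> f \<noteq> {}" using cls_self[OF assms(1)] by blast
  from cINF_less_iff[OF this p_bdd] assms(2) show ?thesis
    unfolding p_def qnorm_def by (auto simp: in_cls)
qed

lemma p_nonneg: assumes "f \<in> BV \<beta>" shows "0 \<le> p f"
proof -
  have "cls \<beta> f \<noteq> {}" using cls_self[OF assms] by blast
  then show ?thesis
    unfolding p_def qnorm_def by (rule cINF_greatest) (auto simp: in_cls nrm_nonneg)
qed

lemma p_cong: "f \<in> BV \<beta> \<Longrightarrow> g \<in> BV \<beta> \<Longrightarrow> f - g \<in> BV_null \<beta> \<Longrightarrow> p f = p g"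
  using cls_eq_iff[of f g] by (simp add: p_def)

lemma p_add: assumes "f \<in> BV \<beta>" "g \<in> BV \<beta>" shows "p (f + g) \<le> p f + p g"
proof (rule field_le_epsilon)
  fix e :: real assume e: "e > 0"
  obtain h where h: "h \<in> BV \<beta>" "f - h \<in> BV_null \<beta>" "nrm h < p f + e / 2"
    using p_less[OF assms(1), of "p f + e / 2"] e by auto
  obtain k where k: "k \<in> BV \<beta>" "g - k \<in> BV_null \<beta>" "nrm k < p g + e / 2"
    using p_less[OF assms(2), of "p g + e / 2"] e by auto
  have "f + g - (h + k) \<in> BV_null \<beta>" using null_add[OF h(2) k(2)] by (simp add: algebra_simps)
  then have "p (f + g) \<le> nrm (h + k)" using assms h k by (intro p_le BV_add)
  also have "\<dots> \<le> nrm h + nrm k" using h k by (intro BV_add)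
  finally show "p (f + g) \<le> p f + p g + e" using h k by linarith
qed

text \<open>The null functions form an ideal, so near-optimal representatives of the two factors
  multiply to a representative of the product.\<close>

lemma p_mult: assumes "f \<in> BV \<beta>" "g \<in> BV \<beta>" shows "p (f * g) \<le> p f * p g"
proof -
  have *: "p (f * g) \<le> (p f + e) * (p g + e)" if e: "e > 0" for e
  proof -
    obtain h where h: "h \<in> BV \<beta>" "f - h \<in> BV_null \<beta>" "nrm h < p f + e"
      using p_less[OF assms(1), of "p f + e"] e by auto
    obtain k where k: "k \<in> BV \<beta>" "g - k \<in> BV_null \<beta>" "nrm k < p g + e"
      using p_less[OF assms(2), of "p g + e"] e by auto
    have "f * g - h * k = (f - h) * g + (g - k) * h" by (simp add: algebra_simps)
    also have "\<dots> \<in> BV_null \<beta>" by (intro null_add null_mult h k assms)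
    finally have "p (f * g) \<le> nrm (h * k)" using assms h k by (intro p_le BV_mult)
    also have "\<dots> \<le> nrm h * nrm k" using h k by (intro BV_mult)
    also have "\<dots> \<le> (p f + e) * (p g + e)" using h k nrm_nonneg p_nonneg[OF assms(1)] e by (intro mult_mono) auto
    finally show ?thesis .
  qed
  have "((\<lambda>e. (p f + e) * (p g + e)) \<longlongrightarrow> (p f + 0) * (p g + 0)) (at_right 0)"
    by (intro tendsto_intros)
  then have "p (f * g) \<le> (p f + 0) * (p g + 0)"
    by (rule tendsto_lowerbound) (auto intro!: * eventually_at_rightI[of 0 1])
  then show ?thesis by simp
qed

lemma p_scale: assumes "f \<in> BV \<beta>" shows "p (\<lambda>x. c * f x) = cmod c * p f"
proof -
  have le: "p (\<lambda>x. c * f x) \<le> cmod c * p f" if "f \<in> BV \<beta>" for c f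
  proof -
    have "p ((\<lambda>_. c) * f) \<le> p (\<lambda>_. c) * p f" using that by (intro p_mult BV_const)
    also have "\<dots> \<le> cmod c * p f"
      using that order_trans[OF p_le_nrm[OF BV_const(1)] BV_const(2)] by (intro mult_right_mono p_nonneg)
    finally show ?thesis by (simp add: times_fun_def)
  qed
  show ?thesis
  proof (cases "c = 0")
    case True
    then show ?thesis using le[OF assms, of c] p_nonneg[OF BV_scale(1)[OF assms], of c] by simp
  next
    case False
    then have "p f \<le> cmod (1 / c) * p (\<lambda>x. c * f x)"
      using le[OF BV_scale(1)[OF assms], of "1 / c" c] by simp
    then have "cmod c * p f \<le> p (\<lambda>x. c * f x)"
      using False by (simp add: norm_divide field_simps)
    then show ?thesis using le[OF assms, of c] by simp
  qed
qed

text \<open>If \<open>p f = 0\<close>, there are representatives \<open>h n\<close> of norm below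
  \<open>1 / Suc n\<close>, each equal to \<open>f\<close> off a countable set. Where
  \<open>f\<close> does not vanish, it differs from some \<open>h n\<close>, so these points lie in
  a countable union.\<close>

lemma p_eq_0_iff: assumes "f \<in> BV \<beta>" shows "p f = 0 \<longleftrightarrow> f \<in> BV_null \<beta>"
proof
  assume "f \<in> BV_null \<beta>"
  then show "p f = 0" using p_le[OF assms BV_zero(1)] p_nonneg[OF assms] BV_zero by simp
next
  assume 0: "p f = 0"
  have "\<forall>n::nat. \<exists>h\<in>BV \<beta>. f - h \<in> BV_null \<beta> \<and> nrm h < 1 / Suc n"
    using p_less[OF assms] 0 by simp
  then obtain h where h: "\<And>n. h n \<in> BV \<beta>" "\<And>n. f - h n \<in> BV_null \<beta>" "\<And>n::nat. nrm (h n) < 1 / Suc n"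
    by metis
  have "{x \<in> X. f x \<noteq> 0} \<subseteq> (\<Union>n. {x \<in> X. (f - h n) x \<noteq> 0})"
  proof
    fix x assume "x \<in> {x \<in> X. f x \<noteq> 0}"
    then have x: "x \<in> X" "cmod (f x) > 0" by auto
    then obtain n where n: "1 / Suc n < cmod (f x)" using nat_approx_posE by blast
    have "cmod (h n x) \<le> nrm (h n)" using h x by (intro cmod_le_nrm)
    then have "f x \<noteq> h n x" using n h(3)[of n] by auto
    then show "x \<in> (\<Union>n. {x \<in> X. (f - h n) x \<noteq> 0})" using x by auto
  qed
  moreover have "countable (\<Union>n. {x \<in> X. (f - h n) x \<noteq> 0})"
    using h(2) by (intro countable_UN) (auto simp: BV_null_iff)
  ultimately show "f \<in> BV_null \<beta>" using assms countable_subset by (auto simp: BV_null_iff)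
qed

text \<open>Along a subsequence with consecutive differences below \<open>(1 / 2) ^ k\<close>, these
  differences have representatives \<open>h k\<close> of norm below \<open>(1 / 2) ^ k\<close>. The
  partial sums of \<open>h\<close> converge in the norm of \<open>BV \<beta>\<close> and differ from
  the subsequence only by null functions.\<close>

lemma p_complete:
  assumes F: "\<And>n. F n \<in> BV \<beta>" and Cauchy: "\<forall>e>0. \<exists>N. \<forall>m\<ge>N. \<forall>n\<ge>N. p (F m - F n) < e"
  shows "\<exists>f\<in>BV \<beta>. (\<lambda>n. p (F n - f)) \<longlonglongrightarrow> 0"
proof -
  have "\<forall>k. \<exists>N. \<forall>m\<ge>N. \<forall>n\<ge>N. p (F m - F n) < (1 / 2) ^ k"
    using Cauchy by simp
  then obtain N where N: "\<And>k m n. m \<ge> N k \<Longrightarrow> n \<ge> N k \<Longrightarrow> p (F m - F n) < (1 / 2) ^ k" by metis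
  \<comment> \<open>Partial sums of \<open>N\<close> make the indices nondecreasing while dominating
    each \<open>N k\<close>.\<close>
  define r where "r k = (\<Sum>j\<le>k. N j)" for k
  have rN: "N k \<le> r k" "N k \<le> r (Suc k)" for k
  proof -
    have "N k \<le> (\<Sum>j\<le>k. N j)" by (rule member_le_sum) auto
    then show "N k \<le> r k" "N k \<le> r (Suc k)" unfolding r_def by auto
  qed
  have "\<forall>k. \<exists>h\<in>BV \<beta>. (F (r (Suc k)) - F (r k)) - h \<in> BV_null \<beta> \<and> nrm h < (1 / 2) ^ k"
    using N rN by (intro allI p_less BV_diff F) auto
  then obtain h where h: "\<And>k. h k \<in> BV \<beta>" "\<And>k. (F (r (Suc k)) - F (r k)) - h k \<in> BV_null \<beta>"
      "\<And>k. nrm (h k) < (1 / 2) ^ k" by metis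
  define G where "G k = F (r 0) + sum h {..<k}" for k
  have G: "G k \<in> BV \<beta>" for k unfolding G_def using BV_sum[of "{..<k}" h] h by (intro BV_add F) auto
  have FG: "F (r k) - G k \<in> BV_null \<beta>" for k
  proof (induction k)
    case 0
    have "F (r 0) - G 0 = 0" by (simp add: G_def fun_eq_iff)
    then show ?case using null_zero by (simp only:)
  next
    case (Suc k)
    have "F (r (Suc k)) - G (Suc k) = (F (r k) - G k) + ((F (r (Suc k)) - F (r k)) - h k)"
      by (simp add: G_def)
    then show ?case using null_add[OF Suc h(2)[of k]] by (simp only:)
  qed
  \<comment> \<open>The right side is the sum of \<open>(1 / 2) ^ j\<close> over
    \<open>n \<le> j < n + k\<close>.\<close>
  have GG: "nrm (G (n + k) - G n) \<le> 2 * (1 / 2) ^ n - 2 * (1 / 2) ^ (n + k)" for n k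
  proof (induction k)
    case 0
    have "G (n + 0) - G n = 0" by (simp add: fun_eq_iff)
    then show ?case by (simp only: BV_zero(2)) simp
  next
    case (Suc k)
    have "G (n + Suc k) - G n = (G (n + k) - G n) + h (n + k)" by (simp add: G_def)
    then have "nrm (G (n + Suc k) - G n) \<le> nrm (G (n + k) - G n) + nrm (h (n + k))"
      using BV_add(2)[OF BV_diff(1)[OF G G] h(1)] by (simp only:)
    moreover have "(1 / 2 :: real) ^ (n + Suc k) = (1 / 2) ^ (n + k) / 2" by simp
    ultimately show ?case using Suc h(3)[of "n + k"] by linarith
  qed
  have GG': "nrm (G m - G n) \<le> 2 * (1 / 2) ^ k" if "m \<ge> n" "n \<ge> k" for m n k
  proof -
    have "nrm (G m - G n) \<le> 2 * (1 / 2) ^ n"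
      using GG[of n "m - n"] that by (auto intro: order_trans)
    also have "\<dots> \<le> 2 * (1 / 2) ^ k" using that by (intro mult_left_mono power_decreasing) auto
    finally show ?thesis .
  qed
  have pow: "\<exists>k. 2 * (1 / 2) ^ k < e" if "e > 0" for e :: real
    using real_arch_pow_inv[of "e / 2" "1 / 2"] that by (auto simp: field_simps)
  have "\<exists>N. \<forall>m\<ge>N. \<forall>n\<ge>N. nrm (G m - G n) < e" if "e > 0" for e
  proof -
    obtain k where k: "2 * (1 / 2) ^ k < e" using pow \<open>e > 0\<close> by blast
    have "nrm (G m - G n) < e" if "m \<ge> k" "n \<ge> k" for m n
    proof (cases "n \<le> m")
      case True
      then show ?thesis using GG'[of n m k] that k by linarith
    next
      case False
      have "nrm (G m - G n) \<le> nrm (G n - G m)" using BV_minus(2)[OF BV_diff(1)[OF G G], of n m] by simp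
      then show ?thesis using GG'[of m n k] that k False by linarith
    qed
    then show ?thesis by blast
  qed
  from BV_complete[OF G this] obtain f where f: "f \<in> BV \<beta>" "(\<lambda>n. nrm (G n - f)) \<longlonglongrightarrow> 0" by blast
  have "(\<lambda>n. p (F n - f)) \<longlonglongrightarrow> 0"
  proof (rule LIMSEQ_I)
    fix e :: real assume e: "e > 0"
    obtain M where M: "\<And>m n. m \<ge> M \<Longrightarrow> n \<ge> M \<Longrightarrow> p (F m - F n) < e / 2"
      using Cauchy e by (metis half_gt_zero)
    have "\<forall>\<^sub>F k in sequentially. nrm (G k - f) < e / 2" by (rule order_tendstoD(2)[OF f(2)]) (use e in simp)
    moreover have "\<forall>\<^sub>F k in sequentially. (1 / 2) ^ k < e / 2"
      by (rule order_tendstoD(2)[OF LIMSEQ_power_zero]) (use e in auto)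
    ultimately have "\<forall>\<^sub>F k in sequentially. nrm (G k - f) < e / 2 \<and> (1 / 2) ^ k < e / 2"
      by eventually_elim auto
    then obtain k where k: "nrm (G k - f) < e / 2" "(1 / 2) ^ k < e / 2"
      by (auto simp: eventually_sequentially)
    have "norm (p (F n - f) - 0) < e" if n: "n \<ge> r k" for n
    proof -
      have "p (F n - f) \<le> p (F n - F (r k)) + p (F (r k) - f)"
        using p_add[OF BV_diff(1)[OF F F] BV_diff(1)[OF F f(1)], of n "r k" "r k"] by simp
      moreover have "p (F n - F (r k)) < (1 / 2) ^ k" using N rN(1)[of k] n by auto
      moreover have "p (F (r k) - f) = p (G k - f)" using FG[of k] by (intro p_cong BV_diff F G f) simp
      moreover have "p (G k - f) \<le> nrm (G k - f)" by (intro p_le_nrm BV_diff G f)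
      ultimately show ?thesis using k p_nonneg[OF BV_diff(1)[OF F f(1)], of n] by simp
    qed
    then show "\<exists>N. \<forall>n\<ge>N. norm (p (F n - f) - 0) < e" by blast
  qed
  then show ?thesis using f by blast
qed

end

section \<open>The closure of the step functions and the transfer operator\<close>

text \<open>Pointwise scaling is given a name so that \<open>vector_space\<close> and its
  \<open>span\<close> can be instantiated for functions.\<close>

definition cscale :: "complex \<Rightarrow> ('a \<Rightarrow> complex) \<Rightarrow> 'a \<Rightarrow> complex" where
  "cscale c f = (\<lambda>x. c * f x)"

interpretation fun_space: vector_space "cscale :: complex \<Rightarrow> (bseq \<Rightarrow> complex) \<Rightarrow> _"
  by standard (simp_all add: cscale_def fun_eq_iff algebra_simps)

context beta_shift_space
begin

section \<open>Step functions and their closure\<close>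

lemma BV_cscale: "f \<in> BV \<beta> \<Longrightarrow> cscale c f \<in> BV \<beta>" "f \<in> BV \<beta> \<Longrightarrow> nrm (cscale c f) \<le> cmod c * nrm f"
  using BV_scale[of f c] by (simp_all only: cscale_def)

lemma null_cscale: "f \<in> BV_null \<beta> \<Longrightarrow> cscale c f \<in> BV_null \<beta>"
  using null_scale[of f c] by (simp only: cscale_def)

lemma p_cscale: "f \<in> BV \<beta> \<Longrightarrow> p (cscale c f) = cmod c * p f"
  using p_scale[of f c] by (simp only: cscale_def)

text \<open>Including membership in \<open>BV \<beta>\<close> saves computing the variation of an
  indicator: an interval whose indicator violated it would have an empty class and contribute
  nothing to the span.\<close>

definition interval_indicators :: "(bseq \<Rightarrow> complex) set" where
  "interval_indicators = {indicator I | I. I \<in> beta_intervals \<beta> \<and> (indicator I :: bseq \<Rightarrow> complex) \<in> BV \<beta>}"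

definition step_funs :: "(bseq \<Rightarrow> complex) set" where
  "step_funs = fun_space.span interval_indicators"

abbreviation indicator_classes :: "bclass set" where
  "indicator_classes \<equiv> (\<lambda>I. cls \<beta> (indicator I)) ` beta_intervals \<beta>"

lemma step_BV: "s \<in> step_funs \<Longrightarrow> s \<in> BV \<beta>"
  unfolding step_funs_def
proof (induction rule: fun_space.span_induct_alt)
  case base
  show ?case by (rule BV_zero)
next
  case (step c x y)
  then show ?case by (intro BV_add BV_cscale) (auto simp: interval_indicators_def)
qed

lemma step_qspan: "s \<in> step_funs \<Longrightarrow> cls \<beta> s \<in> qspan \<beta> indicator_classes"
proof -
  assume "s \<in> step_funs"
  then have "\<exists>m c f. (\<forall>i<m. \<exists>A\<in>indicator_classes. f i \<in> A) \<and> s = (\<lambda>x. \<Sum>i<m::nat. c i * f i x)"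
    unfolding step_funs_def
  proof (induction rule: fun_space.span_induct_alt)
    case base
    show ?case by (intro exI[of _ 0]) auto
  next
    case (step a g y)
    then obtain m c f where *: "\<forall>i<m. \<exists>A\<in>indicator_classes. f i \<in> A" "y = (\<lambda>x. \<Sum>i<m::nat. c i * f i x)"
      by blast
    have g: "\<exists>A\<in>indicator_classes. g \<in> A"
      using step(1) cls_self by (auto simp: interval_indicators_def)
    show ?case
    proof (intro exI[of _ "Suc m"] exI[of _ "c(m := a)"] exI[of _ "f(m := g)"] conjI allI impI)
      fix i assume "i < Suc m"
      then show "\<exists>A\<in>indicator_classes. (f(m := g)) i \<in> A" using * g by (cases "i = m") auto
    next
      show "cscale a g + y = (\<lambda>x. \<Sum>i<Suc m. (c(m := a)) i * (f(m := g)) i x)"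
        by (auto simp: *(2) cscale_def fun_eq_iff intro!: sum.cong)
    qed
  qed
  then show ?thesis unfolding qspan_def by blast
qed

text \<open>An element of the span may use arbitrary representatives of the indicator classes;
  replacing them by the indicators changes the sum by a null function.\<close>

lemma qspan_step:
  assumes "G \<in> qspan \<beta> indicator_classes" obtains s where "s \<in> step_funs" "G = cls \<beta> s"
proof -
  obtain m c f where G: "G = cls \<beta> (\<lambda>x. \<Sum>i<m::nat. c i * f i x)"
    and f: "\<forall>i<m. \<exists>I\<in>beta_intervals \<beta>. f i \<in> cls \<beta> (indicator I)"
    using assms unfolding qspan_def by auto
  obtain I where I: "\<And>i. i < m \<Longrightarrow> I i \<in> beta_intervals \<beta> \<and> f i \<in> cls \<beta> (indicator (I i))"
    using f by metis
  define s where "s = (\<Sum>i<m. cscale (c i) (indicator (I i)))"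
  define g where "g = (\<Sum>i<m. cscale (c i) (f i))"
  have ind: "indicator (I i) \<in> BV \<beta>" "f i \<in> BV \<beta>" "indicator (I i) - f i \<in> BV_null \<beta>" if "i < m" for i
    using I[OF that] by (auto simp: in_cls)
  have step: "s \<in> step_funs" unfolding s_def step_funs_def
    using I ind by (intro fun_space.span_sum fun_space.span_scale fun_space.span_base)
      (auto simp: interval_indicators_def)
  have gBV: "g \<in> BV \<beta>" unfolding g_def 
    using BV_sum[of "{..<m}" "\<lambda>i. cscale (c i) (f i)"] BV_cscale(1)[OF ind(2)] by simp
  have "s - g = (\<Sum>i<m. cscale (c i) (indicator (I i) - f i))"
    unfolding s_def g_def sum_subtractf[symmetric] by (simp add: fun_space.scale_right_diff_distrib)
  also have "\<dots> \<in> BV_null \<beta>" using ind by (intro null_sum null_cscale) auto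
  finally have "cls \<beta> s = cls \<beta> g" using cls_eq_iff[OF step_BV[OF step] gBV] by blast
  moreover have "g = (\<lambda>x. \<Sum>i<m. c i * f i x)"
  proof -
    have "(\<Sum>i\<in>A. cscale (c i) (f i)) = (\<lambda>x. \<Sum>i\<in>A. c i * f i x)" for A
      by (induction A rule: infinite_finite_induct) (auto simp: cscale_def fun_eq_iff)
    then show ?thesis by (simp add: g_def)
  qed
  ultimately show thesis using that[OF step] G by simp
qed

text \<open>The functions whose class lies in \<open>F_space \<beta>\<close>, see \<open>cls_in_F\<close> below.  All estimates are
  carried out for functions with the seminorm \<open>p\<close>, and only the final statements about the
  spectrum are translated to classes.\<close>

definition M :: "(bseq \<Rightarrow> complex) set" where
  "M = {f \<in> BV \<beta>. \<forall>e>0. \<exists>s\<in>step_funs. p (f - s) < e}"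

lemma M_BV: "f \<in> M \<Longrightarrow> f \<in> BV \<beta>"
  by (simp add: M_def)

lemma cls_in_F: "cls \<beta> f \<in> F_space \<beta> \<longleftrightarrow> f \<in> M"
proof
  assume f: "cls \<beta> f \<in> F_space \<beta>"
  then have fBV: "f \<in> BV \<beta>" by (auto simp: F_space_def cls_in_quot)
  have "\<exists>s\<in>step_funs. p (f - s) < e" if e: "e > 0" for e
  proof -
    obtain G where G: "G \<in> qspan \<beta> indicator_classes" "qnorm \<beta> (qdiff \<beta> (cls \<beta> f) G) < e"
      using f e unfolding F_space_def by blast
    obtain s where "s \<in> step_funs" "G = cls \<beta> s" using qspan_step[OF G(1)] .
    then show ?thesis using G(2) qdiff_cls[OF fBV step_BV] by (auto simp: p_def)
  qed
  then show "f \<in> M" using fBV by (simp add: M_def)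
next
  assume f: "f \<in> M"
  have "\<exists>G\<in>qspan \<beta> indicator_classes. qnorm \<beta> (qdiff \<beta> (cls \<beta> f) G) < e" if e: "e > 0" for e
  proof -
    obtain s where s: "s \<in> step_funs" "p (f - s) < e" using f e unfolding M_def by blast
    then show ?thesis using step_qspan[OF s(1)] qdiff_cls[OF M_BV[OF f] step_BV[OF s(1)]]
      by (intro bexI[of _ "cls \<beta> s"]) (auto simp: p_def)
  qed
  then show "cls \<beta> f \<in> F_space \<beta>" using M_BV[OF f] by (auto simp: F_space_def cls_in_quot)
qed

lemma F_cases: assumes "A \<in> F_space \<beta>" obtains f where "f \<in> M" "A = cls \<beta> f"
proof -
  have "A \<in> quot_space \<beta>" using assms by (simp add: F_space_def)
  then obtain f where "f \<in> BV \<beta>" "A = cls \<beta> f" by (rule quot_cases)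
  then show thesis using that assms cls_in_F by blast
qed

lemma step_add: "s \<in> step_funs \<Longrightarrow> t \<in> step_funs \<Longrightarrow> s + t \<in> step_funs"
  and step_scale: "s \<in> step_funs \<Longrightarrow> cscale c s \<in> step_funs"
  and step_zero: "0 \<in> step_funs"
  unfolding step_funs_def
  by (auto intro: fun_space.span_add fun_space.span_scale fun_space.span_zero)

lemma step_M: "s \<in> step_funs \<Longrightarrow> s \<in> M"
proof -
  assume s: "s \<in> step_funs"
  have "p (s - s) = 0" using p_eq_0_iff[OF BV_zero(1)] null_zero by simp
  then show ?thesis unfolding M_def using s step_BV by (auto intro!: bexI[OF _ s])
qed

lemma M_approx: "f \<in> M \<Longrightarrow> e > 0 \<Longrightarrow> \<exists>s\<in>step_funs. p (f - s) < e"
  by (simp add: M_def)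

lemma M_closed:
  assumes f: "f \<in> BV \<beta>" and "\<And>e. e > 0 \<Longrightarrow> \<exists>g\<in>M. p (f - g) < e" shows "f \<in> M"
proof -
  have "\<exists>s\<in>step_funs. p (f - s) < e" if e: "e > 0" for e
  proof -
    obtain g where g: "g \<in> M" "p (f - g) < e / 2" using assms(2)[of "e / 2"] e by auto
    obtain s where s: "s \<in> step_funs" "p (g - s) < e / 2"
      using M_approx[OF g(1), of "e / 2"] e by auto
    have "f - s = (f - g) + (g - s)" by simp
    then have "p (f - s) \<le> p (f - g) + p (g - s)"
      using p_add[OF BV_diff(1)[OF f M_BV[OF g(1)]] BV_diff(1)[OF M_BV[OF g(1)] step_BV[OF s(1)]]] by (simp only:)
    then show ?thesis using g s by (intro bexI[OF _ s(1)]) linarith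
  qed
  then show ?thesis using f by (simp add: M_def)
qed

lemma M_add: assumes "f \<in> M" "g \<in> M" shows "f + g \<in> M"
proof (rule M_closed)
  show "f + g \<in> BV \<beta>" using assms by (intro BV_add M_BV)
  fix e :: real assume e: "e > 0"
  obtain s where s: "s \<in> step_funs" "p (f - s) < e / 2" using M_approx[OF assms(1), of "e / 2"] e by auto
  obtain t where t: "t \<in> step_funs" "p (g - t) < e / 2" using M_approx[OF assms(2), of "e / 2"] e by auto
  have "f + g - (s + t) = (f - s) + (g - t)" by simp
  then have "p (f + g - (s + t)) \<le> p (f - s) + p (g - t)"
    using p_add[OF BV_diff(1)[OF M_BV[OF assms(1)] step_BV[OF s(1)]] BV_diff(1)[OF M_BV[OF assms(2)] step_BV[OF t(1)]]]
    by (simp only:)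
  then show "\<exists>h\<in>M. p (f + g - h) < e" using s t by (intro bexI[OF _ step_M[OF step_add[OF s(1) t(1)]]]) linarith
qed

text \<open>A near-optimal representative \<open>h\<close> of \<open>f\<close> is mapped to a
  representative of \<open>Q f\<close>, because \<open>Q\<close> preserves null functions.\<close>

lemma bounded_op_p:
  assumes "\<And>f g. Q (f - g) = Q f - Q g"
    and "\<And>f. f \<in> BV \<beta> \<Longrightarrow> Q f \<in> BV \<beta> \<and> nrm (Q f) \<le> K * nrm f" "0 \<le> K"
    and "\<And>f. f \<in> BV_null \<beta> \<Longrightarrow> Q f \<in> BV_null \<beta>" and f: "f \<in> BV \<beta>"
  shows "p (Q f) \<le> K * p f"
proof -
  have *: "p (Q f) \<le> K * (p f + e)" if e: "e > 0" for e
  proof -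
    obtain h where h: "h \<in> BV \<beta>" "f - h \<in> BV_null \<beta>" "nrm h < p f + e"
      using p_less[OF f, of "p f + e"] e by auto
    have "Q f - Q h \<in> BV_null \<beta>" using assms(4)[OF h(2)] assms(1) by simp
    then have "p (Q f) \<le> nrm (Q h)" using assms(2) f h by (intro p_le) auto
    also have "\<dots> \<le> K * nrm h" using assms(2) h by blast
    also have "\<dots> \<le> K * (p f + e)" using h assms(3) by (intro mult_left_mono) auto
    finally show ?thesis .
  qed
  have "((\<lambda>e. K * (p f + e)) \<longlongrightarrow> K * (p f + 0)) (at_right 0)"
    by (intro tendsto_intros)
  then have "p (Q f) \<le> K * (p f + 0)"
    by (rule tendsto_lowerbound) (auto intro!: * eventually_at_rightI[of 0 1])
  then show ?thesis by simp
qed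

text \<open>By linearity \<open>Q\<close> maps step functions into \<open>M\<close>, and boundedness
  carries approximations by step functions over to \<open>Q f\<close>. In the applications only the
  generators have to be examined.\<close>

lemma bounded_op_M:
  assumes add: "\<And>f g. Q (f + g) = Q f + Q g" and scale: "\<And>c f. Q (cscale c f) = cscale c (Q f)"
    and BV: "\<And>f. f \<in> BV \<beta> \<Longrightarrow> Q f \<in> BV \<beta>" and bound: "\<And>f. f \<in> BV \<beta> \<Longrightarrow> p (Q f) \<le> K * p f"
    and ind: "\<And>f. f \<in> interval_indicators \<Longrightarrow> Q f \<in> M" and f: "f \<in> M"
  shows "Q f \<in> M"
proof -
  have "Q 0 + Q 0 = Q 0 + 0" using add[of 0 0] by (simp only: add_0_right)
  then have zero: "Q 0 = 0" by (simp only: add_left_cancel)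
  \<comment> \<open>\<open>M_scale\<close> is derived from this lemma, so closure under scaling is
    proved here directly.\<close>
  have Mscale: "cscale c g \<in> M" if g: "g \<in> M" for c g
  proof (rule M_closed)
    show "cscale c g \<in> BV \<beta>" using g by (intro BV_cscale M_BV)
    fix e :: real assume e: "e > 0"
    then have "e / (cmod c + 1) > 0" by (simp add: add_nonneg_pos)
    then obtain s where s: "s \<in> step_funs" "p (g - s) < e / (cmod c + 1)" using M_approx[OF g] by blast
    have "p (cscale c g - cscale c s) = cmod c * p (g - s)"
      using p_cscale[OF BV_diff(1)[OF M_BV[OF g] step_BV[OF s(1)]], of c]
      by (simp add: fun_space.scale_right_diff_distrib)
    also have "\<dots> \<le> cmod c * (e / (cmod c + 1))" using s by (intro mult_left_mono) auto
    also have "\<dots> < e" using e add_nonneg_pos[OF norm_ge_zero[of c] zero_less_one] by (simp add: field_simps)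
    finally show "\<exists>h\<in>M. p (cscale c g - h) < e" using step_M[OF step_scale[OF s(1)]] by blast
  qed
  have step: "Q s \<in> M" if "s \<in> step_funs" for s
    using that unfolding step_funs_def
  proof (induction rule: fun_space.span_induct_alt)
    case base
    show ?case unfolding zero by (rule step_M[OF step_zero])
  next
    case (step c x y)
    show ?case unfolding add scale by (rule M_add[OF Mscale[OF ind[OF step(1)]] step(2)])
  qed
  show ?thesis
  proof (rule M_closed)
    show "Q f \<in> BV \<beta>" using BV M_BV[OF f] .
    fix e :: real assume e: "e > 0"
    then have "e / (\<bar>K\<bar> + 1) > 0" by (simp add: add_nonneg_pos)
    then obtain s where s: "s \<in> step_funs" "p (f - s) < e / (\<bar>K\<bar> + 1)" using M_approx[OF f] by blast
    have BVd: "f - s \<in> BV \<beta>" by (intro BV_diff M_BV f step_BV s)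
    have "Q f = Q (f - s) + Q s" unfolding add[symmetric] by simp
    then have "Q f - Q s = Q (f - s)" by simp
    then have "p (Q f - Q s) \<le> K * p (f - s)" using bound[OF BVd] by simp
    also have "\<dots> \<le> \<bar>K\<bar> * p (f - s)" using p_nonneg[OF BVd] by (intro mult_right_mono) auto
    also have "\<dots> \<le> \<bar>K\<bar> * (e / (\<bar>K\<bar> + 1))" using s by (intro mult_left_mono) auto
    also have "\<dots> < e" using e by (simp add: field_simps add_nonneg_pos)
    finally show "\<exists>h\<in>M. p (Q f - h) < e" using step[OF s(1)] by blast
  qed
qed

section \<open>The closure as an algebra stable under exponentials\<close>

lemma M_scale: assumes "f \<in> M" shows "cscale c f \<in> M"
proof (rule bounded_op_M[where Q = "cscale c" and K = "cmod c"])
  show "cscale c g \<in> M" if "g \<in> interval_indicators" for g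
    using that by (intro step_M step_scale) (auto simp: step_funs_def intro: fun_space.span_base)
  show "cscale c (cscale d f) = cscale d (cscale c f)" for d and f :: "bseq \<Rightarrow> complex"
    by (rule fun_space.scale_left_commute)
  show "cscale c (f + g) = cscale c f + cscale c g" for f g :: "bseq \<Rightarrow> complex"
    by (rule fun_space.scale_right_distrib)
  show "p (cscale c f) \<le> cmod c * p f" if "f \<in> BV \<beta>" for f
    unfolding p_cscale[OF that] ..
qed (rule BV_cscale(1) assms; assumption?)+

lemma M_diff: "f \<in> M \<Longrightarrow> g \<in> M \<Longrightarrow> f - g \<in> M"
  using M_add[of f "cscale (- 1) g"] M_scale[of g "- 1"] by (simp add: cscale_def fun_diff_def plus_fun_def)

lemma M_null: assumes "f \<in> BV_null \<beta>" shows "f \<in> M"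
proof (rule M_closed)
  show "f \<in> BV \<beta>" using assms by (rule null_BV)
  then have "p (f - 0) = 0" using assms by (simp add: p_eq_0_iff)
  then show "\<exists>g\<in>M. p (f - g) < e" if "e > 0" for e
    using that step_M[OF step_zero] by (intro bexI[of _ 0]) auto
qed

lemma M_one: "(\<lambda>_. 1) \<in> M"
proof -
  have "(\<lambda>_. 1) - indicator X \<in> BV_null \<beta>" "(indicator X :: bseq \<Rightarrow> complex) \<in> BV \<beta>"
    using BV_cong[OF BV_const(1)[of 1], of "indicator X"] by auto
  moreover have "X \<in> beta_intervals \<beta>" by (auto simp: beta_intervals_def)
  ultimately have "indicator X \<in> step_funs" "(\<lambda>_. 1) - indicator X \<in> M"
    by (auto simp: step_funs_def interval_indicators_def intro!: fun_space.span_base M_null)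
  from M_add[OF this(2) step_M[OF this(1)]] show ?thesis by simp
qed

lemma indicator_mult:
  assumes "f \<in> interval_indicators" "g \<in> interval_indicators" shows "f * g \<in> interval_indicators"
proof -
  obtain I J where IJ: "f = indicator I" "g = indicator J" "I \<in> beta_intervals \<beta>" "J \<in> beta_intervals \<beta>"
      "f \<in> BV \<beta>" "g \<in> BV \<beta>"
    using assms by (auto simp: interval_indicators_def)
  have "f * g = indicator (I \<inter> J)" unfolding IJ by (auto simp: indicator_def fun_eq_iff)
  moreover have "I \<inter> J \<in> beta_intervals \<beta>" using IJ(3,4) unfolding beta_intervals_def by blast
  ultimately show ?thesis using BV_mult(1)[OF IJ(5,6)] by (auto simp: interval_indicators_def)
qed

text \<open>\<open>bounded_op_M\<close> is used twice: for multiplication by an indicator, where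
  products of generators are again generators, and then for multiplication by
  \<open>f\<close>.\<close>

lemma M_mult: assumes "f \<in> M" "g \<in> M" shows "f * g \<in> M"
proof -
  have mult_op: "h * k \<in> M" if h: "h \<in> M" and base: "\<And>i. i \<in> interval_indicators \<Longrightarrow> h * i \<in> M"
    and k: "k \<in> M" for h k
  proof (rule bounded_op_M[where Q = "\<lambda>k. h * k" and K = "p h"])
    show "\<And>f. f \<in> BV \<beta> \<Longrightarrow> h * f \<in> BV \<beta>" using M_BV[OF h] by (intro BV_mult)
    show "\<And>f. f \<in> BV \<beta> \<Longrightarrow> p (h * f) \<le> p h * p f" using M_BV[OF h] by (intro p_mult)
    show "h * (f + g) = h * f + h * g" for f g by (rule distrib_left)
    show "h * cscale c f = cscale c (h * f)" for c f by (auto simp: cscale_def fun_eq_iff)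
  qed (fact base k)+
  have "i * f \<in> M" if i: "i \<in> interval_indicators" for i
  proof (rule mult_op)
    show "i \<in> M" using i by (intro step_M) (auto simp: step_funs_def intro: fun_space.span_base)
    show "i * j \<in> M" if "j \<in> interval_indicators" for j
      using indicator_mult[OF i that] by (intro step_M) (auto simp: step_funs_def intro: fun_space.span_base)
  qed (rule assms(1))
  then have "f * i \<in> M" if "i \<in> interval_indicators" for i
    using that by (simp only: mult.commute[of f i])
  then show ?thesis by (rule mult_op[OF assms(1) _ assms(2)])
qed

text \<open>Since \<open>nrm\<close> is submultiplicative, the exponential series converges in norm,
  and its partial sums lie in \<open>M\<close>. The limit has to be the pointwise exponential, so
  the error is estimated by \<open>BV_limit\<close> and not through completeness.\<close>

lemma M_exp: assumes f: "f \<in> M" shows "(\<lambda>x. exp (f x)) \<in> M"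
proof -
  define t where "t k = (\<lambda>x. f x ^ k / fact k)" for k
  define s where "s n = sum t {..<n}" for n
  define a where "a k = nrm f ^ k / fact k" for k
  have fB: "f \<in> BV \<beta>" using f by (rule M_BV)
  have n0: "0 \<le> nrm f" by (rule nrm_nonneg[OF fB])
  have t: "t k \<in> M \<and> nrm (t k) \<le> a k" for k
  proof (induction k)
    case 0
    have "t 0 = (\<lambda>_. 1)" by (simp add: t_def)
    then show ?case using M_one BV_const(2)[of 1] by (simp add: a_def)
  next
    case (Suc k)
    have eq: "t (Suc k) = cscale (1 / of_nat (Suc k)) (f * t k)"
      by (auto simp: t_def cscale_def fun_eq_iff field_simps)
    have tB: "t k \<in> BV \<beta>" by (rule M_BV[OF conjunct1[OF Suc]])
    have "nrm (t (Suc k)) \<le> cmod (1 / of_nat (Suc k)) * nrm (f * t k)"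
      unfolding eq by (intro BV_cscale BV_mult fB tB)
    also have "\<dots> \<le> cmod (1 / of_nat (Suc k)) * (nrm f * a k)"
      using Suc BV_mult(2)[OF fB tB] n0 by (intro mult_left_mono order_trans[OF BV_mult(2)[OF fB tB]]) auto
    also have "\<dots> = a (Suc k)" by (simp add: a_def norm_divide field_simps del: of_nat_Suc)
    finally show ?case unfolding eq using Suc f by (auto intro: M_scale M_mult)
  qed
  have tB: "t k \<in> BV \<beta>" for k by (rule M_BV[OF conjunct1[OF t]])
  have sB: "s n \<in> BV \<beta>" for n using BV_sum[of "{..<n}" t] tB by (simp add: s_def)
  have sM: "s n \<in> M" for n
  proof (induction n)
    case 0
    have "s 0 = 0" by (simp add: s_def fun_eq_iff)
    then show ?case using step_M[OF step_zero] by (simp only:)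
  next
    case (Suc n)
    have "s (Suc n) = s n + t n" by (simp add: s_def)
    then show ?case using M_add[OF Suc conjunct1[OF t]] by (simp only:)
  qed
  have a_sums: "a sums exp (nrm f)"
    using exp_converges[of "nrm f"] by (simp add: a_def[abs_def] scaleR_conv_of_real divide_inverse mult.commute)
  have a0: "0 \<le> a k" for k using n0 by (simp add: a_def)
  \<comment> \<open>The tail of the scalar exponential series of \<open>nrm f\<close> dominates the
    tail of the function series.\<close>
  define eps where "eps n = exp (nrm f) - sum a {..<n}" for n
  have eps: "eps \<longlonglongrightarrow> 0"
    using tendsto_diff[OF tendsto_const, of "\<lambda>n. sum a {..<n}" "exp (nrm f)" sequentially "exp (nrm f)"] a_sums
    by (simp add: eps_def[abs_def] sums_def)
  have diff: "nrm (s m - s n) \<le> eps n" if "n \<le> m" for m n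
  proof -
    have split: "{..<m} = {..<n} \<union> {n..<m}" using that by auto
    have "s m = s n + sum t {n..<m}" unfolding s_def split by (rule sum.union_disjoint) auto
    then have "s m - s n = sum t {n..<m}" by simp
    then have "nrm (s m - s n) \<le> (\<Sum>k=n..<m. nrm (t k))" using BV_sum[of "{n..<m}" t] tB by simp
    also have "\<dots> \<le> sum a {n..<m}" using t by (intro sum_mono) blast
    also have "\<dots> = sum a {..<m} - sum a {..<n}" unfolding split by (subst sum.union_disjoint) auto
    also have "sum a {..<m} \<le> exp (nrm f)"
      using sum_le_suminf[OF sums_summable[OF a_sums], of "{..<m}"] a0 a_sums by (simp add: sums_iff)
    finally show ?thesis by (simp add: eps_def)
  qed
  have s_app: "s n x = (\<Sum>k<n. f x ^ k / fact k)" for n x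
    unfolding s_def by (induction n) (auto simp: t_def)
  have lim: "(\<lambda>m. s m x) \<longlonglongrightarrow> exp (f x)" for x
    using exp_converges[of "f x"]
    by (simp add: sums_def s_app scaleR_conv_of_real divide_inverse mult.commute)
  have d: "(\<lambda>x. exp (f x)) - s n \<in> BV \<beta> \<and> nrm ((\<lambda>x. exp (f x)) - s n) \<le> eps n" for n
  proof -
    have "\<forall>\<^sub>F m in sequentially. nrm (s m - s n) \<le> eps n"
      using diff by (auto simp: eventually_sequentially)
    moreover have "(\<lambda>m. (s m - s n) x) \<longlonglongrightarrow> ((\<lambda>x. exp (f x)) - s n) x" for x
      using tendsto_diff[OF lim tendsto_const, of x "s n x"] by simp
    ultimately show ?thesis
      using BV_limit[where F = "\<lambda>m. s m - s n" and f = "(\<lambda>x. exp (f x)) - s n", OF BV_diff(1)[OF sB sB]]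
      by blast
  qed
  show ?thesis
  proof (rule M_closed)
    have "(\<lambda>x. exp (f x)) = ((\<lambda>x. exp (f x)) - s 0) + s 0" by (simp add: fun_eq_iff)
    also have "\<dots> \<in> BV \<beta>" using d[of 0] by (intro BV_add sB) blast
    finally show "(\<lambda>x. exp (f x)) \<in> BV \<beta>" .
    fix e :: real assume "e > 0"
    then have "\<forall>\<^sub>F n in sequentially. eps n < e" by (rule order_tendstoD(2)[OF eps])
    then obtain n where "eps n < e" by (auto simp: eventually_sequentially)
    then have "p ((\<lambda>x. exp (f x)) - s n) < e" using d[of n] p_le_nrm by (meson order_le_less_trans)
    then show "\<exists>g\<in>M. p ((\<lambda>x. exp (f x)) - g) < e" using sM by blast
  qed
qed

section \<open>Composition with an inverse branch\<close>

definition branch :: "int \<Rightarrow> (bseq \<Rightarrow> complex) \<Rightarrow> bseq \<Rightarrow> complex" where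
  "branch b h x = (if pre b x \<in> X then h (pre b x) else 0)"

text \<open>The branch preserves the order and is defined on an initial segment, so the variation
  grows by at most one jump, of size at most the sup norm, where the domain ends. This jump is the
  reason for the factor 2.\<close>

lemma branch_BV: assumes "h \<in> BV \<beta>" shows "branch b h \<in> BV \<beta>" "nrm (branch b h) \<le> 2 * nrm h"
proof -
  have *: "cmod (branch b h x) + vsum (branch b h) xs \<le> 2 * nrm h" if "x \<in> X" "xs \<in> chains X" for x xs
  proof -
    define S where "S = sup_norm \<beta> h"
    define D where "D = {x. pre b x \<in> X}"
    have S: "cmod (h y) \<le> S" if "y \<in> X" for y unfolding S_def by (rule cmod_le_sup_norm[OF assms that])
    have S0: "0 \<le> S" using S[OF zero_seq_in] norm_ge_zero order_trans by blast
    have "vsum (branch b h) xs = vsum (\<lambda>x. if x \<in> D then h (pre b x) else 0) xs"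
      by (simp add: branch_def[abs_def] D_def)
    also have "\<dots> \<le> vsum (\<lambda>x. h (pre b x)) (filter (\<lambda>x. x \<in> D) xs) + S"
    proof (rule vsum_cutoff)
      show "x \<in> D" if "x \<in> set xs" "y \<in> D" "less_fun x y" for x y
        using that \<open>xs \<in> chains X\<close> cat_down[of x y "[b]"] by (auto simp: D_def chains_def)
    qed (use that S S0 in \<open>auto simp: chains_def D_def\<close>)
    also have "vsum (\<lambda>x. h (pre b x)) (filter (\<lambda>x. x \<in> D) xs) = vsum h (map (pre b) (filter (\<lambda>x. x \<in> D) xs))"
      by (simp add: vsum_map)
    also have "\<dots> \<le> tv X h"
      using that(2) by (intro vsum_le_tv assms)
        (auto simp: chains_def D_def sorted_wrt_map less_fun_pre sorted_wrt_filter)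
    finally have "vsum (branch b h) xs \<le> tv X h + S" by simp
    moreover have "cmod (branch b h x) \<le> S" using S S0 by (simp add: branch_def)
    moreover have "0 \<le> tv X h" by (rule tv_nonneg[OF assms]) simp
    ultimately show ?thesis by (simp add: nrm_eq[OF assms] S_def)
  qed
  show "branch b h \<in> BV \<beta>" "nrm (branch b h) \<le> 2 * nrm h"
    by (rule BV_leI[of "branch b h", OF *]; assumption)+
qed

text \<open>The points where \<open>branch b h\<close> does not vanish are images under the shift of
  points where \<open>h\<close> does not vanish.\<close>

lemma branch_null: assumes "h \<in> BV_null \<beta>" shows "branch b h \<in> BV_null \<beta>"
proof -
  have "{x \<in> X. branch b h x \<noteq> 0} \<subseteq> shift ` {y \<in> X. h y \<noteq> 0}"
  proof
    fix x assume "x \<in> {x \<in> X. branch b h x \<noteq> 0}"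
    then have "pre b x \<in> X" "h (pre b x) \<noteq> 0" by (auto simp: branch_def split: if_splits)
    then show "x \<in> shift ` {y \<in> X. h y \<noteq> 0}" by (intro image_eqI[of _ _ "pre b x"]) auto
  qed
  then show ?thesis
    using assms branch_BV(1)[of h b] countable_subset[OF _ countable_image] unfolding BV_null_iff by blast
qed

lemma branch_linear:
  "branch b (f + g) = branch b f + branch b g" "branch b (f - g) = branch b f - branch b g"
  "branch b (cscale c f) = cscale c (branch b f)"
  by (auto simp: branch_def cscale_def fun_eq_iff)

lemma branch_p: "h \<in> BV \<beta> \<Longrightarrow> p (branch b h) \<le> 2 * p h"
  by (rule bounded_op_p[where Q = "branch b"]) (auto simp: branch_linear branch_BV branch_null)

text \<open>A monotone branch pulls an order-convex set back to an order-convex set; an intermediate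
  point is in the domain because the upper endpoint is.\<close>

lemma branch_indicator: assumes "f \<in> interval_indicators" shows "branch b f \<in> interval_indicators"
proof -
  obtain I where I: "f = indicator I" "I \<in> beta_intervals \<beta>" "f \<in> BV \<beta>"
    using assms by (auto simp: interval_indicators_def)
  define J where "J = {x. pre b x \<in> I}"
  have IX: "I \<subseteq> X" using I(2) by (auto simp: beta_intervals_def)
  have eq: "branch b f = indicator J"
    using IX by (auto simp: branch_def I(1) J_def fun_eq_iff indicator_def)
  have "J \<in> beta_intervals \<beta>"
    unfolding beta_intervals_def
  proof (intro CollectI conjI ballI impI)
    show "J \<subseteq> X" using IX by (auto simp: J_def pre_in_X)
    fix x z y assume *: "x \<in> J" "z \<in> J" "y \<in> X" "lex_le x y \<and> lex_le y z"
    then have xz: "pre b x \<in> I" "pre b z \<in> I" "lex_le (pre b x) (pre b y)" "lex_le (pre b y) (pre b z)"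
      by (auto simp: J_def lex_le_def less_fun_pre)
    have "pre b y \<in> X"
      using *(3,4) xz(2) IX cat_down[of y z "[b]"] by (auto simp: lex_le_def)
    then show "y \<in> J" using xz I(2) unfolding beta_intervals_def J_def by blast
  qed
  then show ?thesis using eq branch_BV(1)[OF I(3), of b] by (auto simp: interval_indicators_def)
qed

lemma branch_M: assumes "h \<in> M" shows "branch b h \<in> M"
proof (rule bounded_op_M[where Q = "branch b" and K = 2])
  show "branch b f \<in> M" if "f \<in> interval_indicators" for f
    using branch_indicator[OF that] by (intro step_M) (simp add: step_funs_def fun_space.span_base)
  show "branch b f \<in> BV \<beta>" "p (branch b f) \<le> 2 * p f" if "f \<in> BV \<beta>" for f
    using that by (rule branch_BV branch_p)+
qed (rule branch_linear assms)+

end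

section \<open>The transfer operator on functions and on classes\<close>

locale transfer_operator = beta_shift_space +
  fixes \<phi> :: "bseq \<Rightarrow> real"
  assumes \<phi>_M: "(\<lambda>x. complex_of_real (\<phi> x)) \<in> M"
begin

abbreviation L where "L \<equiv> transfer_fun \<beta> \<phi>"

definition weight :: "bseq \<Rightarrow> complex" where
  "weight x = complex_of_real (exp (\<phi> x))"

lemma weight_M: "weight \<in> M"
  using M_exp[OF \<phi>_M] by (simp add: weight_def[abs_def] exp_of_real)

lemma L_eq: "L f = branch 0 (weight * f) + branch 1 (weight * f)"
  by (simp add: fun_eq_iff transfer_fun_eq branch_def weight_def)

lemma L_linear: "L (f + g) = L f + L g" "L (f - g) = L f - L g" "L (cscale c f) = cscale c (L f)"
  unfolding L_eq
  by (auto simp: branch_def cscale_def fun_eq_iff algebra_simps)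

lemma L_M: "f \<in> M \<Longrightarrow> L f \<in> M"
  unfolding L_eq by (intro M_add branch_M M_mult weight_M)

lemma L_BV: "f \<in> BV \<beta> \<Longrightarrow> L f \<in> BV \<beta>"
  unfolding L_eq by (intro BV_add branch_BV BV_mult M_BV[OF weight_M])

lemma L_null: "f \<in> BV_null \<beta> \<Longrightarrow> L f \<in> BV_null \<beta>"
  unfolding L_eq using null_mult[OF _ M_BV[OF weight_M]]
  by (intro null_add branch_null) (simp_all add: mult.commute)

text \<open>The constant 4 counts two branches of norm at most 2 each.\<close>

lemma L_p: assumes "f \<in> BV \<beta>" shows "p (L f) \<le> 4 * p weight * p f"
proof -
  have wf: "weight * f \<in> BV \<beta>" by (intro BV_mult M_BV[OF weight_M] assms)
  have "p (L f) \<le> p (branch 0 (weight * f)) + p (branch 1 (weight * f))"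
    unfolding L_eq by (intro p_add branch_BV wf)
  also have "\<dots> \<le> 4 * p (weight * f)" using branch_p[OF wf, of 0] branch_p[OF wf, of 1] by simp
  also have "\<dots> \<le> 4 * (p weight * p f)" using p_mult[OF M_BV[OF weight_M] assms] by simp
  finally show ?thesis by simp
qed

lemma transfer_op_cls: assumes "f \<in> BV \<beta>" shows "transfer_op \<beta> \<phi> (cls \<beta> f) = cls \<beta> (L f)"
  unfolding transfer_op_def
proof (intro UN_constant_eq[OF cls_self[OF assms]] ballI)
  fix g assume "g \<in> cls \<beta> f"
  then have g: "g \<in> BV \<beta>" "f - g \<in> BV_null \<beta>" by (auto simp: in_cls)
  have "L f - L g \<in> BV_null \<beta>" unfolding L_linear(2)[symmetric] by (rule L_null[OF g(2)])
  then show "cls \<beta> (L g) = cls \<beta> (L f)" using cls_eq_iff[OF L_BV[OF assms] L_BV[OF g(1)]] by simp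
qed

end

section \<open>The noncompactness bound for the powers of the transfer operator\<close>

text \<open>Bolzano-Weierstrass is applied to one coordinate after the other. Discarding an initial
  piece puts all remaining values, not just almost all, within \<open>\<delta> / 2\<close> of the
  limit.\<close>

lemma common_close_subsequence:
  fixes u :: "'w \<Rightarrow> nat \<Rightarrow> complex"
  assumes "finite A" "\<And>w i. w \<in> A \<Longrightarrow> cmod (u w i) \<le> C" "0 < \<delta>"
  shows "\<exists>s::nat \<Rightarrow> nat. strict_mono s \<and> (\<forall>w\<in>A. \<forall>i j. cmod (u w (s i) - u w (s j)) \<le> \<delta>)"
  using assms(1,2)
proof (induction A)
  case empty
  show ?case by (rule exI[of _ id]) (simp add: strict_mono_def)
next
  case (insert w A)
  then obtain s :: "nat \<Rightarrow> nat" where s: "strict_mono s" "\<forall>w\<in>A. \<forall>i j. cmod (u w (s i) - u w (s j)) \<le> \<delta>"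
    by auto
  have "\<forall>i. (u w \<circ> s) i \<in> cball 0 C" using insert.prems by simp
  then obtain l and r :: "nat \<Rightarrow> nat" where r: "strict_mono r" "((u w \<circ> s) \<circ> r) \<longlonglongrightarrow> l"
    using seq_compactE[OF compact_imp_seq_compact[OF compact_cball]] by metis
  then obtain N where N: "\<And>i. i \<ge> N \<Longrightarrow> dist (u w (s (r i))) l < \<delta> / 2"
    using metric_LIMSEQ_D[OF r(2), of "\<delta> / 2"] assms(3) by auto
  define q where "q i = s (r (i + N))" for i
  have q: "strict_mono q" using s(1) r(1) by (auto simp: q_def strict_mono_def)
  have "cmod (u w (q i) - u w (q j)) \<le> \<delta>" for i j
  proof -
    have "dist (u w (q i)) (u w (q j)) \<le> dist (u w (q i)) l + dist (u w (q j)) l"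
      by (rule dist_triangle2)
    then show ?thesis using N[of "i + N"] N[of "j + N"] by (simp add: q_def dist_norm)
  qed
  moreover have "cmod (u v (q i) - u v (q j)) \<le> \<delta>" if "v \<in> A" for v i j
    using s(2) that by (simp add: q_def)
  ultimately show ?case using q by (intro exI[of _ q]) blast
qed

text \<open>Mean value inequality: \<open>c\<close> bounds the derivative up to the larger argument.
  It turns the variation of a Birkhoff sum into that of its exponential at the price of the factor
  \<open>weight_sup n\<close>.\<close>

lemma exp_diff_le:
  fixes a b c :: real
  assumes "exp a \<le> c" "exp b \<le> c" shows "\<bar>exp a - exp b\<bar> \<le> c * \<bar>a - b\<bar>"
proof -
  have *: "exp x - exp y \<le> c * (x - y)" if "y \<le> x" "exp x \<le> c" for x y
  proof -
    have "1 - exp (y - x) \<le> x - y" using exp_ge_add_one_self[of "y - x"] by linarith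
    moreover have "0 \<le> c" using that(2) order_trans[OF exp_ge_zero] by blast
    ultimately have "exp x * (1 - exp (y - x)) \<le> c * (x - y)" using that by (intro mult_mono) auto
    then show ?thesis by (simp add: algebra_simps flip: exp_add)
  qed
  show ?thesis
  proof (cases "b \<le> a")
    case True
    then show ?thesis using *[OF True assms(1)] by (simp add: abs_of_nonneg)
  next
    case False
    then have "\<bar>exp a - exp b\<bar> = exp b - exp a" "\<bar>a - b\<bar> = b - a" by auto
    then show ?thesis using *[of a b] False assms(2) by simp
  qed
qed

context beta_shift_space
begin

section \<open>Variation on cylinders\<close>

definition cyl :: "int list \<Rightarrow> bseq set" where
  "cyl w = {y \<in> X. \<exists>x. y = cat w x}"

lemma cyl_subset: "cyl w \<subseteq> X"
  by (auto simp: cyl_def)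

lemma cyl_append_subset: "cyl (v @ w) \<subseteq> cyl v"
  by (auto simp: cyl_def cat_append)

text \<open>The cylinder of \<open>v\<close> contains those of \<open>v @ [0]\<close> and
  \<open>v @ [1]\<close>, the first entirely below the second, so superadditivity can be iterated.
  The arbitrary prefix \<open>v\<close> makes the induction work.\<close>

lemma sum_tv_cyl:
  assumes "f \<in> BV \<beta>"
  shows "(\<Sum>w\<in>words n. tv (cyl (v @ w)) f) \<le> tv (cyl v) f"
proof (induction n arbitrary: v)
  case 0
  show ?case by simp
next
  case (Suc n)
  have "(\<Sum>w\<in>words (Suc n). tv (cyl (v @ w)) f)
      = (\<Sum>w\<in>words n. tv (cyl ((v @ [0]) @ w)) f) + (\<Sum>w\<in>words n. tv (cyl ((v @ [1]) @ w)) f)"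
    unfolding sum_words_Suc by (simp add: sum.distrib)
  also have "\<dots> \<le> tv (cyl (v @ [0])) f + tv (cyl (v @ [1])) f"
    by (intro add_mono Suc)
  also have "\<dots> \<le> tv (cyl v) f"
  proof (rule tv_superadditive[OF assms cyl_subset cyl_append_subset cyl_append_subset])
    fix x y assume "x \<in> cyl (v @ [0])" "y \<in> cyl (v @ [1])"
    then show "less_fun x y" by (auto simp: cyl_def cat_append less_fun_cat less_fun_pre_0_1)
  qed
  finally show ?case .
qed

end

context transfer_operator
begin

section \<open>Weights of words and their variation\<close>

definition weight_sup :: "nat \<Rightarrow> real" where
  "weight_sup n = sup_norm \<beta> (\<lambda>x. exp (birkhoff_sum n \<phi> x))"

text \<open>The full norm of the potential, so that it bounds both its values and its
  variation.\<close>

abbreviation V where "V \<equiv> nrm (\<lambda>x. complex_of_real (\<phi> x))"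

lemma \<phi>_BV: "(\<lambda>x. complex_of_real (\<phi> x)) \<in> BV \<beta>"
  by (rule M_BV[OF \<phi>_M])

lemma V_nonneg: "0 \<le> V"
  by (rule nrm_nonneg[OF \<phi>_BV])

lemma exp_le_weight_sup: assumes "x \<in> X" shows "exp (birkhoff_sum n \<phi> x) \<le> weight_sup n"
proof -
  have "birkhoff_sum n \<phi> y \<le> n * V" if y: "y \<in> X" for y
  proof -
    have "\<phi> ((shift ^^ i) y) \<le> V" for i
      using cmod_le_nrm[OF \<phi>_BV shift_pow_in[OF y], of i] by simp
    then show ?thesis
      unfolding birkhoff_sum_def using sum_bounded_above[of "{..<n}" "\<lambda>i. \<phi> ((shift ^^ i) y)" V] by simp
  qed
  then have "bdd_above ((\<lambda>x. norm (exp (birkhoff_sum n \<phi> x))) ` X)"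
    by (intro bdd_aboveI[of _ "exp (n * V)"]) auto
  then have "norm (exp (birkhoff_sum n \<phi> x)) \<le> weight_sup n"
    unfolding weight_sup_def sup_norm_def by (rule cSUP_upper[OF assms])
  then show ?thesis by simp
qed

lemma weight_sup_pos: "0 < weight_sup n"
  using exp_le_weight_sup[OF zero_seq_in, of n] exp_gt_zero[of "birkhoff_sum n \<phi> zero_seq"] by linarith

text \<open>A Birkhoff sum of length \<open>m + n\<close> is one of length \<open>m\<close> plus one
  of length \<open>n\<close> after \<open>m\<close> shifts, and the shift preserves
  \<open>X\<close>.\<close>

lemma weight_sup_add: "weight_sup (m + n) \<le> weight_sup m * weight_sup n"
proof -
  have "norm (exp (birkhoff_sum (m + n) \<phi> x)) \<le> weight_sup m * weight_sup n" if x: "x \<in> X" for x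
  proof -
    have "birkhoff_sum (m + n) \<phi> x = birkhoff_sum m \<phi> x + birkhoff_sum n \<phi> ((shift ^^ m) x)"
    proof (induction n)
      case (Suc n)
      have "(shift ^^ (m + n)) x = (shift ^^ n) ((shift ^^ m) x)"
        by (metis add.commute comp_apply funpow_add)
      then show ?case using Suc by (simp add: birkhoff_sum_def)
    qed (simp add: birkhoff_sum_def)
    then have "norm (exp (birkhoff_sum (m + n) \<phi> x))
        = exp (birkhoff_sum m \<phi> x) * exp (birkhoff_sum n \<phi> ((shift ^^ m) x))"
      by (simp add: exp_add)
    also have "\<dots> \<le> weight_sup m * weight_sup n"
      using weight_sup_pos[of m]
      by (intro mult_mono exp_le_weight_sup x shift_pow_in less_imp_le) auto
    finally show ?thesis .
  qed
  then show ?thesis unfolding weight_sup_def[of "m + n"] sup_norm_def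
    using zero_seq_in by (intro cSUP_least) auto
qed

text \<open>On a cylinder of length \<open>n\<close> each of the \<open>n\<close> summands of the Birkhoff sum is \<open>\<phi>\<close> composed with
  a monotone map.  The resulting linear growth in \<open>n\<close> is harmless for the exponential rate.\<close>

lemma vsum_birkhoff:
  assumes "length w = n" and zs: "sorted_wrt less_fun zs" "\<And>z. z \<in> set zs \<Longrightarrow> cat w z \<in> X"
  shows "vsum (\<lambda>z. complex_of_real (birkhoff_sum n \<phi> (cat w z))) zs \<le> n * V"
proof -
  have "vsum (\<lambda>z. complex_of_real (birkhoff_sum n \<phi> (cat w z))) zs
      = vsum (\<lambda>z. \<Sum>i<n. complex_of_real (\<phi> (cat (drop i w) z))) zs"
  proof (rule vsum_cong)
    fix z assume "z \<in> set zs"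
    show "complex_of_real (birkhoff_sum n \<phi> (cat w z)) = (\<Sum>i<n. complex_of_real (\<phi> (cat (drop i w) z)))"
      unfolding birkhoff_sum_def of_real_sum using assms(1)
      by (intro sum.cong refl) (simp add: shift_cat)
  qed
  also have "\<dots> \<le> (\<Sum>i<n. vsum (\<lambda>z. complex_of_real (\<phi> (cat (drop i w) z))) zs)"
    by (rule vsum_sum)
  also have "\<dots> \<le> (\<Sum>i<n. V)"
  proof (rule sum_mono)
    fix i
    have "vsum (\<lambda>z. complex_of_real (\<phi> (cat (drop i w) z))) zs
        = vsum (\<lambda>y. complex_of_real (\<phi> y)) (map (cat (drop i w)) zs)"
      by (simp add: vsum_map)
    also have "\<dots> \<le> tv X (\<lambda>y. complex_of_real (\<phi> y))"
      using zs cat_drop_in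
      by (intro vsum_le_tv \<phi>_BV) (auto simp: chains_def sorted_wrt_map less_fun_cat)
    also have "\<dots> \<le> V" by (rule tv_le_nrm[OF \<phi>_BV])
    finally show "vsum (\<lambda>z. complex_of_real (\<phi> (cat (drop i w) z))) zs \<le> V" .
  qed
  finally show ?thesis by simp
qed

definition word_term :: "(bseq \<Rightarrow> complex) \<Rightarrow> nat \<Rightarrow> int list \<Rightarrow> bseq \<Rightarrow> complex" where
  "word_term d n w x =
     (if cat w x \<in> X then of_real (exp (birkhoff_sum n \<phi> (cat w x))) * d (cat w x) else 0)"

text \<open>On the cylinder \<open>d\<close> is at most \<open>\<delta>\<close> plus its variation
  there. In the constant \<open>3 + n * V\<close> one unit each pays for the value at
  \<open>x\<close>, for the jump where the domain of the branch ends and for the variation of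
  \<open>d\<close>; \<open>n * V\<close> pays for the variation of the weight.\<close>

lemma word_term_bound:
  assumes d: "d \<in> BV \<beta>" and w: "length w = n" and \<delta>: "0 \<le> \<delta>"
    and pt: "cyl w \<noteq> {} \<Longrightarrow> q \<in> cyl w \<and> cmod (d q) \<le> \<delta>"
    and x: "x \<in> X" and xs: "xs \<in> chains X"
  shows "cmod (word_term d n w x) + vsum (word_term d n w) xs
    \<le> weight_sup n * (3 + n * V) * (\<delta> + tv (cyl w) d)"
proof -
  define a where "a = weight_sup n"
  define t where "t = tv (cyl w) d"
  define D where "D = {x. cat w x \<in> X}"
  define E where "E z = complex_of_real (exp (birkhoff_sum n \<phi> (cat w z)))" for z
  define h where "h z = E z * d (cat w z)" for z
  have a: "0 < a" unfolding a_def by (rule weight_sup_pos)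
  have t: "0 \<le> t" unfolding t_def by (rule tv_nonneg[OF d cyl_subset])
  have dD: "cmod (d (cat w z)) \<le> \<delta> + t" if "z \<in> D" for z
  proof -
    have "cat w z \<in> cyl w" using that by (auto simp: cyl_def D_def)
    moreover from this have "q \<in> cyl w" "cmod (d q) \<le> \<delta>" using pt by blast+
    ultimately show ?thesis
      using diff_le_tv[OF d cyl_subset, of "cat w z" w q] norm_triangle_sub[of "d (cat w z)" "d q"]
      by (simp add: t_def)
  qed
  have ED: "cmod (E z) \<le> a" if "z \<in> D" for z
    using exp_le_weight_sup[of "cat w z" n] that by (simp add: E_def D_def a_def)
  have hD: "cmod (h z) \<le> a * (\<delta> + t)" if "z \<in> D" for z
    unfolding h_def norm_mult using ED[OF that] dD[OF that] a by (intro mult_mono) auto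
  have pos: "0 \<le> a * (\<delta> + t)" using a t \<delta> by simp
  define zs where "zs = filter (\<lambda>z. z \<in> D) xs"
  have zs: "sorted_wrt less_fun zs" "\<And>z. z \<in> set zs \<Longrightarrow> z \<in> D"
    using xs by (auto simp: zs_def chains_def sorted_wrt_filter)
  have word_term_eq: "word_term d n w = (\<lambda>x. if x \<in> D then h x else 0)"
    by (auto simp: word_term_def fun_eq_iff h_def E_def D_def)
  have "vsum (word_term d n w) xs \<le> vsum h zs + a * (\<delta> + t)"
    unfolding word_term_eq zs_def
  proof (rule vsum_cutoff)
    show "x \<in> D" if "x \<in> set xs" "y \<in> D" "less_fun x y" for x y
      using that xs cat_down[of x y w] by (auto simp: D_def chains_def)
  qed (use xs hD pos in \<open>auto simp: chains_def\<close>)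
  moreover have "vsum h zs \<le> a * vsum (\<lambda>z. d (cat w z)) zs + (\<delta> + t) * vsum E zs"
    unfolding h_def using ED dD zs by (intro vsum_mult) auto
  moreover have "a * vsum (\<lambda>z. d (cat w z)) zs \<le> a * t"
  proof -
    have "vsum d (map (cat w) zs) \<le> t"
      unfolding t_def using zs
      by (intro vsum_le_tv d cyl_subset) (auto simp: chains_def sorted_wrt_map less_fun_cat cyl_def D_def)
    then show ?thesis using a by (simp add: vsum_map)
  qed
  moreover have "(\<delta> + t) * vsum E zs \<le> (\<delta> + t) * (a * (n * V))"
  proof (rule mult_left_mono)
    have "vsum E zs \<le> a * vsum (\<lambda>z. complex_of_real (birkhoff_sum n \<phi> (cat w z))) zs"
    proof (rule vsum_le)
      fix y z assume "y \<in> set zs" "z \<in> set zs"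
      then have "exp (birkhoff_sum n \<phi> (cat w y)) \<le> a" "exp (birkhoff_sum n \<phi> (cat w z)) \<le> a"
        using zs(2) exp_le_weight_sup by (auto simp: D_def a_def)
      then show "cmod (E y - E z) \<le> a * cmod (complex_of_real (birkhoff_sum n \<phi> (cat w y))
          - complex_of_real (birkhoff_sum n \<phi> (cat w z)))"
        unfolding E_def of_real_diff[symmetric] norm_of_real by (rule exp_diff_le)
    qed
    also have "\<dots> \<le> a * (n * V)"
      using vsum_birkhoff[OF w zs(1)] zs(2) a by (intro mult_left_mono) (auto simp: D_def)
    finally show "vsum E zs \<le> a * (n * V)" .
  qed (use t \<delta> in simp)
  moreover have "cmod (word_term d n w x) \<le> a * (\<delta> + t)"
    using hD[of x] pos by (simp add: word_term_eq)
  moreover have "a * t \<le> a * (\<delta> + t)" using a \<delta> by simp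
  ultimately have "cmod (word_term d n w x) + vsum (word_term d n w) xs
      \<le> 3 * (a * (\<delta> + t)) + (\<delta> + t) * (a * (n * V))"
    by linarith
  also have "\<dots> = a * (3 + n * V) * (\<delta> + t)" by (simp add: algebra_simps)
  finally show ?thesis by (simp only: a_def t_def)
qed

text \<open>The \<open>2 ^ n\<close> words contribute \<open>\<delta>\<close> each, while the
  variations on the cylinders add up to at most \<open>nrm d\<close>. With
  \<open>\<delta> = 1 / 2 ^ n\<close> the last factor is \<open>1 + nrm d\<close>, whatever
  \<open>n\<close> is.\<close>

lemma L_pow_bound:
  assumes d: "d \<in> BV \<beta>" and \<delta>: "0 \<le> \<delta>"
    and pt: "\<And>w. w \<in> words n \<Longrightarrow> cyl w \<noteq> {} \<Longrightarrow> q w \<in> cyl w \<and> cmod (d (q w)) \<le> \<delta>"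
  shows "nrm ((L ^^ n) d) \<le> weight_sup n * (3 + n * V) * (2 ^ n * \<delta> + nrm d)"
proof (rule BV_leI)
  fix x xs assume x: "x \<in> X" and xs: "xs \<in> chains X"
  have eq: "(L ^^ n) d y = (\<Sum>w\<in>words n. word_term d n w y)" if "y \<in> X" for y
    unfolding transfer_fun_pow[OF that] word_term_def ..
  have "vsum ((L ^^ n) d) xs = vsum (\<lambda>y. \<Sum>w\<in>words n. word_term d n w y) xs"
    using xs by (intro vsum_cong eq) (auto simp: chains_def)
  also have "\<dots> \<le> (\<Sum>w\<in>words n. vsum (word_term d n w) xs)" by (rule vsum_sum)
  moreover have "cmod ((L ^^ n) d x) \<le> (\<Sum>w\<in>words n. cmod (word_term d n w x))"
    unfolding eq[OF x] by (rule norm_sum)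
  ultimately have "cmod ((L ^^ n) d x) + vsum ((L ^^ n) d) xs
      \<le> (\<Sum>w\<in>words n. cmod (word_term d n w x) + vsum (word_term d n w) xs)"
    by (simp add: sum.distrib)
  also have "\<dots> \<le> (\<Sum>w\<in>words n. weight_sup n * (3 + n * V) * (\<delta> + tv (cyl w) d))"
    using pt by (intro sum_mono word_term_bound d \<delta> x xs length_words)
  also have "\<dots> = weight_sup n * (3 + n * V) * (2 ^ n * \<delta> + (\<Sum>w\<in>words n. tv (cyl w) d))"
    by (simp add: sum.distrib card_words flip: sum_distrib_left)
  also have "\<dots> \<le> weight_sup n * (3 + n * V) * (2 ^ n * \<delta> + nrm d)"
  proof (intro mult_left_mono add_left_mono)
    have "(\<Sum>w\<in>words n. tv (cyl ([] @ w)) d) \<le> tv (cyl []) d" by (rule sum_tv_cyl[OF d])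
    also have "cyl [] = X" by (auto simp: cyl_def)
    also have "tv X d \<le> nrm d" by (rule tv_le_nrm[OF d])
    finally show "(\<Sum>w\<in>words n. tv (cyl w) d) \<le> nrm d" by simp
    show "0 \<le> weight_sup n * (3 + n * V)" using weight_sup_pos[of n] V_nonneg by simp
  qed
  finally show "cmod ((L ^^ n) d x) + vsum ((L ^^ n) d) xs
    \<le> weight_sup n * (3 + n * V) * (2 ^ n * \<delta> + nrm d)" .
qed

section \<open>The transfer operator as an instance of the Riesz theory\<close>

lemma L_pow_diff: "(L ^^ n) (f - g) = (L ^^ n) f - (L ^^ n) g"
  by (induction n) (simp_all only: funpow.simps id_apply o_apply L_linear)

lemma L_pow_null: "f \<in> BV_null \<beta> \<Longrightarrow> (L ^^ n) f \<in> BV_null \<beta>"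
  by (induction n) (simp_all only: funpow.simps id_apply o_apply L_null)

lemma L_pow_BV: "f \<in> BV \<beta> \<Longrightarrow> (L ^^ n) f \<in> BV \<beta>"
  by (induction n) (simp_all only: funpow.simps id_apply o_apply L_BV)

sublocale op: seminormed_operator cscale M p L "4 * p weight"
proof
  show "fun_space.subspace M"
    by (rule fun_space.subspaceI) (auto intro: M_add M_scale step_M[OF step_zero])
  show "p (f + g) \<le> p f + p g" if "f \<in> M" "g \<in> M" for f g
    using that by (intro p_add M_BV)
  show "p (cscale c f) = cmod c * p f" if "f \<in> M" for c f
    using that by (intro p_cscale M_BV)
  show "0 \<le> 4 * p weight" using p_nonneg[OF M_BV[OF weight_M]] by simp
  show "p (L f) \<le> 4 * p weight * p f" if "f \<in> M" for f
    using that by (intro L_p M_BV)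
  show "\<exists>l\<in>M. (\<lambda>n. p (F n - l)) \<longlonglongrightarrow> 0"
    if F: "range F \<subseteq> M" and C: "\<forall>e>0. \<exists>N. \<forall>m\<ge>N. \<forall>n\<ge>N. p (F m - F n) < e" for F
  proof -
    have FM: "F n \<in> M" for n using F by blast
    obtain f where f: "f \<in> BV \<beta>" "(\<lambda>n. p (F n - f)) \<longlonglongrightarrow> 0"
      using p_complete[OF M_BV[OF FM] C] by blast
    have "f \<in> M"
    proof (rule M_closed[OF f(1)])
      fix e :: real assume "e > 0"
      then have "\<forall>\<^sub>F n in sequentially. p (F n - f) < e" by (rule order_tendstoD(2)[OF f(2)])
      then obtain n where n: "p (F n - f) < e" by (auto simp: eventually_sequentially)
      have "p (f - F n) = p (cscale (- 1) (F n - f))"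
        by (rule arg_cong[of _ _ p]) (simp add: cscale_def fun_eq_iff)
      also have "\<dots> = p (F n - f)"
        by (subst p_cscale[OF BV_diff(1)[OF M_BV[OF FM] f(1)]]) simp
      finally show "\<exists>g\<in>M. p (f - g) < e" using n FM[of n] by (intro bexI[of _ "F n"]) simp_all
    qed
    then show ?thesis using f(2) by blast
  qed
qed (rule L_M L_linear; assumption)+

text \<open>The gap between \<open>\<theta>\<close> and \<open>\<rho>\<close> absorbs the linear
  factor, as \<open>n * (\<theta> / \<rho>) ^ n\<close> tends to 0. The factor 5 is
  \<open>2 ^ n * (1 / 2 ^ n)\<close> plus 4, where 4 bounds the norm of a difference of two
  representatives of norm below 2.\<close>

lemma ess_bound_weight:
  assumes \<theta>: "0 < \<theta>" "\<theta> < \<rho>" and ev: "\<forall>\<^sub>F n in sequentially. weight_sup n \<le> \<theta> ^ n"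
  shows "op.ess_bound \<rho>"
  unfolding op.ess_bound_def
proof (intro allI impI)
  fix e :: real assume e: "e > 0"
  define r where "r = \<theta> / \<rho>"
  have r: "0 < r" "r < 1" using \<theta> by (auto simp: r_def)
  \<comment> \<open>The coefficients come from multiplying out
    \<open>(3 + n * V) * 5\<close>.\<close>
  have "(\<lambda>n. 15 * r ^ n + 5 * V * (real n * r ^ n)) \<longlonglongrightarrow> 15 * 0 + 5 * V * 0"
    using r by (intro tendsto_intros LIMSEQ_power_zero powser_times_n_limit_0) auto
  then have "\<forall>\<^sub>F n in sequentially. 15 * r ^ n + 5 * V * (real n * r ^ n) < e"
    by (rule order_tendstoD) (use e in simp)
  with ev have "\<forall>\<^sub>F n in sequentially. weight_sup n * (3 + n * V) * 5 \<le> e * \<rho> ^ n"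
  proof eventually_elim
    case (elim n)
    have "weight_sup n * (3 + n * V) * 5 \<le> \<theta> ^ n * (3 + n * V) * 5"
      using elim V_nonneg by (intro mult_right_mono) auto
    also have "\<dots> = (15 * r ^ n + 5 * V * (real n * r ^ n)) * \<rho> ^ n"
      using \<theta> by (simp add: r_def power_divide field_simps)
    also have "\<dots> \<le> e * \<rho> ^ n" using elim \<theta> by (intro mult_right_mono) auto
    finally show ?case .
  qed
  then obtain n where n: "weight_sup n * (3 + n * V) * 5 \<le> e * \<rho> ^ n"
    by (auto simp: eventually_sequentially)
  show "\<exists>m. \<forall>F::nat \<Rightarrow> bseq \<Rightarrow> complex. (\<forall>i. F i \<in> M \<and> p (F i) \<le> 1) \<longrightarrow>
      (\<exists>s::nat \<Rightarrow> nat. strict_mono s \<and> (\<forall>i j. p ((L ^^ m) (F (s i)) - (L ^^ m) (F (s j))) \<le> e * \<rho> ^ m))"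
  proof (intro exI[of _ n] allI impI)
    fix F :: "nat \<Rightarrow> bseq \<Rightarrow> complex" assume F: "\<forall>i. F i \<in> M \<and> p (F i) \<le> 1"
    have FM: "F i \<in> M" for i using F by simp
    \<comment> \<open>\<open>p (F i) \<le> 1\<close> bounds an infimum that need not be attained,
      hence the larger bound 2 for a representative.\<close>
    have "\<exists>h\<in>BV \<beta>. F i - h \<in> BV_null \<beta> \<and> nrm h < 2" for i
      using F by (intro p_less M_BV) (auto intro: order_le_less_trans)
    then obtain h where h: "\<And>i. h i \<in> BV \<beta>" "\<And>i. F i - h i \<in> BV_null \<beta>" "\<And>i. nrm (h i) < 2" by metis
    define q where "q w = (SOME y. y \<in> cyl w)" for w
    have q: "q w \<in> cyl w" if "cyl w \<noteq> {}" for w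
      unfolding q_def using that by (simp add: some_in_eq)
    define W where "W = {w \<in> words n. cyl w \<noteq> {}}"
    have "cmod (h i (q w)) \<le> 2" if "w \<in> W" for w i
      using cmod_le_nrm[OF h(1), of "q w" i] h(3)[of i] q[of w] cyl_subset[of w] that
      by (force simp: W_def)
    moreover have "finite W" by (simp add: W_def)
    moreover have "0 < (1 / 2 ^ n :: real)" by simp
    ultimately obtain s :: "nat \<Rightarrow> nat" where s: "strict_mono s"
        "\<forall>w\<in>W. \<forall>i j. cmod (h (s i) (q w) - h (s j) (q w)) \<le> 1 / 2 ^ n"
      using common_close_subsequence[of W "\<lambda>w i. h i (q w)" 2 "1 / 2 ^ n"] by auto
    have "p ((L ^^ n) (F (s i)) - (L ^^ n) (F (s j))) \<le> e * \<rho> ^ n" for i j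
    proof -
      define d where "d = h (s i) - h (s j)"
      have d: "d \<in> BV \<beta>" unfolding d_def by (intro BV_diff h)
      have nd: "nrm d \<le> 4" unfolding d_def using BV_diff(2)[OF h(1) h(1), of "s i" "s j"] h(3)[of "s i"] h(3)[of "s j"]
        by linarith
      have FF: "F (s i) - F (s j) \<in> BV \<beta>" by (intro BV_diff M_BV FM)
      \<comment> \<open>Passing from \<open>F\<close> to the representatives \<open>h\<close>
        changes the difference by a null function, and powers of \<open>L\<close> preserve null
        functions.\<close>
      have "(F (s i) - F (s j)) - d = (F (s i) - h (s i)) - (F (s j) - h (s j))" by (simp add: d_def fun_eq_iff)
      also have "\<dots> \<in> BV_null \<beta>" by (intro null_diff h)
      finally have "(L ^^ n) (F (s i) - F (s j)) - (L ^^ n) d \<in> BV_null \<beta>"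
        unfolding L_pow_diff[symmetric, of _ _ d] by (rule L_pow_null)
      then have "p ((L ^^ n) (F (s i) - F (s j))) \<le> nrm ((L ^^ n) d)"
        by (intro p_le L_pow_BV FF d)
      also have "\<dots> \<le> weight_sup n * (3 + n * V) * (2 ^ n * (1 / 2 ^ n) + nrm d)"
        using s(2) q by (intro L_pow_bound[where q = q] d) (auto simp: d_def W_def)
      also have "\<dots> \<le> weight_sup n * (3 + n * V) * 5"
        using nd weight_sup_pos[of n] V_nonneg by (intro mult_left_mono) auto
      also note n
      finally show ?thesis unfolding L_pow_diff .
    qed
    then show "\<exists>s::nat \<Rightarrow> nat. strict_mono s \<and>
        (\<forall>i j. p ((L ^^ n) (F (s i)) - (L ^^ n) (F (s j))) \<le> e * \<rho> ^ n)"
      using s(1) by blast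
  qed
qed

end

section \<open>Spectrum of the transfer operator\<close>

context beta_shift_space
begin

lemma qzero_eq: "qzero \<beta> = cls \<beta> 0"
  by (simp add: qzero_def zero_fun_def)

lemma cls_eq_qzero_iff: "f \<in> BV \<beta> \<Longrightarrow> cls \<beta> f = qzero \<beta> \<longleftrightarrow> p f = 0"
  unfolding qzero_eq using cls_eq_iff[OF _ BV_zero(1), of f] p_eq_0_iff[of f] by simp

lemma cls_eq_iff_p: "f \<in> BV \<beta> \<Longrightarrow> g \<in> BV \<beta> \<Longrightarrow> cls \<beta> f = cls \<beta> g \<longleftrightarrow> p (f - g) = 0"
  using cls_eq_iff[of f g] p_eq_0_iff[OF BV_diff(1), of f g] by (simp only:)

lemma qscale_cscale: "f \<in> BV \<beta> \<Longrightarrow> qscale \<beta> c (cls \<beta> f) = cls \<beta> (cscale c f)"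
  unfolding cscale_def by (rule qscale_cls)

end

context transfer_operator
begin

section \<open>Translation from functions to classes\<close>

abbreviation T where "T \<equiv> transfer_op \<beta> \<phi>"

lemma resolvent_cls: "f \<in> M \<Longrightarrow> resolvent_map \<beta> T z (cls \<beta> f) = cls \<beta> (op.A z f)"
  unfolding resolvent_map_def op.A_def
  by (simp only: transfer_op_cls qscale_cscale M_BV M_scale L_M qdiff_cls)

lemma resolvent_pow_cls: "f \<in> M \<Longrightarrow> (resolvent_map \<beta> T z ^^ k) (cls \<beta> f) = cls \<beta> ((op.A z ^^ k) f)"
  by (induction k) (simp_all only: funpow.simps id_apply o_apply resolvent_cls op.A_pow_V)

text \<open>Boundedness below makes the class of a preimage under \<open>op.A z\<close> unique and
  bounds the inverse by \<open>K\<close>; surjectivity up to null functions provides preimages for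
  all of \<open>F_space \<beta>\<close>.\<close>

lemma good_notin_spectrum:
  assumes "op.good z" shows "z \<notin> F_spectrum \<beta> T"
proof -
  obtain K where K: "\<And>x. x \<in> M \<Longrightarrow> p x \<le> K * p (op.A z x)"
    and surj: "\<And>y. y \<in> M \<Longrightarrow> \<exists>x\<in>M. p (op.A z x - y) = 0"
    using assms unfolding op.good_def by blast
  define R where "R A = cls \<beta> (SOME g. g \<in> M \<and> cls \<beta> (op.A z g) = A)" for A
  have R_cls: "R (cls \<beta> (op.A z f)) = cls \<beta> f" if f: "f \<in> M" for f
  proof -
    define g where "g = (SOME g. g \<in> M \<and> cls \<beta> (op.A z g) = cls \<beta> (op.A z f))"
    have "g \<in> M \<and> cls \<beta> (op.A z g) = cls \<beta> (op.A z f)"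
      unfolding g_def by (rule someI[of _ f]) (simp add: f)
    then have g: "g \<in> M" "cls \<beta> (op.A z g) = cls \<beta> (op.A z f)" by simp_all
    have "p (op.A z (g - f)) = 0"
      unfolding op.A_diff[OF g(1) f]
      using g(2) cls_eq_iff_p[OF M_BV[OF op.A_V[OF g(1)]] M_BV[OF op.A_V[OF f]]] by blast
    then have "p (g - f) \<le> 0" using K[OF M_diff[OF g(1) f]] by simp
    then have "p (g - f) = 0" using op.p_nonneg[OF M_diff[OF g(1) f]] by simp
    then have "cls \<beta> g = cls \<beta> f" using cls_eq_iff_p[OF M_BV[OF g(1)] M_BV[OF f]] by simp
    then show ?thesis by (simp add: R_def g_def)
  qed
  have rep: "\<exists>g\<in>M. A = cls \<beta> (op.A z g) \<and> R A = cls \<beta> g" if A: "A \<in> F_space \<beta>" for A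
  proof -
    obtain y where y: "y \<in> M" "A = cls \<beta> y" using F_cases[OF A] .
    obtain g where g: "g \<in> M" "p (op.A z g - y) = 0" using surj[OF y(1)] by blast
    have "cls \<beta> (op.A z g) = A"
      using g(2) y cls_eq_iff_p[OF M_BV[OF op.A_V[OF g(1)]] M_BV[OF y(1)]] by simp
    then show ?thesis using R_cls[OF g(1)] g(1) by (intro bexI[of _ g]) auto
  qed
  have "F_bounded_op \<beta> R"
    unfolding F_bounded_op_def F_linear_op_def
  proof (intro conjI ballI allI exI)
    fix A assume A: "A \<in> F_space \<beta>"
    obtain g where g: "g \<in> M" "A = cls \<beta> (op.A z g)" "R A = cls \<beta> g" using rep[OF A] by blast
    show "R A \<in> F_space \<beta>" using g by (simp add: cls_in_F)
    show "qnorm \<beta> (R A) \<le> K * qnorm \<beta> A" using K[OF g(1)] g by (simp add: p_def)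
    show "R (qscale \<beta> c A) = qscale \<beta> c (R A)" for c
      using R_cls[OF M_scale[OF g(1), of c]] g op.A_scale[OF g(1), of z c]
      by (simp add: qscale_cscale M_BV)
    fix B assume B: "B \<in> F_space \<beta>"
    obtain h where h: "h \<in> M" "B = cls \<beta> (op.A z h)" "R B = cls \<beta> h" using rep[OF B] by blast
    have "qadd \<beta> A B = cls \<beta> (op.A z (g + h))"
      unfolding g(2) h(2) op.A_add[OF g(1) h(1)] by (intro qadd_cls M_BV op.A_V g h)
    then have "R (qadd \<beta> A B) = cls \<beta> (g + h)" using R_cls[OF M_add[OF g(1) h(1)]] by simp
    also have "\<dots> = qadd \<beta> (R A) (R B)" unfolding g(3) h(3) using M_BV g(1) h(1) by (simp only: qadd_cls)
    finally show "R (qadd \<beta> A B) = qadd \<beta> (R A) (R B)" .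
  qed
  moreover have "R (resolvent_map \<beta> T z A) = A \<and> resolvent_map \<beta> T z (R A) = A" if A: "A \<in> F_space \<beta>" for A
  proof -
    obtain f where f: "f \<in> M" "A = cls \<beta> f" using F_cases[OF A] .
    obtain g where g: "g \<in> M" "A = cls \<beta> (op.A z g)" "R A = cls \<beta> g" using rep[OF A] by blast
    have "R (resolvent_map \<beta> T z A) = A" unfolding f(2) resolvent_cls[OF f(1)] by (rule R_cls[OF f(1)])
    moreover have "resolvent_map \<beta> T z (R A) = A" unfolding g(3) resolvent_cls[OF g(1)] by (rule g(2)[symmetric])
    ultimately show ?thesis ..
  qed
  ultimately show ?thesis unfolding F_spectrum_def by blast
qed

lemma eigenvalue_F: assumes "op.eigenvalue z" shows "F_eigenvalue \<beta> T z"
proof -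
  obtain f where f: "f \<in> M" "p f \<noteq> 0" "p (op.A z f) = 0" using assms unfolding op.eigenvalue_def by blast
  have fB: "f \<in> BV \<beta>" by (rule M_BV[OF f(1)])
  have "qscale \<beta> z (cls \<beta> f) = T (cls \<beta> f)"
    using f(3) cls_eq_iff_p[OF BV_cscale(1)[OF fB, of z] L_BV[OF fB]]
    by (simp only: transfer_op_cls[OF fB] qscale_cscale[OF fB] op.A_def)
  then show ?thesis
    unfolding F_eigenvalue_def using f cls_eq_qzero_iff[OF fB]
    by (intro bexI[of _ "cls \<beta> f"]) (simp_all add: cls_in_F)
qed

text \<open>The recursion of \<open>W\<close> is unrolled into coefficients, the form in which
  \<open>qspan\<close> is stated.\<close>

lemma W_qspan:
  assumes "\<And>i. i < n \<Longrightarrow> u i \<in> M" "f \<in> op.W u n"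
  shows "\<exists>c. p (f - (\<lambda>x. \<Sum>i<n. c i * u i x)) = 0"
  using assms
proof (induction n arbitrary: f)
  case 0
  have "f - (\<lambda>x. \<Sum>i<0. c i * u i x) = f" for c by (simp add: fun_eq_iff)
  then show ?case using 0 by simp
next
  case (Suc n)
  obtain c where c: "f - cscale c (u n) \<in> op.W u n" using Suc.prems(2) by auto
  have "\<exists>d. p (f - cscale c (u n) - (\<lambda>x. \<Sum>i<n. d i * u i x)) = 0"
    by (rule Suc.IH[OF Suc.prems(1) c]) simp
  then obtain d where d: "p (f - cscale c (u n) - (\<lambda>x. \<Sum>i<n. d i * u i x)) = 0" by (rule exE)
  have "f - cscale c (u n) - (\<lambda>x. \<Sum>i<n. d i * u i x) = f - (\<lambda>x. \<Sum>i<Suc n. (d(n := c)) i * u i x)"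
    by (auto simp: fun_eq_iff cscale_def intro!: sum.cong)
  then show ?case using d by (intro exI[of _ "d(n := c)"]) (simp only:)
qed

text \<open>Spectral values are not good, which is all that the Riesz theory has to know about the
  spectrum.\<close>

lemma isolated_eigenvalue:
  assumes ess: "op.ess_bound \<rho>" and \<rho>: "0 < \<rho>" "\<rho> < cmod z" and z: "z \<in> F_spectrum \<beta> T"
  shows "isolated_eigenvalue_fin_mult \<beta> T z"
  unfolding isolated_eigenvalue_fin_mult_def
proof (intro conjI)
  have bad: "\<not> op.good z" using z good_notin_spectrum by blast
  note iso = op.bad_isolated_eigenvalue[OF ess \<rho> bad]
  show "F_eigenvalue \<beta> T z" by (rule eigenvalue_F[OF iso(1)])
  obtain d where d: "d > 0" "\<And>w. dist w z < d \<Longrightarrow> w \<noteq> z \<Longrightarrow> op.good w" using iso(2) by blast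
  have "w = z" if "w \<in> ball z d" "w \<in> F_spectrum \<beta> T" for w
    using d(2)[of w] good_notin_spectrum[of w] that by (auto simp: dist_commute)
  then have "ball z d \<inter> F_spectrum \<beta> T = {z}" using z d(1) by auto
  then show "z isolated_in F_spectrum \<beta> T"
    unfolding isolated_in_def using z by (auto intro!: exI[of _ "ball z d"])
  obtain n u where u: "\<And>i. i < n \<Longrightarrow> u i \<in> {x \<in> M. \<exists>k. p ((op.A z ^^ k) x) = 0}"
      and sub: "{x \<in> M. \<exists>k. p ((op.A z ^^ k) x) = 0} \<subseteq> op.W u n"
    using op.finite_generalized_eigenspace[OF ess \<rho>(1) less_imp_le[OF \<rho>(2)]] by blast
  have uM: "u i \<in> M" if "i < n" for i using u[OF that] by simp
  have gen: "cls \<beta> f \<in> gen_eigenspace \<beta> T z \<longleftrightarrow> (\<exists>k. p ((op.A z ^^ k) f) = 0)" if f: "f \<in> M" for f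
    unfolding gen_eigenspace_def
    using f by (simp add: cls_in_F resolvent_pow_cls cls_eq_qzero_iff M_BV op.A_pow_V)
  show "finite_multiplicity \<beta> T z"
    unfolding finite_multiplicity_def
  proof (intro exI[of _ "(\<lambda>i. cls \<beta> (u i)) ` {..<n}"] conjI subsetI)
    fix A assume "A \<in> (\<lambda>i. cls \<beta> (u i)) ` {..<n}"
    then show "A \<in> gen_eigenspace \<beta> T z" using u gen by auto
  next
    fix A assume A: "A \<in> gen_eigenspace \<beta> T z"
    then have "A \<in> F_space \<beta>" by (simp add: gen_eigenspace_def)
    then obtain f where f: "f \<in> M" "A = cls \<beta> f" by (rule F_cases)
    then have "f \<in> op.W u n" using sub A gen[OF f(1)] by blast
    then obtain c where c: "p (f - (\<lambda>x. \<Sum>i<n. c i * u i x)) = 0" 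
      using W_qspan[where u = u and n = n, OF uM] by blast
    have "(\<lambda>x. \<Sum>i\<in>S. c i * u i x) = (\<Sum>i\<in>S. cscale (c i) (u i))" for S
      by (induction S rule: infinite_finite_induct) (auto simp: cscale_def fun_eq_iff)
    then have "(\<lambda>x. \<Sum>i<n. c i * u i x) \<in> BV \<beta>"
      using BV_sum[of "{..<n}" "\<lambda>i. cscale (c i) (u i)"] uM by (simp add: BV_cscale M_BV)
    then have "A = cls \<beta> (\<lambda>x. \<Sum>i<n. c i * u i x)"
      using c f cls_eq_iff_p[OF M_BV[OF f(1)]] by simp
    moreover have "\<forall>i<n. \<exists>B\<in>(\<lambda>i. cls \<beta> (u i)) ` {..<n}. u i \<in> B"
      using cls_self[OF M_BV[OF uM]] by blast
    ultimately show "A \<in> qspan \<beta> ((\<lambda>i. cls \<beta> (u i)) ` {..<n})" unfolding qspan_def by blast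
  qed simp
qed

section \<open>The growth rate of the weights and the conformal eigenvalue\<close>

lemma r_phi_eq: "r_phi \<beta> \<phi> = limsup (\<lambda>n. ereal (root n (weight_sup n)))"
  by (simp add: r_phi_def weight_sup_def)

text \<open>A number \<open>\<theta>'\<close> strictly between \<open>r_phi\<close> and
  \<open>c\<close> eventually dominates the roots. Taking \<open>\<rho>\<close> halfway between
  \<open>\<theta>'\<close> and \<open>c\<close> leaves the gap that \<open>ess_bound_weight\<close>
  needs and keeps \<open>\<rho> < c\<close>.\<close>

lemma ess_bound_above_r_phi:
  assumes "r_phi \<beta> \<phi> < ereal c"
  shows "\<exists>\<rho>. 0 < \<rho> \<and> \<rho> < c \<and> op.ess_bound \<rho>"
proof -
  \<comment> \<open>Nonnegativity of \<open>r_phi\<close> is what makes \<open>\<theta>'\<close>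
    positive.\<close>
  have "0 \<le> r_phi \<beta> \<phi>"
    unfolding r_phi_eq by (rule le_Limsup) (auto intro!: always_eventually real_root_ge_zero simp: weight_sup_pos less_imp_le)
  obtain \<theta>' where \<theta>': "r_phi \<beta> \<phi> < ereal \<theta>'" "ereal \<theta>' < ereal c" using ereal_dense2[OF assms] by blast
  have \<theta>'0: "0 < \<theta>'" using \<open>0 \<le> r_phi \<beta> \<phi>\<close> \<theta>'(1) by (metis ereal_less(2) order_le_less_trans)
  have "\<forall>\<^sub>F n in sequentially. ereal (root n (weight_sup n)) < ereal \<theta>'"
    using \<theta>'(1) unfolding r_phi_eq by (rule Limsup_lessD)
  moreover have "\<forall>\<^sub>F n in sequentially. 0 < n" by (rule eventually_gt_at_top)
  ultimately have "\<forall>\<^sub>F n in sequentially. weight_sup n \<le> \<theta>' ^ n"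
  proof eventually_elim
    case (elim n)
    have "weight_sup n = root n (weight_sup n) ^ n" using elim weight_sup_pos[of n] by simp
    also have "\<dots> \<le> \<theta>' ^ n" using elim weight_sup_pos[of n] by (intro power_mono) (auto intro: less_imp_le)
    finally show ?case .
  qed
  then have "op.ess_bound ((\<theta>' + c) / 2)" using \<theta>' \<theta>'0 by (intro ess_bound_weight[of \<theta>']) auto
  then show ?thesis using \<theta>' \<theta>'0 by (intro exI[of _ "(\<theta>' + c) / 2"]) auto
qed

text \<open>A single \<open>k\<close> with \<open>weight_sup k < lam ^ k / 2\<close> suffices:
  division of \<open>n\<close> by \<open>k\<close> and submultiplicativity give
  \<open>weight_sup n \<le> C * \<theta> ^ n\<close>, where \<open>\<theta>\<close> is
  \<open>lam\<close> times the \<open>k\<close>-th root of 1/2, and the roots of \<open>C\<close>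
  tend to 1.\<close>

lemma r_phi_less:
  assumes lam: "0 < lam" and lim: "(\<lambda>n. weight_sup n / lam ^ n) \<longlonglongrightarrow> 0"
  shows "r_phi \<beta> \<phi> < ereal lam"
proof -
  have "\<forall>\<^sub>F n in sequentially. weight_sup n / lam ^ n < 1 / 2"
    by (rule order_tendstoD(2)[OF lim]) simp
  then have "\<forall>\<^sub>F n in sequentially. weight_sup n / lam ^ n < 1 / 2 \<and> 0 < n"
    using eventually_gt_at_top[of 0] by eventually_elim simp
  then obtain k where k: "weight_sup k / lam ^ k < 1 / 2" "0 < k" by (auto simp: eventually_sequentially)
  define \<theta> where "\<theta> = root k (1 / 2) * lam"
  have \<theta>: "0 < \<theta>" "\<theta> < lam" using k lam by (auto simp: \<theta>_def)
  have \<theta>k: "weight_sup k \<le> \<theta> ^ k"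
    using k lam by (simp add: \<theta>_def power_mult_distrib field_simps)
  \<comment> \<open>\<open>C\<close> absorbs the remainders \<open>j < k\<close>; the summand 1
    keeps it positive, so that its roots tend to 1.\<close>
  define C where "C = 1 + (\<Sum>j<k. weight_sup j / \<theta> ^ j)"
  have pos: "0 \<le> weight_sup j / \<theta> ^ j" for j using weight_sup_pos[of j] \<theta> by simp
  have C: "1 \<le> C" unfolding C_def using pos by (simp add: sum_nonneg)
  have small: "weight_sup j \<le> C * \<theta> ^ j" if "j < k" for j
  proof -
    have "weight_sup j / \<theta> ^ j \<le> (\<Sum>j<k. weight_sup j / \<theta> ^ j)"
      using that pos by (intro member_le_sum) auto
    then have "weight_sup j / \<theta> ^ j \<le> C" by (simp add: C_def)
    then show ?thesis using \<theta> by (simp add: field_simps)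
  qed
  have mult: "weight_sup (q * k + j) \<le> C * \<theta> ^ (q * k + j)" if "j < k" for q j
  proof (induction q)
    case 0
    show ?case using small[OF that] by simp
  next
    case (Suc q)
    have "weight_sup (k + (q * k + j)) \<le> weight_sup k * weight_sup (q * k + j)" by (rule weight_sup_add)
    also have "\<dots> \<le> \<theta> ^ k * (C * \<theta> ^ (q * k + j))"
      using \<theta>k Suc weight_sup_pos \<theta> by (intro mult_mono) (auto intro: less_imp_le)
    finally show ?case by (simp add: power_add algebra_simps)
  qed
  have all: "weight_sup n \<le> C * \<theta> ^ n" for n
    using mult[of "n mod k" "n div k"] k by simp
  have "(\<lambda>n. root n C * \<theta>) \<longlonglongrightarrow> 1 * \<theta>"
    using C by (intro tendsto_mult LIMSEQ_root_const tendsto_const) auto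
  then have "(\<lambda>n. ereal (root n C * \<theta>)) \<longlonglongrightarrow> ereal \<theta>" by simp
  then have "limsup (\<lambda>n. ereal (root n C * \<theta>)) = ereal \<theta>"
    by (rule lim_imp_Limsup[rotated]) simp
  moreover have "limsup (\<lambda>n. ereal (root n (weight_sup n))) \<le> limsup (\<lambda>n. ereal (root n C * \<theta>))"
  proof (rule Limsup_mono)
    show "\<forall>\<^sub>F n in sequentially. ereal (root n (weight_sup n)) \<le> ereal (root n C * \<theta>)"
      using eventually_gt_at_top[of 0]
    proof eventually_elim
      case (elim n)
      have "root n (weight_sup n) \<le> root n (C * \<theta> ^ n)" using all elim by simp
      also have "\<dots> = root n C * \<theta>" using elim \<theta> by (simp add: real_root_mult real_root_power_cancel)
      finally show ?case by simp
    qed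
  qed
  ultimately show ?thesis unfolding r_phi_eq using \<theta> by (auto intro: order_le_less_trans)
qed

text \<open>An inverse would represent the constant 1 as the class of \<open>lam f - L f\<close>, on
  which \<open>\<nu>\<close> vanishes by conformality.\<close>

lemma conformal_in_spectrum:
  assumes "conformal_pair \<beta> \<phi> lam \<nu>" shows "complex_of_real lam \<in> F_spectrum \<beta> T"
proof (rule ccontr)
  assume "complex_of_real lam \<notin> F_spectrum \<beta> T"
  then have "\<exists>R. F_bounded_op \<beta> R \<and> (\<forall>A\<in>F_space \<beta>.
      R (resolvent_map \<beta> T (of_real lam) A) = A \<and> resolvent_map \<beta> T (of_real lam) (R A) = A)"
    unfolding F_spectrum_def mem_Collect_eq not_not .
  then obtain R where R: "F_bounded_op \<beta> R" and inv: "\<forall>A\<in>F_space \<beta>.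
      R (resolvent_map \<beta> T (of_real lam) A) = A \<and> resolvent_map \<beta> T (of_real lam) (R A) = A"
    by (elim exE conjE) (rule that)
  have one: "cls \<beta> (\<lambda>_. 1) \<in> F_space \<beta>" using M_one by (simp add: cls_in_F)
  have "\<forall>A\<in>F_space \<beta>. R A \<in> F_space \<beta>"
    using R unfolding F_bounded_op_def F_linear_op_def by (elim conjE)
  then have "R (cls \<beta> (\<lambda>_. 1)) \<in> F_space \<beta>" using one by (rule bspec)
  then obtain f where f: "f \<in> M" "R (cls \<beta> (\<lambda>_. 1)) = cls \<beta> f" by (rule F_cases)
  have fF: "cls \<beta> f \<in> F_space \<beta>" "cls \<beta> (L f) \<in> F_space \<beta>" using f(1) L_M by (auto simp: cls_in_F)
  have dual: "\<nu> \<in> F_dual \<beta>" and T: "\<forall>A\<in>F_space \<beta>. \<nu> (T A) = of_real lam * \<nu> A"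
    and norm: "\<nu> (cls \<beta> (\<lambda>_. 1)) = 1"
    using assms unfolding conformal_pair_def by - (elim conjE, assumption)+
  have add: "\<forall>A\<in>F_space \<beta>. \<forall>B\<in>F_space \<beta>. \<nu> (qadd \<beta> A B) = \<nu> A + \<nu> B"
    and scale: "\<forall>c. \<forall>A\<in>F_space \<beta>. \<nu> (qscale \<beta> c A) = c * \<nu> A"
    using dual unfolding F_dual_def mem_Collect_eq by - (elim conjE, assumption)+
  note \<nu>_add = add[rule_format] and \<nu>_scale = scale[rule_format] and \<nu>_T = T[rule_format]
  have "cls \<beta> (\<lambda>_. 1) = cls \<beta> (op.A (of_real lam) f)"
    using conjunct2[OF bspec[OF inv one]] unfolding f(2) resolvent_cls[OF f(1)] by (rule sym)
  also have "op.A (of_real lam) f = cscale (of_real lam) f + cscale (- 1) (L f)"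
    by (simp add: op.A_def cscale_def fun_eq_iff)
  also have "cls \<beta> \<dots> = qadd \<beta> (cls \<beta> (cscale (of_real lam) f)) (cls \<beta> (cscale (- 1) (L f)))"
    using f(1) by (intro qadd_cls[symmetric] BV_cscale L_BV M_BV)
  also have "\<nu> \<dots> = \<nu> (cls \<beta> (cscale (of_real lam) f)) + \<nu> (cls \<beta> (cscale (- 1) (L f)))"
    using f(1) by (intro \<nu>_add) (simp_all only: cls_in_F M_scale L_M)
  also have "\<nu> (cls \<beta> (cscale (of_real lam) f)) = of_real lam * \<nu> (cls \<beta> f)"
    using \<nu>_scale[OF fF(1)] by (simp only: qscale_cscale[OF M_BV[OF f(1)]])
  also have "\<nu> (cls \<beta> (cscale (- 1) (L f))) = - 1 * \<nu> (cls \<beta> (L f))"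
    using \<nu>_scale[OF fF(2)] by (simp only: qscale_cscale[OF L_BV[OF M_BV[OF f(1)]]])
  also have "cls \<beta> (L f) = T (cls \<beta> f)"
    by (rule transfer_op_cls[OF M_BV[OF f(1)], symmetric])
  also have "\<nu> \<dots> = of_real lam * \<nu> (cls \<beta> f)" by (rule \<nu>_T[OF fF(1)])
  finally show False using norm by simp
qed

end

theorem theorem2p4:
  fixes \<beta> lam :: real and \<phi> :: "bseq \<Rightarrow> real" and \<nu> :: "bclass \<Rightarrow> complex"
  assumes "1 < \<beta>" and "\<beta> \<le> 2"
    and "cls \<beta> (\<lambda>x. complex_of_real (\<phi> x)) \<in> F_space \<beta>"
    and "beta_lipschitz \<beta> \<phi>"
    and "conformal_pair \<beta> \<phi> lam \<nu>"
    and "(\<lambda>n. sup_norm \<beta> (\<lambda>x. exp (birkhoff_sum n \<phi> x)) / lam ^ n) \<longlonglongrightarrow> 0"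
  shows "quasi_compact \<beta> \<phi> \<and>
    0 < lam \<and> isolated_eigenvalue_fin_mult \<beta> (transfer_op \<beta> \<phi>) (complex_of_real lam)"
proof -
  interpret beta_shift_space \<beta> by standard (fact assms)+
  interpret transfer_operator \<beta> \<phi>
    by standard (use assms(3) in \<open>simp only: cls_in_F\<close>)
  have iso: "isolated_eigenvalue_fin_mult \<beta> T z"
    if z: "z \<in> F_spectrum \<beta> T" "r_phi \<beta> \<phi> < ereal (cmod z)" for z
  proof -
    obtain \<rho> where "0 < \<rho>" "\<rho> < cmod z" "op.ess_bound \<rho>" using ess_bound_above_r_phi[OF z(2)] by blast
    then show ?thesis by (intro isolated_eigenvalue z)
  qed
  have lam: "0 < lam" using assms(5) by (simp add: conformal_pair_def)
  have "r_phi \<beta> \<phi> < ereal lam"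
    using assms(6) by (intro r_phi_less lam) (simp add: weight_sup_def)
  then have "isolated_eigenvalue_fin_mult \<beta> T (complex_of_real lam)"
    using lam by (intro iso conformal_in_spectrum[OF assms(5)]) simp
  then show ?thesis using iso lam by (simp add: quasi_compact_def)
qed

end
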